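(* Let $\{S_n\}_{n\ge0}$ be a generalized directionally reinforced random walk on $\mathbb Z^2$ with horizontal and vertical persistence time distributions $\nu_{\mathtt h},\nu_{\mathtt v}$ and U-turn probabilities $p_{\mathtt h},p_{\mathtt v}$, and let $\{H_n\}_{n\ge0}$ and $\{V_n\}_{n\ge0}$ be the associated independent one-dimensional random walks (all defined in the context). Then the origin is recurrent for $\{S_n\}_{n\ge0}$ if and only if $$\sum_{n=0}^\infty\mathbb P(H_{n+1}=0)\,\mathbb P(0\le V_n\le V_{n+1}-V_n)=\infty\quad\text{or}\quad\sum_{n=0}^\infty\mathbb P(V_{n+1}=0)\,\mathbb P(0\le H_n\le H_{n+1}-H_n)=\infty.$$
   Context: Generalized DRRW. Let $\nu_{\mathtt h},\nu_{\mathtt v}$ be probability distributions on $\{1,2,\dots\}$ and $p_{\mathtt h},p_{\mathtt v}\in[0,1)$. The walk $\{S_n\}_{n\ge0}$ on $\mathbb Z^2$, $S_0=0$, makes unit steps organized in successive straight runs; the $i$-th run ($i\ge1$) is in direction $D_i\in\{\mathtt e,\mathtt n,\mathtt w,\mathtt s\}$ (east, north, west, south) and has length (persistence time) $T_i$. The persistence times of horizontal runs ($D_i\in\{\mathtt e,\mathtt w\}$) are i.i.d. with law $\nu_{\mathtt h}$, those of vertical runs ($D_i\in\{\mathtt n,\mathtt s\}$) are i.i.d. with law $\nu_{\mathtt v}$, and all are independent of each other and of the sequence of directions. The sequence $(D_i)$ is a Markov chain: at the end of a horizontal run, the next direction is the opposite horizontal one (U-turn) with probability $p_{\mathtt h}$,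 and north or south with probability $p_{\mathtt n}=p_{\mathtt s}=(1-p_{\mathtt h})/2$ each; at the end of a vertical run, the next direction is the opposite vertical one with probability $p_{\mathtt v}$, and east or west with probability $p_{\mathtt e}=p_{\mathtt w}=(1-p_{\mathtt v})/2$ each. The initial time is a vertical-to-horizontal change of direction; by the standing normalization the last step before time $0$ is north and $D_1=\mathtt e$. The origin is recurrent for $\{S_n\}$ if $\mathbb P(S_n=0\text{ for infinitely many }n)=1$. Associated walks. Let $\varepsilon$ be a symmetric Rademacher variable ($\pm1$ with probability $1/2$), $G_{\mathtt h},G_{\mathtt v}$ geometric variables on $\{1,2,\dots\}$ with parameters $1-p_{\mathtt h}$ and $1-p_{\mathtt v}$, and $\{\tau^{\mathtt h}_k\}_{k\ge1}$, $\{\tau^{\mathtt v}_k\}_{k\ge1}$ i.i.d. sequences with laws $\nu_{\mathtt h}$ and $\nu_{\mathtt v}$, all independent. Then $\{H_n\}_{n\ge0}$ and $\{V_n\}_{n\ge0}$ are two independent random walks on $\mathbb Z$ started from $0$ with i.i.d. jumps distributed respectively as $$\varepsilon\sum_{k=1}^{G_{\mathtt h}}(-1)^{k-1}\tau^{\mathtt h}_k\quad\text{and}\quad\varepsilon\sum_{k=1}^{G_{\mathtt v}}(-1)^{k-1}\tau^{\mathtt v}_k.$$ *)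

theory Defs
  imports "HOL-Probability.Probability"
begin

datatype dir = East | North | West | South

fun horizontal :: "dir \<Rightarrow> bool" where
  "horizontal East = True"
| "horizontal West = True"
| "horizontal North = False"
| "horizontal South = False"

fun opposite :: "dir \<Rightarrow> dir" where
  "opposite East = West"
| "opposite West = East"
| "opposite North = South"
| "opposite South = North"

fun step :: "dir \<Rightarrow> int \<times> int" where
  "step East = (1, 0)"
| "step West = (-1, 0)"
| "step North = (0, 1)"
| "step South = (0, -1)"

definition turn_prob :: "real \<Rightarrow> real \<Rightarrow> dir \<Rightarrow> dir \<Rightarrow> real" where
  "turn_prob p\<^sub>h p\<^sub>v d d' =
    (let p = (if horizontal d then p\<^sub>h else p\<^sub>v) in
     if horizontal d' \<noteq> horizontal d then (1 - p) / 2
     else if d' = opposite d then p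
     else 0)"

text \<open>
  Runs are numbered from \<open>0\<close>: \<open>D i\<close> is the direction of the run with number \<open>i\<close>.
  The arguments \<open>\<tau>\<^sub>h k\<close> and \<open>\<tau>\<^sub>v k\<close> are the persistence times of the horizontal, respectively
  vertical, run that is preceded by exactly \<open>k\<close> runs of the same kind.
\<close>

definition run_length ::
  "(nat \<Rightarrow> 'a \<Rightarrow> dir) \<Rightarrow> (nat \<Rightarrow> 'a \<Rightarrow> nat) \<Rightarrow> (nat \<Rightarrow> 'a \<Rightarrow> nat) \<Rightarrow> nat \<Rightarrow> 'a \<Rightarrow> nat" where
  "run_length D \<tau>\<^sub>h \<tau>\<^sub>v i \<omega> =
    (let k = card {j. j < i \<and> horizontal (D j \<omega>) = horizontal (D i \<omega>)} in
     if horizontal (D i \<omega>) then \<tau>\<^sub>h k \<omega> else \<tau>\<^sub>v k \<omega>)"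

text \<open>The number of the run to which the step from time \<open>m\<close> to time \<open>m + 1\<close> belongs.\<close>

definition run_at ::
  "(nat \<Rightarrow> 'a \<Rightarrow> dir) \<Rightarrow> (nat \<Rightarrow> 'a \<Rightarrow> nat) \<Rightarrow> (nat \<Rightarrow> 'a \<Rightarrow> nat) \<Rightarrow> nat \<Rightarrow> 'a \<Rightarrow> nat" where
  "run_at D \<tau>\<^sub>h \<tau>\<^sub>v m \<omega> = (LEAST j. m < (\<Sum>i\<le>j. run_length D \<tau>\<^sub>h \<tau>\<^sub>v i \<omega>))"

definition drrw_walk ::
  "(nat \<Rightarrow> 'a \<Rightarrow> dir) \<Rightarrow> (nat \<Rightarrow> 'a \<Rightarrow> nat) \<Rightarrow> (nat \<Rightarrow> 'a \<Rightarrow> nat) \<Rightarrow> nat \<Rightarrow> 'a \<Rightarrow> int \<times> int" where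
  "drrw_walk D \<tau>\<^sub>h \<tau>\<^sub>v n \<omega> = (\<Sum>m<n. step (D (run_at D \<tau>\<^sub>h \<tau>\<^sub>v m \<omega>) \<omega>))"

locale drrw_parameters =
  fixes \<nu>\<^sub>h \<nu>\<^sub>v :: "nat pmf" and p\<^sub>h p\<^sub>v :: real
  assumes persistence_pos: "0 \<notin> set_pmf \<nu>\<^sub>h" "0 \<notin> set_pmf \<nu>\<^sub>v"
    and turn_range: "0 \<le> p\<^sub>h" "p\<^sub>h < 1" "0 \<le> p\<^sub>v" "p\<^sub>v < 1"

text \<open>
  In \<open>markov\<close>, the conditional probability of the next direction given the past is multiplied
  out, so that pasts of probability zero need no separate treatment.
\<close>

locale drrw = drrw_parameters \<nu>\<^sub>h \<nu>\<^sub>v p\<^sub>h p\<^sub>v + prob_space M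
  for M :: "'a measure" and \<nu>\<^sub>h \<nu>\<^sub>v :: "nat pmf" and p\<^sub>h p\<^sub>v :: real +
  fixes D :: "nat \<Rightarrow> 'a \<Rightarrow> dir" and \<tau>\<^sub>h \<tau>\<^sub>v :: "nat \<Rightarrow> 'a \<Rightarrow> nat"
  assumes D_rv: "\<And>i. random_variable (count_space UNIV) (D i)"
    and D_start: "AE \<omega> in M. D 0 \<omega> = East"
    and markov: "\<And>n (d :: nat \<Rightarrow> dir).
        prob {\<omega> \<in> space M. \<forall>i\<le>Suc n. D i \<omega> = d i} =
        prob {\<omega> \<in> space M. \<forall>i\<le>n. D i \<omega> = d i} * turn_prob p\<^sub>h p\<^sub>v (d n) (d (Suc n))"
    and \<tau>_indep: "indep_vars (\<lambda>_. count_space UNIV) (case_sum \<tau>\<^sub>h \<tau>\<^sub>v) UNIV"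
    and \<tau>h_law: "\<And>k. distr M (count_space UNIV) (\<tau>\<^sub>h k) = measure_pmf \<nu>\<^sub>h"
    and \<tau>v_law: "\<And>k. distr M (count_space UNIV) (\<tau>\<^sub>v k) = measure_pmf \<nu>\<^sub>v"
    and D_\<tau>_indep: "indep_set
        (sets (vimage_algebra (space M) (\<lambda>\<omega> i. D i \<omega>)
          (PiM UNIV (\<lambda>_. count_space UNIV))))
        (sets (vimage_algebra (space M) (\<lambda>\<omega> k. case_sum \<tau>\<^sub>h \<tau>\<^sub>v k \<omega>)
          (PiM UNIV (\<lambda>_. count_space UNIV))))"

definition origin_recurrent :: "'a measure \<Rightarrow> (nat \<Rightarrow> 'a \<Rightarrow> int \<times> int) \<Rightarrow> bool" where
  "origin_recurrent M S \<longleftrightarrow> measure M {\<omega> \<in> space M. infinite {n. S n \<omega> = (0, 0)}} = 1"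

text \<open>
  \<open>geometric_pmf\<close> lives on \<open>{0, 1, \<dots>}\<close>, hence the shift by \<open>Suc\<close>; \<open>\<tau> k\<close> is the \<open>(k + 1)\<close>-st
  persistence time, so the alternating sum starts with sign \<open>+\<close>.
\<close>

definition jump_pmf :: "nat pmf \<Rightarrow> real \<Rightarrow> int pmf" where
  "jump_pmf \<nu> p =
    do {
      \<epsilon> \<leftarrow> pmf_of_set {- 1, 1};
      G \<leftarrow> map_pmf Suc (geometric_pmf (1 - p));
      \<tau> \<leftarrow> Pi_pmf {..<G} 0 (\<lambda>_. \<nu>);
      return_pmf (\<epsilon> * (\<Sum>k<G. (- 1) ^ k * int (\<tau> k)))
    }"

locale associated_walks = drrw_parameters \<nu>\<^sub>h \<nu>\<^sub>v p\<^sub>h p\<^sub>v + prob_space M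
  for M :: "'b measure" and \<nu>\<^sub>h \<nu>\<^sub>v :: "nat pmf" and p\<^sub>h p\<^sub>v :: real +
  fixes H V :: "nat \<Rightarrow> 'b \<Rightarrow> int"
  assumes start: "\<And>\<omega>. \<omega> \<in> space M \<Longrightarrow> H 0 \<omega> = 0" "\<And>\<omega>. \<omega> \<in> space M \<Longrightarrow> V 0 \<omega> = 0"
    and jumps_indep: "indep_vars (\<lambda>_. count_space UNIV)
        (case_sum (\<lambda>n \<omega>. H (Suc n) \<omega> - H n \<omega>) (\<lambda>n \<omega>. V (Suc n) \<omega> - V n \<omega>)) UNIV"
    and H_jump_law: "\<And>n. distr M (count_space UNIV) (\<lambda>\<omega>. H (Suc n) \<omega> - H n \<omega>)
        = measure_pmf (jump_pmf \<nu>\<^sub>h p\<^sub>h)"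
    and V_jump_law: "\<And>n. distr M (count_space UNIV) (\<lambda>\<omega>. V (Suc n) \<omega> - V n \<omega>)
        = measure_pmf (jump_pmf \<nu>\<^sub>v p\<^sub>v)"

end

theory Submission
  imports Defs
begin

text \<open>
  A maximal string of horizontal runs followed by a maximal string of vertical runs forms a cycle.
  Up to conditioning on the first direction, the cycles are i.i.d. words, and the position after
  \<open>n\<close> cycles is \<open>(H n, V n)\<close>. By symmetry and because every run is the last one of its block with
  conditional probability \<open>1 - p\<close>, a vertical block hits the ordinate \<open>0\<close> with probability comparable
  to \<open>P (0 \<le> V n \<le> V (n + 1) - V n)\<close>; hence the two series are comparable to the expected numbers
  of vertical and of horizontal blocks that hit the origin, and convergence gives transience by
  Borel--Cantelli. For divergence, concentration of symmetric walks bounds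
  \<open>sup\<^sub>y P (y lies between V n and V (n + 1))\<close> by a multiple of the same probability, so that the
  events ``the origin is straddled'' satisfy the Kochen--Stone criterion, and a zero-one law for
  events of the walk \<open>(H, V)\<close> upgrades positive probability to probability one.
\<close>

section \<open>Symmetric random walks on the integers\<close>

text \<open>No moments are assumed, so no local limit theorem is at hand to compare probabilities at
  neighbouring times or levels; only symmetry and the positivity of single atoms are available.
  Parity is the recurring obstacle: a return may be impossible at odd times, and the concentration
  argument works at even times. Shifts of the time index are therefore paid for by one jump of least
  modulus (\<open>straddle_Suc\<close>) or by a return in two steps. The index \<open>n + 1\<close>
  in both series hides an asymmetry: in a cycle the horizontal block comes first, so the
  \<open>n\<close>-th horizontal block lives at ordinate \<open>V n\<close>, whereas the vertical
  block lives at abscissa \<open>H (n + 1)\<close>. The end of a cycle is visible only once the next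
  horizontal run has begun, and the walk starts east although a cycle starts east or west with
  probability 1/2. The runs are therefore compared in law with an i.i.d. stream of cycles
  conditioned to start east. An inequality between the two laws on every event suffices, because
  both have mass 1.\<close>

lemma emeasure_pair_pmf:
  "emeasure (measure_pmf (pair_pmf A B)) S =
    (\<integral>\<^sup>+x. emeasure (measure_pmf B) {y. (x, y) \<in> S} \<partial>measure_pmf A)"
  by (simp add: pair_pmf_def emeasure_bind_pmf nn_integral_return_pmf
      nn_integral_indicator[symmetric] nn_integral_bind_pmf indicator_def del: nn_integral_indicator)

lemma prob_pair_pmf_Times:
  "measure (measure_pmf (pair_pmf A B)) (S \<times> T) =
    measure (measure_pmf A) S * measure (measure_pmf B) T"
proof -
  have "emeasure (measure_pmf (pair_pmf A B)) (S \<times> T) =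
      (\<integral>\<^sup>+x. emeasure (measure_pmf B) T * indicator S x \<partial>measure_pmf A)"
    unfolding emeasure_pair_pmf by (intro nn_integral_cong) (auto simp: indicator_def)
  also have "\<dots> = emeasure (measure_pmf B) T * emeasure (measure_pmf A) S"
    by (simp add: nn_integral_cmult)
  finally show ?thesis
    by (simp add: measure_pmf.emeasure_eq_measure mult.commute flip: ennreal_mult'')
qed

text \<open>Over a general monoid, so that one definition serves \<open>H\<close>, \<open>V\<close>
  and the pair \<open>(H, V)\<close>.\<close>

primrec walk_pmf :: "'a::monoid_add pmf \<Rightarrow> nat \<Rightarrow> 'a pmf" where
  "walk_pmf \<mu> 0 = return_pmf 0"
| "walk_pmf \<mu> (Suc n) = map_pmf (\<lambda>(x, y). x + y) (pair_pmf \<mu> (walk_pmf \<mu> n))"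

lemma map_sum_list_replicate_pmf:
  "map_pmf sum_list (replicate_pmf n \<mu>) = walk_pmf \<mu> n"
proof (induction n)
  case (Suc n)
  show ?case
    unfolding walk_pmf.simps Suc.IH[symmetric]
    by (simp add: map_pmf_def pair_pmf_def bind_assoc_pmf bind_return_pmf)
qed simp

lemma walk_pmf_add:
  "walk_pmf \<mu> (m + n) = map_pmf (\<lambda>(x, y). x + y) (pair_pmf (walk_pmf \<mu> m) (walk_pmf \<mu> n))"
  by (induction m)
    (simp_all add: map_pmf_def pair_pmf_def bind_assoc_pmf bind_return_pmf add.assoc bind_return_pmf')

lemma walk_pmf_1 [simp]: "walk_pmf \<mu> (Suc 0) = \<mu>"
  by (simp add: map_pmf_def pair_pmf_def bind_assoc_pmf bind_return_pmf bind_return_pmf')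

lemma walk_pmf_map_additive:
  assumes "f 0 = 0" "\<And>x y. f (x + y) = f x + f y"
  shows "walk_pmf (map_pmf f \<mu>) n = map_pmf f (walk_pmf \<mu> n)"
  by (induction n) (simp_all add: assms map_pmf_def pair_pmf_def bind_assoc_pmf bind_return_pmf)

lemma walk_pmf_pair:
  "walk_pmf (pair_pmf \<mu> \<mu>') n = pair_pmf (walk_pmf \<mu> n) (walk_pmf \<mu>' n)"
proof (induction n)
  case 0
  then show ?case by (simp add: pair_return_pmf1 zero_prod_def)
next
  case (Suc n)
  have "walk_pmf (pair_pmf \<mu> \<mu>') (Suc n) =
    do {a \<leftarrow> \<mu>; b \<leftarrow> \<mu>'; x \<leftarrow> walk_pmf \<mu> n; y \<leftarrow> walk_pmf \<mu>' n; return_pmf (a + x, b + y)}"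
    unfolding walk_pmf.simps Suc.IH
    by (simp add: map_pmf_def pair_pmf_def bind_assoc_pmf bind_return_pmf)
  also have "\<dots> = do {a \<leftarrow> \<mu>; x \<leftarrow> walk_pmf \<mu> n; b \<leftarrow> \<mu>'; y \<leftarrow> walk_pmf \<mu>' n; return_pmf (a + x, b + y)}"
    by (subst bind_commute_pmf[of \<mu>']) simp
  also have "\<dots> = pair_pmf (walk_pmf \<mu> (Suc n)) (walk_pmf \<mu>' (Suc n))"
    by (simp add: map_pmf_def pair_pmf_def bind_assoc_pmf bind_return_pmf)
  finally show ?case .
qed

definition ret_prob :: "int pmf \<Rightarrow> nat \<Rightarrow> real" where
  "ret_prob \<mu> n = pmf (walk_pmf \<mu> n) 0"

text \<open>With x replaced by - x, which does not change the law of a symmetric walk, the event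
  says that the jump j leads from a point <= 0 to a point >= 0.\<close>

definition straddle_prob :: "int pmf \<Rightarrow> nat \<Rightarrow> real" where
  "straddle_prob \<mu> n =
    measure_pmf.prob (pair_pmf (walk_pmf \<mu> n) \<mu>) {(x, j). 0 \<le> x \<and> x \<le> j}"

definition weakly_between :: "int \<Rightarrow> int \<Rightarrow> int \<Rightarrow> bool" where
  "weakly_between y a b \<longleftrightarrow> a \<le> y \<and> y \<le> b \<or> b \<le> y \<and> y \<le> a"

locale symmetric_walk =
  fixes \<mu> :: "int pmf"
  assumes sym: "map_pmf uminus \<mu> = \<mu>"
begin

lemma walk_sym: "map_pmf uminus (walk_pmf \<mu> n) = walk_pmf \<mu> n"
  using walk_pmf_map_additive[of uminus \<mu> n] sym by simp

lemma pmf_sym: "pmf \<mu> (- x) = pmf \<mu> x"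
  using pmf_map_inj'[of uminus \<mu> x] sym by (simp add: inj_on_def)

lemma pair_sym1:
  "measure_pmf.prob (pair_pmf (walk_pmf \<mu> n) \<mu>) {(x, j). P (- x) j} =
   measure_pmf.prob (pair_pmf (walk_pmf \<mu> n) \<mu>) {(x, j). P x j}"
proof -
  have "measure_pmf.prob (pair_pmf (walk_pmf \<mu> n) \<mu>) {(x, j). P x j} =
      measure_pmf.prob (pair_pmf (map_pmf uminus (walk_pmf \<mu> n)) \<mu>) {(x, j). P x j}"
    by (simp add: walk_sym)
  also have "\<dots> = measure_pmf.prob (pair_pmf (walk_pmf \<mu> n) \<mu>) {(x, j). P (- x) j}"
    unfolding pair_map_pmf1 measure_map_pmf by (rule arg_cong[where f="measure _"]) auto
  finally show ?thesis by simp
qed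

lemma pair_sym2:
  "measure_pmf.prob (pair_pmf (walk_pmf \<mu> n) \<mu>) {(x, j). P x (- j)} =
   measure_pmf.prob (pair_pmf (walk_pmf \<mu> n) \<mu>) {(x, j). P x j}"
proof -
  have "measure_pmf.prob (pair_pmf (walk_pmf \<mu> n) \<mu>) {(x, j). P x j} =
      measure_pmf.prob (pair_pmf (walk_pmf \<mu> n) (map_pmf uminus \<mu>)) {(x, j). P x j}"
    by (simp add: sym)
  also have "\<dots> = measure_pmf.prob (pair_pmf (walk_pmf \<mu> n) \<mu>) {(x, j). P x (- j)}"
    unfolding pair_map_pmf2 measure_map_pmf by (rule arg_cong[where f="measure _"]) auto
  finally show ?thesis by simp
qed

text \<open>Reflecting the position or the jump turns an upward or a downward crossing into the
  event of \<open>straddle_prob\<close>. The two cases overlap when x = j = 0, whence an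
  inequality.\<close>

lemma between_0_le:
  "measure_pmf.prob (pair_pmf (walk_pmf \<mu> n) \<mu>) {(x, j). weakly_between 0 x (x + j)} \<le> 2 * straddle_prob \<mu> n"
proof -
  let ?P = "measure_pmf.prob (pair_pmf (walk_pmf \<mu> n) \<mu>)"
  have "?P {(x, j). weakly_between 0 x (x + j)} \<le> ?P ({(x, j). 0 \<le> - x \<and> - x \<le> j} \<union> {(x, j). 0 \<le> x \<and> x \<le> - j})"
    by (intro measure_pmf.finite_measure_mono) (auto simp: weakly_between_def)
  also have "\<dots> \<le> ?P {(x, j). 0 \<le> - x \<and> - x \<le> j} + ?P {(x, j). 0 \<le> x \<and> x \<le> - j}"
    by (rule measure_Un_le) auto
  also have "\<dots> = 2 * straddle_prob \<mu> n"
    unfolding straddle_prob_def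
    using pair_sym1[of n "\<lambda>x j. 0 \<le> x \<and> x \<le> j"] pair_sym2[of n "\<lambda>x j. 0 \<le> x \<and> x \<le> j"] by simp
  finally show ?thesis .
qed

lemma between_0_ge:
  "straddle_prob \<mu> n \<le> measure_pmf.prob (pair_pmf (walk_pmf \<mu> n) \<mu>) {(x, j). weakly_between 0 x (x + j)}"
proof -
  have "straddle_prob \<mu> n =
      measure_pmf.prob (pair_pmf (walk_pmf \<mu> n) \<mu>) {(x, j). 0 \<le> - x \<and> - x \<le> j}"
    using pair_sym1[of n "\<lambda>x j. 0 \<le> x \<and> x \<le> j"] by (simp add: straddle_prob_def)
  also have "\<dots> \<le> measure_pmf.prob (pair_pmf (walk_pmf \<mu> n) \<mu>) {(x, j). weakly_between 0 x (x + j)}"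
    by (intro measure_pmf.finite_measure_mono) (auto simp: weakly_between_def)
  finally show ?thesis .
qed

text \<open>The condition involves moduli only: if |x| <= |j|, the jump crosses 0 from x or from -
  x, and both starting points have the same law.\<close>

lemma abs_le_abs:
  "measure_pmf.prob (pair_pmf (walk_pmf \<mu> n) \<mu>) {(x, j). \<bar>x\<bar> \<le> \<bar>j\<bar>} \<le> 4 * straddle_prob \<mu> n"
proof -
  let ?P = "measure_pmf.prob (pair_pmf (walk_pmf \<mu> n) \<mu>)"
  let ?B = "{(x, j). weakly_between 0 x (x + j)}" and ?B' = "{(x, j). weakly_between 0 (- x) (- x + j)}"
  have "?P {(x, j). \<bar>x\<bar> \<le> \<bar>j\<bar>} \<le> ?P (?B \<union> ?B')"
    by (intro measure_pmf.finite_measure_mono) (auto simp: weakly_between_def)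
  also have "\<dots> \<le> ?P ?B + ?P ?B'"
    by (rule measure_Un_le) auto
  also have "\<dots> \<le> 4 * straddle_prob \<mu> n"
    using pair_sym1[of n "\<lambda>x j. weakly_between 0 x (x + j)"] between_0_le[of n] by simp
  finally show ?thesis .
qed

text \<open>Let \<open>m\<close> be the least modulus of a jump. An extra jump by \<open>- m\<close>
  carries x with 0 <= x <= j to x - m, whose modulus is still at most j because j >= m. The
  resulting event |x| <= |j| at time \<open>Suc n\<close> is reduced to \<open>straddle_prob\<close>
  by \<open>abs_le_abs\<close>, which costs the factor 4.\<close>

lemma straddle_Suc: "\<exists>c>0. \<forall>n. c * straddle_prob \<mu> n \<le> straddle_prob \<mu> (Suc n)"
proof -
  define m where "m = (LEAST k. \<exists>x\<in>set_pmf \<mu>. nat \<bar>x\<bar> = k)"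
  have ex: "\<exists>x\<in>set_pmf \<mu>. nat \<bar>x\<bar> = m" unfolding m_def
    by (rule LeastI_ex) (use set_pmf_not_empty[of \<mu>] in blast)
  have min: "int m \<le> \<bar>x\<bar>" if "x \<in> set_pmf \<mu>" for x
  proof -
    have "m \<le> nat \<bar>x\<bar>" unfolding m_def by (rule Least_le) (use that in blast)
    then show ?thesis by simp
  qed
  define z where "z = - int m"
  have z: "pmf \<mu> z > 0"
  proof -
    obtain x where x: "x \<in> set_pmf \<mu>" "nat \<bar>x\<bar> = m" using ex by auto
    then have "z = x \<or> z = - x" by (auto simp: z_def)
    then show ?thesis using x pmf_sym[of x] by (auto simp: pmf_positive)
  qed
  have "pmf \<mu> z / 4 * straddle_prob \<mu> n \<le> straddle_prob \<mu> (Suc n)" for n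
  proof -
    let ?W = "walk_pmf \<mu> n"
    let ?P = "measure_pmf.prob (pair_pmf \<mu> (pair_pmf ?W \<mu>))"
    have eq: "pair_pmf (walk_pmf \<mu> (Suc n)) \<mu> =
        map_pmf (\<lambda>(\<zeta>, x, j). (\<zeta> + x, j)) (pair_pmf \<mu> (pair_pmf ?W \<mu>))"
      by (simp add: map_pmf_def pair_pmf_def bind_assoc_pmf bind_return_pmf)
    have "pmf \<mu> z * straddle_prob \<mu> n = ?P ({z} \<times> {(x, j). 0 \<le> x \<and> x \<le> j})"
      by (simp add: prob_pair_pmf_Times straddle_prob_def measure_pmf_single)
    also have "\<dots> \<le> ?P {(\<zeta>, x, j). weakly_between 0 (\<zeta> + x) (\<zeta> + x + j) \<or> weakly_between 0 (- (\<zeta> + x)) (- (\<zeta> + x) + j)}"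
    proof (rule measure_pmf.finite_measure_mono_AE, intro AE_pmfI impI)
      fix w assume "w \<in> set_pmf (pair_pmf \<mu> (pair_pmf ?W \<mu>))" and w: "w \<in> {z} \<times> {(x, j). 0 \<le> x \<and> x \<le> j}"
      obtain \<zeta> x j where [simp]: "w = (\<zeta>, x, j)" by (cases w) auto
      have "int m \<le> \<bar>j\<bar>" using \<open>w \<in> set_pmf _\<close> min by auto
      with w show "w \<in> {(\<zeta>, x, j). weakly_between 0 (\<zeta> + x) (\<zeta> + x + j) \<or> weakly_between 0 (- (\<zeta> + x)) (- (\<zeta> + x) + j)}"
        by (auto simp: weakly_between_def z_def)
    qed auto
    also have "\<dots> = measure_pmf.prob (pair_pmf (walk_pmf \<mu> (Suc n)) \<mu>)
        {(x, j). 0 \<le> x \<and> x \<le> j \<or> 0 \<le> - x \<and> - x \<le> j \<or> 0 \<le> x \<and> x \<le> - j \<or> 0 \<le> - x \<and> - x \<le> - j}"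
      unfolding eq measure_map_pmf by (rule arg_cong[where f="measure _"]) (auto simp: weakly_between_def)
    also have "\<dots> \<le> 4 * straddle_prob \<mu> (Suc n)"
      by (rule order_trans[OF _ abs_le_abs])
        (rule measure_pmf.finite_measure_mono, auto)
    finally show ?thesis by simp
  qed
  then show ?thesis using z by (intro exI[of _ "pmf \<mu> z / 4"]) auto
qed


lemma ret_prob_mult_le: "ret_prob \<mu> m * ret_prob \<mu> n \<le> ret_prob \<mu> (m + n)"
proof -
  have "ret_prob \<mu> m * ret_prob \<mu> n =
      measure_pmf.prob (pair_pmf (walk_pmf \<mu> m) (walk_pmf \<mu> n)) ({0} \<times> {0})"
    by (simp add: ret_prob_def pmf_pair measure_pmf_single)
  also have "\<dots> \<le> measure_pmf.prob (walk_pmf \<mu> (m + n)) {0}"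
    unfolding walk_pmf_add measure_map_pmf by (intro measure_pmf.finite_measure_mono) auto
  finally show ?thesis by (simp add: ret_prob_def measure_pmf_single)
qed

text \<open>A jump followed by its reverse. If all jumps are odd, no odd time allows a return, so
  two is the least shift that is always available.\<close>

lemma ret_prob_2_pos: "0 < ret_prob \<mu> 2"
proof -
  obtain x where x: "x \<in> set_pmf \<mu>" using set_pmf_not_empty[of \<mu>] by blast
  have "0 < pmf \<mu> x * pmf \<mu> (- x)"
    using x by (simp add: pmf_sym pmf_positive)
  also have "\<dots> = measure_pmf.prob (pair_pmf \<mu> \<mu>) ({x} \<times> {- x})"
    by (simp add: pmf_pair measure_pmf_single)
  also have "\<dots> \<le> measure_pmf.prob (walk_pmf \<mu> (1 + 1)) {0}"
    unfolding walk_pmf_add One_nat_def walk_pmf_1 measure_map_pmf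
    by (intro measure_pmf.finite_measure_mono) auto
  finally show ?thesis by (simp add: ret_prob_def measure_pmf_single numeral_2_eq_2)
qed

end

text \<open>This is 2 a b <= a^2 + b^2 applied to \<open>pmf p x\<close> and
  \<open>pmf p (c - x)\<close>; the reflection of x to c - x shows that both squares have the same
  sum. Applied to cell numbers, it yields the concentration bound.\<close>

lemma prob_sum_eq_le:
  fixes p :: "int pmf"
  shows "measure_pmf.prob (pair_pmf p p) {(x, y). x + y = c} \<le>
    measure_pmf.prob (pair_pmf p p) {(x, y). x = y}"
proof -
  have eq: "emeasure (measure_pmf (pair_pmf p p)) {(x, y). y = f x} =
      (\<integral>\<^sup>+x. ennreal (pmf p x * pmf p (f x)) \<partial>count_space UNIV)" for f :: "int \<Rightarrow> int"
    unfolding emeasure_pair_pmf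
    by (simp add: nn_integral_measure_pmf emeasure_pmf_single ennreal_mult)
  have "emeasure (measure_pmf (pair_pmf p p)) {(x, y). x + y = c} =
      emeasure (measure_pmf (pair_pmf p p)) {(x, y). y = c - x}"
    by (rule arg_cong[where f="emeasure _"]) auto
  also have "\<dots> = (\<integral>\<^sup>+x. ennreal (pmf p x * pmf p (c - x)) \<partial>count_space UNIV)"
    by (rule eq)
  also have "\<dots> \<le> (\<integral>\<^sup>+x. ennreal (pmf p x * pmf p x / 2) + ennreal (pmf p (c - x) * pmf p (c - x) / 2) \<partial>count_space UNIV)"
  proof (rule nn_integral_mono)
    fix x
    have "pmf p x * pmf p (c - x) \<le> pmf p x * pmf p x / 2 + pmf p (c - x) * pmf p (c - x) / 2"
      using sum_squares_bound[of "pmf p x" "pmf p (c - x)"] by (simp add: power2_eq_square)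
    then show "ennreal (pmf p x * pmf p (c - x)) \<le>
        ennreal (pmf p x * pmf p x / 2) + ennreal (pmf p (c - x) * pmf p (c - x) / 2)"
      by (simp flip: ennreal_plus)
  qed
  also have "\<dots> = (\<integral>\<^sup>+x. ennreal (pmf p x * pmf p x / 2) \<partial>count_space UNIV) +
      (\<integral>\<^sup>+x. ennreal (pmf p (c - x) * pmf p (c - x) / 2) \<partial>count_space UNIV)"
    by (rule nn_integral_add) auto
  also have "(\<integral>\<^sup>+x. ennreal (pmf p (c - x) * pmf p (c - x) / 2) \<partial>count_space UNIV) =
      (\<integral>\<^sup>+x. ennreal (pmf p x * pmf p x / 2) \<partial>count_space UNIV)"
    by (rule nn_integral_bij_count_space[where g="\<lambda>x. c - x" and f="\<lambda>x. ennreal (pmf p x * pmf p x / 2)"])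
      (rule bij_betw_byWitness[where f'="\<lambda>x. c - x"], auto)
  also have "(\<integral>\<^sup>+x. ennreal (pmf p x * pmf p x / 2) \<partial>count_space UNIV) +
      (\<integral>\<^sup>+x. ennreal (pmf p x * pmf p x / 2) \<partial>count_space UNIV) =
      (\<integral>\<^sup>+x. ennreal (pmf p x * pmf p x / 2) + ennreal (pmf p x * pmf p x / 2) \<partial>count_space UNIV)"
    by (rule nn_integral_add[symmetric]) auto
  also have "\<dots> = (\<integral>\<^sup>+x. ennreal (pmf p x * pmf p x) \<partial>count_space UNIV)"
    by (simp flip: ennreal_plus)
  also have "\<dots> = emeasure (measure_pmf (pair_pmf p p)) {(x, y). y = x}"
    by (rule eq[symmetric])
  also have "\<dots> = emeasure (measure_pmf (pair_pmf p p)) {(x, y). x = y}"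
    by (rule arg_cong[where f="emeasure _"]) auto
  finally show ?thesis by (simp add: measure_pmf.emeasure_eq_measure)
qed

section \<open>Concentration: crossing probabilities, uniformly in the level\<close>

context symmetric_walk
begin

text \<open>Partition the integers into cells of length \<open>L + 1\<close>: if two independent summands add up to an
  element of a fixed interval of length \<open>L\<close>, then the cell of one summand determines that of the
  other up to three choices.\<close>

lemma interval_prob_le:
  "measure_pmf.prob (walk_pmf \<mu> (n + n)) {y..y + int L} \<le>
    3 * measure_pmf.prob (walk_pmf \<mu> (n + n)) {x. \<bar>x\<bar> \<le> int L}"
proof -
  let ?W = "walk_pmf \<mu> n"
  let ?P = "measure_pmf.prob (pair_pmf ?W ?W)"
  define M where "M = int L + 1"
  have M: "M > 0" by (simp add: M_def)
  define b where "b = y div M"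
  let ?E = "\<lambda>e. {(u, v). u div M + v div M = b + e}"
  \<comment> \<open>The cell numbers of the two halves are i.i.d., so a prescribed sum is no
    likelier than equality. Equal cells force |u - v| <= L, and by symmetry of the second half u - v
    has the law of u + v. This is why the time is \<open>n + n\<close>.\<close>
  have cell: "?P (?E e) \<le> measure_pmf.prob (walk_pmf \<mu> (n + n)) {x. \<bar>x\<bar> \<le> int L}" for e
  proof -
    let ?p = "map_pmf (\<lambda>u. u div M) ?W"
    have pp: "pair_pmf ?p ?p = map_pmf (\<lambda>(a, b). (a div M, b div M)) (pair_pmf ?W ?W)"
      by (rule map_pair[symmetric])
    have "?P (?E e) = measure_pmf.prob (pair_pmf ?p ?p) {(x, y). x + y = b + e}"
      unfolding pp measure_map_pmf by (rule arg_cong[where f="measure _"]) auto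
    also have "\<dots> \<le> measure_pmf.prob (pair_pmf ?p ?p) {(x, y). x = y}"
      by (rule prob_sum_eq_le)
    also have "\<dots> = ?P {(u, v). u div M = v div M}"
      unfolding pp measure_map_pmf by (rule arg_cong[where f="measure _"]) auto
    also have "\<dots> \<le> ?P {(u, v). \<bar>u + - v\<bar> \<le> int L}"
    proof (rule measure_pmf.finite_measure_mono, safe)
      fix u v assume *: "u div M = v div M"
      have "u - v = u mod M - v mod M"
        using minus_div_mult_eq_mod[of u M] minus_div_mult_eq_mod[of v M] * by simp
      moreover have "0 \<le> u mod M" "u mod M < M" "0 \<le> v mod M" "v mod M < M" using M by simp_all
      ultimately show "\<bar>u + - v\<bar> \<le> int L" unfolding M_def by linarith
    qed auto
    also have "\<dots> = measure_pmf.prob (pair_pmf ?W (map_pmf uminus ?W)) {(u, v). \<bar>u + v\<bar> \<le> int L}"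
      unfolding pair_map_pmf2 measure_map_pmf by (rule arg_cong[where f="measure _"]) auto
    also have "\<dots> = measure_pmf.prob (walk_pmf \<mu> (n + n)) {x. \<bar>x\<bar> \<le> int L}"
      unfolding walk_sym walk_pmf_add measure_map_pmf by (rule arg_cong[where f="measure _"]) auto
    finally show ?thesis .
  qed
  have "measure_pmf.prob (walk_pmf \<mu> (n + n)) {y..y + int L} = ?P {(u, v). y \<le> u + v \<and> u + v \<le> y + int L}"
    unfolding walk_pmf_add measure_map_pmf by (rule arg_cong[where f="measure _"]) auto
  also have "\<dots> \<le> ?P ((?E (-1) \<union> ?E 0) \<union> ?E 1)"
  proof (rule measure_pmf.finite_measure_mono, safe)
    fix u v assume *: "y \<le> u + v" "u + v \<le> y + int L" and n0: "u div M + v div M \<noteq> b + 0"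
      and n1: "u div M + v div M \<noteq> b + 1"
    \<comment> \<open>The three remainders and u + v - y all lie in [0, M), so the sum of the cell
      numbers differs from \<open>b\<close> by less than 2.\<close>
    have "(u div M + v div M - b) * M = (u + v - y) - u mod M - v mod M + y mod M"
      unfolding b_def left_diff_distrib distrib_right
      using minus_div_mult_eq_mod[of u M] minus_div_mult_eq_mod[of v M] minus_div_mult_eq_mod[of y M]
      by linarith
    moreover have "0 \<le> u mod M" "u mod M < M" "0 \<le> v mod M" "v mod M < M" "0 \<le> y mod M" "y mod M < M"
      using M by simp_all
    moreover have "u + v - y < M" "0 \<le> u + v - y" using * by (simp_all add: M_def)
    ultimately have "(u div M + v div M - b) * M < 2 * M" "(- 2) * M < (u div M + v div M - b) * M"
      by linarith+
    then have "u div M + v div M - b < 2" "-2 < u div M + v div M - b"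
      using M by (simp_all only: mult_less_cancel_right_pos)
    then show "u div M + v div M = b + - 1" using n0 n1 by linarith
  qed auto
  also have "\<dots> \<le> (?P (?E (-1)) + ?P (?E 0)) + ?P (?E 1)"
    by (intro order_trans[OF measure_Un_le] add_right_mono measure_Un_le) auto
  also have "\<dots> \<le> 3 * measure_pmf.prob (walk_pmf \<mu> (n + n)) {x. \<bar>x\<bar> \<le> int L}"
    using cell[of "-1"] cell[of 0] cell[of 1] by simp
  finally show ?thesis .
qed

lemma emeasure_pair_commute:
  "emeasure (measure_pmf (pair_pmf A B)) S =
    (\<integral>\<^sup>+y. emeasure (measure_pmf A) {x. (x, y) \<in> S} \<partial>measure_pmf B)"
  by (subst pair_commute_pmf) (simp add: emeasure_pair_pmf del: emeasure_bind_pmf)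

text \<open>For a fixed jump \<open>j\<close>, the level \<open>y\<close> is crossed only if the
  starting point lies in an interval of length |j|; \<open>interval_prob_le\<close> moves that
  interval to 0, and \<open>abs_le_abs\<close> applies after averaging over \<open>j\<close>. The
  constant is 3 * 4.\<close>

lemma between_le_even:
  "measure_pmf.prob (pair_pmf (walk_pmf \<mu> (n + n)) \<mu>) {(x, j). weakly_between y x (x + j)} \<le>
    12 * straddle_prob \<mu> (n + n)"
proof -
  let ?W = "walk_pmf \<mu> (n + n)"
  have "emeasure (measure_pmf (pair_pmf ?W \<mu>)) {(x, j). weakly_between y x (x + j)} =
      (\<integral>\<^sup>+j. emeasure (measure_pmf ?W) {x. weakly_between y x (x + j)} \<partial>measure_pmf \<mu>)"
    unfolding emeasure_pair_commute by simp
  also have "\<dots> \<le> (\<integral>\<^sup>+j. 3 * emeasure (measure_pmf ?W) {x. \<bar>x\<bar> \<le> \<bar>j\<bar>} \<partial>measure_pmf \<mu>)"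
  proof (rule nn_integral_mono)
    fix j
    define z where "z = (if 0 \<le> j then y - j else y)"
    have "measure_pmf.prob ?W {x. weakly_between y x (x + j)} \<le> measure_pmf.prob ?W {z..z + int (nat \<bar>j\<bar>)}"
      by (rule measure_pmf.finite_measure_mono) (auto simp: weakly_between_def z_def)
    also have "\<dots> \<le> 3 * measure_pmf.prob ?W {x. \<bar>x\<bar> \<le> int (nat \<bar>j\<bar>)}"
      by (rule interval_prob_le)
    finally have "ennreal (measure_pmf.prob ?W {x. weakly_between y x (x + j)}) \<le>
        ennreal (3 * measure_pmf.prob ?W {x. \<bar>x\<bar> \<le> \<bar>j\<bar>})" by (intro ennreal_leI) simp
    then show "emeasure (measure_pmf ?W) {x. weakly_between y x (x + j)} \<le> 3 * emeasure (measure_pmf ?W) {x. \<bar>x\<bar> \<le> \<bar>j\<bar>}"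
      by (simp add: measure_pmf.emeasure_eq_measure ennreal_mult)
  qed
  also have "\<dots> = 3 * emeasure (measure_pmf (pair_pmf ?W \<mu>)) {(x, j). \<bar>x\<bar> \<le> \<bar>j\<bar>}"
    unfolding emeasure_pair_commute by (subst nn_integral_cmult) auto
  also have "\<dots> = ennreal (3 * measure_pmf.prob (pair_pmf ?W \<mu>) {(x, j). \<bar>x\<bar> \<le> \<bar>j\<bar>})"
    by (simp add: measure_pmf.emeasure_eq_measure ennreal_mult)
  finally have "measure_pmf.prob (pair_pmf ?W \<mu>) {(x, j). weakly_between y x (x + j)} \<le>
      3 * measure_pmf.prob (pair_pmf ?W \<mu>) {(x, j). \<bar>x\<bar> \<le> \<bar>j\<bar>}"
    by (simp add: measure_pmf.emeasure_eq_measure)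
  with abs_le_abs[of "n + n"] show ?thesis by simp
qed

lemma straddle_prob_nonneg: "0 \<le> straddle_prob \<mu> n"
  by (simp add: straddle_prob_def)

text \<open>At odd times the first jump is split off. It only shifts \<open>y\<close>, which the
  uniform bound absorbs, and \<open>straddle_Suc\<close> carries the bound from the even time to the
  odd one.\<close>

lemma between_le:
  "\<exists>C>0. \<forall>n y. measure_pmf.prob (pair_pmf (walk_pmf \<mu> n) \<mu>) {(x, j). weakly_between y x (x + j)} \<le>
    C * straddle_prob \<mu> n"
proof -
  obtain c where c: "c > 0" "\<And>n. c * straddle_prob \<mu> n \<le> straddle_prob \<mu> (Suc n)"
    using straddle_Suc by auto
  let ?P = "\<lambda>n y. measure_pmf.prob (pair_pmf (walk_pmf \<mu> n) \<mu>) {(x, j). weakly_between y x (x + j)}"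
  have odd: "?P (Suc (n + n)) y \<le> 12 / c * straddle_prob \<mu> (Suc (n + n))" for n y
  proof -
    let ?W = "walk_pmf \<mu> (n + n)"
    have eq: "pair_pmf (walk_pmf \<mu> (Suc (n + n))) \<mu> =
        map_pmf (\<lambda>(\<zeta>, x, j). (\<zeta> + x, j)) (pair_pmf \<mu> (pair_pmf ?W \<mu>))"
      by (simp add: map_pmf_def pair_pmf_def bind_assoc_pmf bind_return_pmf)
    have "emeasure (measure_pmf (pair_pmf (walk_pmf \<mu> (Suc (n + n))) \<mu>)) {(x, j). weakly_between y x (x + j)} =
        (\<integral>\<^sup>+\<zeta>. emeasure (measure_pmf (pair_pmf ?W \<mu>)) {(x, j). weakly_between (y - \<zeta>) x (x + j)} \<partial>measure_pmf \<mu>)"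
      unfolding eq emeasure_map_pmf emeasure_pair_pmf[of \<mu>]
      by (intro nn_integral_cong arg_cong[where f="emeasure _"]) (auto simp: weakly_between_def)
    also have "\<dots> \<le> (\<integral>\<^sup>+\<zeta>. ennreal (12 * straddle_prob \<mu> (n + n)) \<partial>measure_pmf \<mu>)"
      unfolding measure_pmf.emeasure_eq_measure
      by (intro nn_integral_mono ennreal_leI between_le_even)
    also have "\<dots> = ennreal (12 * straddle_prob \<mu> (n + n))"
      by simp
    finally have "?P (Suc (n + n)) y \<le> 12 * straddle_prob \<mu> (n + n)"
      by (simp add: measure_pmf.emeasure_eq_measure straddle_prob_nonneg)
    also have "12 * straddle_prob \<mu> (n + n) \<le> 12 / c * straddle_prob \<mu> (Suc (n + n))"
      using c(2)[of "n + n"] c(1) by (simp add: field_simps)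
    finally show ?thesis .
  qed
  have "?P n y \<le> (12 + 12 / c) * straddle_prob \<mu> n" for n y
  proof -
    have nn: "0 \<le> 12 / c * straddle_prob \<mu> n" "0 \<le> 12 * straddle_prob \<mu> n"
      using c(1) straddle_prob_nonneg[of n] by simp_all
    consider k where "n = k + k" | k where "n = Suc (k + k)"
      by (metis evenE oddE mult_2 Suc_eq_plus1)
    then show ?thesis
    proof cases
      case 1
      then show ?thesis using between_le_even[of k y] nn by (simp add: distrib_right)
    next
      case 2
      then show ?thesis using odd[of k y] nn by (simp add: distrib_right)
    qed
  qed
  then show ?thesis using c(1) by (intro exI[of _ "12 + 12 / c"]) (auto simp: add_pos_pos)
qed

end

section \<open>Blocks of runs and their jumps\<close>

fun altsum :: "int \<Rightarrow> nat list \<Rightarrow> int" where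
  "altsum \<epsilon> [] = 0"
| "altsum \<epsilon> (l # ls) = \<epsilon> * int l + altsum (- \<epsilon>) ls"

fun line_hit :: "int \<Rightarrow> int \<Rightarrow> nat list \<Rightarrow> bool" where
  "line_hit x \<epsilon> [] \<longleftrightarrow> False"
| "line_hit x \<epsilon> (l # ls) \<longleftrightarrow>
    weakly_between 0 x (x + \<epsilon> * int l) \<or> line_hit (x + \<epsilon> * int l) (- \<epsilon>) ls"

definition runs_pmf :: "nat pmf \<Rightarrow> real \<Rightarrow> nat list pmf" where
  "runs_pmf \<nu> p = do {G \<leftarrow> map_pmf Suc (geometric_pmf (1 - p)); replicate_pmf G \<nu>}"

definition block_pmf :: "nat pmf \<Rightarrow> real \<Rightarrow> (int \<times> nat list) pmf" where
  "block_pmf \<nu> p = pair_pmf (pmf_of_set {- 1, 1}) (runs_pmf \<nu> p)"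

lemma altsum_uminus: "altsum (- \<epsilon>) ls = - altsum \<epsilon> ls"
  by (induction ls arbitrary: \<epsilon>) auto

lemma altsum_eq_sum: "altsum \<epsilon> ls = \<epsilon> * (\<Sum>k<length ls. (- 1) ^ k * int (ls ! k))"
proof (induction ls arbitrary: \<epsilon>)
  case (Cons l ls)
  show ?case
    by (simp add: Cons.IH sum.lessThan_Suc_shift sum_negf algebra_simps del: sum.lessThan_Suc)
qed simp

text \<open>If 0 is not between x and y, both lie strictly on the same side of 0.\<close>

lemma between_0_shift:
  "\<not> weakly_between 0 x y \<Longrightarrow> weakly_between 0 x z \<longleftrightarrow> weakly_between 0 y z"
  by (auto simp: weakly_between_def)

text \<open>A discrete intermediate value property: as long as a run misses 0,
  \<open>between_0_shift\<close> moves the starting point to its end without losing the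
  crossing.\<close>

lemma line_hit_if_between:
  "ls \<noteq> [] \<Longrightarrow> weakly_between 0 x (x + altsum \<epsilon> ls) \<Longrightarrow> line_hit x \<epsilon> ls"
proof (induction ls arbitrary: x \<epsilon>)
  case (Cons l ls)
  show ?case
  proof (cases "weakly_between 0 x (x + \<epsilon> * int l)")
    case False
    then have "weakly_between 0 (x + \<epsilon> * int l) (x + \<epsilon> * int l + altsum (- \<epsilon>) ls)"
      using Cons.prems(2) between_0_shift[OF False] by (simp add: add.assoc)
    moreover from this have "ls \<noteq> []" using False Cons.prems(2) by auto
    ultimately show ?thesis using Cons.IH by simp
  qed simp
qed simp

lemma map_Pi_pmf_replicate:
  "map_pmf (\<lambda>f. map f [0..<n]) (Pi_pmf {..<n} d (\<lambda>_. \<nu>)) = replicate_pmf n \<nu>"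
proof (induction n)
  case (Suc n)
  have "map_pmf (\<lambda>f. map f [0..<Suc n]) (Pi_pmf {..<Suc n} d (\<lambda>_. \<nu>)) =
      do {y \<leftarrow> \<nu>; f \<leftarrow> Pi_pmf {..<n} d (\<lambda>_. \<nu>); return_pmf (map f [0..<n] @ [y])}"
    unfolding lessThan_Suc
    by (subst Pi_pmf_insert')
      (auto simp: map_bind_pmf map_pmf_def bind_assoc_pmf bind_return_pmf intro!: bind_pmf_cong)
  also have "\<dots> = do {y \<leftarrow> \<nu>; xs \<leftarrow> replicate_pmf n \<nu>; return_pmf (xs @ [y])}"
    unfolding Suc.IH[symmetric] by (simp add: bind_map_pmf)
  also have "\<dots> = do {xs \<leftarrow> replicate_pmf n \<nu>; y \<leftarrow> \<nu>; return_pmf (xs @ [y])}"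
    by (rule bind_commute_pmf)
  also have "\<dots> = replicate_pmf (n + 1) \<nu>"
    unfolding replicate_pmf_distrib replicate_pmf_1 by (simp add: bind_map_pmf)
  finally show ?case by simp
qed simp

text \<open>The jump is the endpoint of a block. The block also remembers the path, which is needed
  for hits in its interior.\<close>

lemma map_altsum_block_pmf: "map_pmf (\<lambda>(\<epsilon>, ls). altsum \<epsilon> ls) (block_pmf \<nu> p) = jump_pmf \<nu> p"
proof -
  have *: "map_pmf (altsum \<epsilon>) (replicate_pmf n \<nu>) =
      do {\<tau> \<leftarrow> Pi_pmf {..<n} 0 (\<lambda>_. \<nu>); return_pmf (\<epsilon> * (\<Sum>k<n. (- 1) ^ k * int (\<tau> k)))}" for \<epsilon> n
    unfolding map_Pi_pmf_replicate[symmetric, where d=0]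
    by (simp add: altsum_eq_sum map_pmf_def bind_assoc_pmf bind_return_pmf)
  show ?thesis
    unfolding jump_pmf_def block_pmf_def pair_pmf_def runs_pmf_def *[symmetric]
    by (simp add: map_pmf_def bind_assoc_pmf bind_return_pmf)
qed

lemma symmetric_walk_jump: "symmetric_walk (jump_pmf \<nu> p)"
proof
  have "map_pmf uminus (pmf_of_set {- 1, 1 :: int}) = pmf_of_set (uminus ` {- 1, 1})"
    by (rule map_pmf_of_set_inj) auto
  then have *: "map_pmf uminus (pmf_of_set {- 1, 1 :: int}) = pmf_of_set {- 1, 1}"
    by (simp add: insert_commute)
  have "map_pmf uminus (jump_pmf \<nu> p) = map_pmf (\<lambda>(\<epsilon>, ls). altsum \<epsilon> ls)
      (pair_pmf (map_pmf uminus (pmf_of_set {- 1, 1})) (runs_pmf \<nu> p))"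
    unfolding map_altsum_block_pmf[symmetric] block_pmf_def pair_map_pmf1 pmf.map_comp
    by (rule map_pmf_cong) (auto simp: altsum_uminus)
  then show "map_pmf uminus (jump_pmf \<nu> p) = jump_pmf \<nu> p"
    unfolding * by (simp add: map_altsum_block_pmf flip: block_pmf_def)
qed

text \<open>Memorylessness of the geometric law: after its first run a block stops with probability
  \<open>1 - p\<close> or begins afresh.\<close>

lemma runs_pmf_unfold:
  assumes "0 \<le> p" "p < 1"
  shows "runs_pmf \<nu> p = do {l \<leftarrow> \<nu>; b \<leftarrow> bernoulli_pmf (1 - p);
    if b then return_pmf [l] else map_pmf (Cons l) (runs_pmf \<nu> p)}"
proof -
  have *: "geometric_pmf (1 - p) = do {b \<leftarrow> bernoulli_pmf (1 - p);
      if b then return_pmf 0 else map_pmf Suc (geometric_pmf (1 - p))}"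
    by (rule geometric_bind_pmf_unfold) (use assms in auto)
  have "runs_pmf \<nu> p = do {b \<leftarrow> bernoulli_pmf (1 - p);
      if b then replicate_pmf 1 \<nu>
      else do {G \<leftarrow> geometric_pmf (1 - p); replicate_pmf (Suc (Suc G)) \<nu>}}"
    unfolding runs_pmf_def by (subst *)
      (auto simp: map_bind_pmf bind_assoc_pmf bind_map_pmf bind_return_pmf intro!: bind_pmf_cong)
  also have "\<dots> = do {b \<leftarrow> bernoulli_pmf (1 - p);
      l \<leftarrow> \<nu>; if b then return_pmf [l] else map_pmf (Cons l) (runs_pmf \<nu> p)}"
  proof (intro bind_pmf_cong refl)
    fix b
    have "do {G \<leftarrow> geometric_pmf (1 - p); replicate_pmf (Suc (Suc G)) \<nu>} =
        do {l \<leftarrow> \<nu>; G \<leftarrow> geometric_pmf (1 - p); xs \<leftarrow> replicate_pmf (Suc G) \<nu>; return_pmf (l # xs)}"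
      unfolding replicate_pmf.simps(2)[of "Suc _"] by (rule bind_commute_pmf)
    then show "(if b then replicate_pmf 1 \<nu>
        else do {G \<leftarrow> geometric_pmf (1 - p); replicate_pmf (Suc (Suc G)) \<nu>}) =
      do {l \<leftarrow> \<nu>; if b then return_pmf [l] else map_pmf (Cons l) (runs_pmf \<nu> p)}"
      by (auto simp: map_pmf_def runs_pmf_def bind_assoc_pmf bind_return_pmf
        simp del: replicate_pmf.simps(2) simp flip: replicate_pmf_1)
       (simp add: bind_return_pmf)
  qed
  also have "\<dots> = do {l \<leftarrow> \<nu>; b \<leftarrow> bernoulli_pmf (1 - p);
    if b then return_pmf [l] else map_pmf (Cons l) (runs_pmf \<nu> p)}"
    by (rule bind_commute_pmf)
  finally show ?thesis .
qed

lemma emeasure_runs_pmf_unfold: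
  assumes "0 \<le> p" "p < 1"
  shows "emeasure (measure_pmf (runs_pmf \<nu> p)) A =
    (\<integral>\<^sup>+l. ennreal (1 - p) * indicator A [l] +
      ennreal p * emeasure (measure_pmf (runs_pmf \<nu> p)) {ls. l # ls \<in> A} \<partial>measure_pmf \<nu>)"
  by (subst runs_pmf_unfold[OF assms])
    (use assms in \<open>auto intro!: nn_integral_cong simp: vimage_def mult.commute\<close>)

text \<open>The run hitting \<open>0\<close> for the first time is the last run of its block with probability
  \<open>1 - p\<close>, and then \<open>0\<close> lies weakly_between the endpoints of the block. Hence the defect
  \<open>(1 - p) P(hit) - P(0 weakly_between endpoints)\<close> is contracted by the factor \<open>p\<close> with each run.\<close>

lemma line_hit_le:
  assumes p: "0 \<le> p" "p < 1"
  shows "(1 - p) * measure_pmf.prob (runs_pmf \<nu> p) {ls. line_hit x \<epsilon> ls} \<le>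
    measure_pmf.prob (runs_pmf \<nu> p) {ls. weakly_between 0 x (x + altsum \<epsilon> ls)}"
proof -
  let ?E = "emeasure (measure_pmf (runs_pmf \<nu> p))"
  let ?f = "\<lambda>x \<epsilon>. ?E {ls. line_hit x \<epsilon> ls}"
  let ?g = "\<lambda>x \<epsilon>. ?E {ls. weakly_between 0 x (x + altsum \<epsilon> ls)}"
  \<comment> \<open>The defect is at most 1. A first run that meets 0 leaves no defect, and one that
    misses 0 multiplies it by \<open>p\<close>; after \<open>n\<close> runs the error is
    \<open>p ^ n\<close>.\<close>
  have "ennreal (1 - p) * ?f x \<epsilon> \<le> ?g x \<epsilon> + ennreal (p ^ n)" for n
  proof (induction n arbitrary: x \<epsilon>)
    case 0
    have "ennreal (1 - p) * ?f x \<epsilon> \<le> 1 * 1"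
      using p by (intro mult_mono measure_pmf.emeasure_le_1) auto
    then show ?case by (simp add: add_increasing)
  next
    case (Suc n)
    let ?y = "\<lambda>l. x + \<epsilon> * int l"
    have f: "?f x \<epsilon> = (\<integral>\<^sup>+l. (if weakly_between 0 x (?y l) then 1 else ennreal p * ?f (?y l) (- \<epsilon>)) \<partial>measure_pmf \<nu>)"
      unfolding emeasure_runs_pmf_unfold[OF p, of _ "{ls. line_hit x \<epsilon> ls}"]
      using p by (intro nn_integral_cong) (auto simp flip: ennreal_plus)
    have "ennreal (1 - p) * ?f x \<epsilon> = (\<integral>\<^sup>+l. ennreal (1 - p) *
        (if weakly_between 0 x (?y l) then 1 else ennreal p * ?f (?y l) (- \<epsilon>)) \<partial>measure_pmf \<nu>)"
      unfolding f by (rule nn_integral_cmult[symmetric]) auto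
    also have "\<dots> \<le> (\<integral>\<^sup>+l. (if weakly_between 0 x (?y l) then ennreal (1 - p) else ennreal p * ?g (?y l) (- \<epsilon>)) +
        ennreal (p ^ Suc n) \<partial>measure_pmf \<nu>)"
    proof (rule nn_integral_mono)
      fix l
      have "ennreal (1 - p) * (ennreal p * ?f (?y l) (- \<epsilon>)) = ennreal p * (ennreal (1 - p) * ?f (?y l) (- \<epsilon>))"
        by (simp add: ac_simps)
      also have "\<dots> \<le> ennreal p * (?g (?y l) (- \<epsilon>) + ennreal (p ^ n))"
        by (intro mult_left_mono Suc.IH) auto
      also have "\<dots> = ennreal p * ?g (?y l) (- \<epsilon>) + ennreal (p ^ Suc n)"
        using p by (simp add: distrib_left ennreal_mult)
      finally show "ennreal (1 - p) * (if weakly_between 0 x (?y l) then 1 else ennreal p * ?f (?y l) (- \<epsilon>)) \<le>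
        (if weakly_between 0 x (?y l) then ennreal (1 - p) else ennreal p * ?g (?y l) (- \<epsilon>)) + ennreal (p ^ Suc n)"
        by (simp add: add_increasing2)
    qed
    also have "\<dots> = (\<integral>\<^sup>+l. (if weakly_between 0 x (?y l) then ennreal (1 - p) else ennreal p * ?g (?y l) (- \<epsilon>)) \<partial>measure_pmf \<nu>) +
        ennreal (p ^ Suc n)"
      by (subst nn_integral_add) auto
    also have "\<dots> \<le> ?g x \<epsilon> + ennreal (p ^ Suc n)"
    proof (rule add_right_mono)
      show "(\<integral>\<^sup>+l. (if weakly_between 0 x (?y l) then ennreal (1 - p) else ennreal p * ?g (?y l) (- \<epsilon>)) \<partial>measure_pmf \<nu>) \<le> ?g x \<epsilon>"
        unfolding emeasure_runs_pmf_unfold[OF p, of _ "{ls. weakly_between 0 x (x + altsum \<epsilon> ls)}"]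
        by (intro nn_integral_mono)
          (auto simp: add.assoc[symmetric] between_0_shift)
    qed
    finally show ?case .
  qed
  then have "(1 - p) * measure_pmf.prob (runs_pmf \<nu> p) {ls. line_hit x \<epsilon> ls} -
      measure_pmf.prob (runs_pmf \<nu> p) {ls. weakly_between 0 x (x + altsum \<epsilon> ls)} \<le> p ^ n" for n
    using p by (simp add: measure_pmf.emeasure_eq_measure algebra_simps flip: ennreal_mult ennreal_plus)
  then have "(1 - p) * measure_pmf.prob (runs_pmf \<nu> p) {ls. line_hit x \<epsilon> ls} -
      measure_pmf.prob (runs_pmf \<nu> p) {ls. weakly_between 0 x (x + altsum \<epsilon> ls)} \<le> 0"
    by (intro LIMSEQ_le_const[OF LIMSEQ_realpow_zero[OF p]]) auto
  then show ?thesis by simp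
qed

text \<open>Averaging \<open>line_hit_le\<close> over the starting point and the sign gives 1 / (1 -
  p), and \<open>between_0_le\<close> gives the factor 2.\<close>

lemma walk_line_hit_le:
  assumes p: "0 \<le> p" "p < 1"
  shows "measure_pmf.prob (pair_pmf (walk_pmf (jump_pmf \<nu> p) n) (block_pmf \<nu> p))
      {(x, \<epsilon>, ls). line_hit x \<epsilon> ls} \<le> 2 / (1 - p) * straddle_prob (jump_pmf \<nu> p) n"
proof -
  interpret symmetric_walk "jump_pmf \<nu> p" by (rule symmetric_walk_jump)
  let ?W = "walk_pmf (jump_pmf \<nu> p) n" and ?B = "block_pmf \<nu> p"
  have "ennreal (1 - p) * emeasure (measure_pmf (pair_pmf ?W ?B)) {(x, \<epsilon>, ls). line_hit x \<epsilon> ls} =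
      (\<integral>\<^sup>+x. \<integral>\<^sup>+\<epsilon>. ennreal (1 - p) * emeasure (measure_pmf (runs_pmf \<nu> p)) {ls. line_hit x \<epsilon> ls} \<partial>measure_pmf (pmf_of_set {- 1, 1}) \<partial>measure_pmf ?W)"
    unfolding block_pmf_def emeasure_pair_pmf
    by (subst nn_integral_cmult[symmetric], simp, intro nn_integral_cong)
       (simp add: emeasure_pair_pmf nn_integral_cmult)
  also have "\<dots> \<le> (\<integral>\<^sup>+x. \<integral>\<^sup>+\<epsilon>. emeasure (measure_pmf (runs_pmf \<nu> p)) {ls. weakly_between 0 x (x + altsum \<epsilon> ls)} \<partial>measure_pmf (pmf_of_set {- 1, 1}) \<partial>measure_pmf ?W)"
    using p by (intro nn_integral_mono)
      (auto simp: measure_pmf.emeasure_eq_measure line_hit_le simp flip: ennreal_mult intro!: ennreal_leI)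
  also have "\<dots> = emeasure (measure_pmf (pair_pmf ?W ?B)) {(x, \<epsilon>, ls). weakly_between 0 x (x + altsum \<epsilon> ls)}"
    unfolding block_pmf_def emeasure_pair_pmf by (simp add: emeasure_pair_pmf)
  also have "\<dots> = emeasure (measure_pmf (pair_pmf ?W (jump_pmf \<nu> p))) {(x, j). weakly_between 0 x (x + j)}"
    unfolding map_altsum_block_pmf[symmetric] pair_map_pmf2 emeasure_map_pmf
    by (rule arg_cong[where f="emeasure _"]) auto
  finally have "(1 - p) * measure_pmf.prob (pair_pmf ?W ?B) {(x, \<epsilon>, ls). line_hit x \<epsilon> ls} \<le>
      measure_pmf.prob (pair_pmf ?W (jump_pmf \<nu> p)) {(x, j). weakly_between 0 x (x + j)}"
    using p by (simp add: measure_pmf.emeasure_eq_measure flip: ennreal_mult)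
  with between_0_le[of n] p show ?thesis by (simp add: field_simps)
qed

section \<open>A second Borel--Cantelli lemma and a zero-one law\<close>

text \<open>The second-moment method for the number \<open>Z\<close> of events in a window
  \<open>{k..<N}\<close>. The hypothesis has the form that regeneration provides: given
  \<open>E n\<close>, the expected number of later events before \<open>N\<close> is at most of the
  order of one plus the unconditional expectation.\<close>

lemma (in prob_space) kochen_stone:
  fixes E :: "nat \<Rightarrow> 'a set"
  assumes E[measurable]: "\<And>n. E n \<in> events"
    and div: "\<not> summable (\<lambda>n. prob (E n))"
    and K: "K \<ge> 0" "\<And>N n. n < N \<Longrightarrow>
      (\<Sum>m\<in>{n<..<N}. prob (E n \<inter> E m)) \<le> K * prob (E n) * (1 + (\<Sum>m<N. prob (E m)))"
  shows "0 < prob {\<omega> \<in> space M. \<exists>\<^sub>\<infinity>n. \<omega> \<in> E n}"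
proof -
  define s where "s N = (\<Sum>m<N. prob (E m))" for N
  define \<delta> where "\<delta> = 1 / (2 * (1 + 4 * K))"
  have \<delta>: "\<delta> > 0" using K(1) by (simp add: \<delta>_def)
  have s_unbounded: "\<exists>N\<ge>k. s N \<ge> C" for C k
  proof (rule ccontr)
    assume "\<not> ?thesis"
    then have less: "s N \<le> C" if "N \<ge> k" for N using that by force
    have "s N \<le> C" for N
    proof -
      have "s N \<le> s (max k N)" unfolding s_def by (intro sum_mono2) auto
      with less[of "max k N"] show ?thesis by simp
    qed
    then have "summable (\<lambda>n. prob (E n))"
      by (intro bounded_imp_summable[of _ C]) (auto simp: s_def simp del: sum.lessThan_Suc simp flip: lessThan_Suc_atMost)
    with div show False by simp
  qed
  define U where "U k = (\<Union>n\<in>{k..}. E n)" for k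
  have U[measurable]: "U k \<in> events" for k by (simp add: U_def)
  have lower: "\<delta> \<le> prob (U k)" for k
  proof -
    \<comment> \<open>With this \<open>N\<close> the window carries at least half of
      \<open>s N\<close>, and \<open>s N\<close> is at least 1; the lost factor 2 goes into
      \<delta>.\<close>
    obtain N where N: "N \<ge> k" "s N \<ge> 2 * s k + 1" using s_unbounded by blast
    define I where "I = {k..<N}"
    define Z where "Z \<omega> = (\<Sum>n\<in>I. indicator (E n) \<omega> :: real)" for \<omega>
    define z where "z = s N - s k"
    \<comment> \<open>\<open>y\<close> will bound the ratio of the second moment of \<open>Z\<close>
      to its mean \<open>z\<close>, so that \<open>z / y\<close> bounds \<open>prob (U k)\<close>
      from below. The choice of \<delta> comes from
      \<open>y \<le> (1 + 4 * K) * s N\<close>.\<close>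
    define y where "y = 1 + 2 * K * (1 + s N)"
    have s0: "0 \<le> s k" by (simp add: s_def sum_nonneg)
    have z_sum: "z = (\<Sum>n\<in>I. prob (E n))"
      unfolding z_def s_def I_def using N(1)
      by (simp add: lessThan_atLeast0 sum_diff_nat_ivl)
    have y: "y > 0" using K(1) s0 N by (simp add: y_def add_pos_nonneg)
    have ind: "integrable M (indicat_real A)" if "A \<in> events" for A
      using that by (simp add: emeasure_eq_measure)
    have EZ: "expectation Z = z"
      unfolding Z_def z_sum by (subst Bochner_Integration.integral_sum) (auto intro!: ind)
    have Z2: "Z \<omega> ^ 2 = (\<Sum>n\<in>I. \<Sum>m\<in>I. indicator (E n \<inter> E m) \<omega>)" for \<omega>
      by (simp add: Z_def power2_eq_square sum_product indicator_inter_arith)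
    have int1: "integrable M Z"
      unfolding Z_def[abs_def] by (intro Bochner_Integration.integrable_sum ind) auto
    have int2: "integrable M (\<lambda>\<omega>. Z \<omega> ^ 2)"
      unfolding Z2 by (intro Bochner_Integration.integrable_sum ind) auto
    note int = int1 int2
    have "expectation (\<lambda>\<omega>. Z \<omega> ^ 2) = (\<Sum>n\<in>I. \<Sum>m\<in>I. prob (E n \<inter> E m))"
      unfolding Z2
      by (subst Bochner_Integration.integral_sum,
          intro Bochner_Integration.integrable_sum ind, simp, intro sum.cong refl,
          subst Bochner_Integration.integral_sum, auto intro!: ind)
    also have "\<dots> \<le> (\<Sum>n\<in>I. prob (E n)) + 2 * (\<Sum>n\<in>I. \<Sum>m\<in>{n<..<N}. prob (E n \<inter> E m))"
    proof -
      let ?a = "\<lambda>n m. prob (E n \<inter> E m)"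
      have "(\<Sum>n\<in>I. \<Sum>m\<in>I. ?a n m) =
          (\<Sum>n\<in>I. \<Sum>m\<in>I. (if m = n then ?a n m else 0) + ((if n < m then ?a n m else 0) + (if m < n then ?a m n else 0)))"
        by (intro sum.cong refl) (auto simp: Int_commute)
      also have "\<dots> = (\<Sum>n\<in>I. prob (E n)) + ((\<Sum>n\<in>I. \<Sum>m\<in>I. if n < m then ?a n m else 0) +
          (\<Sum>n\<in>I. \<Sum>m\<in>I. if m < n then ?a m n else 0))"
        by (simp add: sum.distrib I_def)
      also have "(\<Sum>n\<in>I. \<Sum>m\<in>I. if m < n then ?a m n else 0) = (\<Sum>n\<in>I. \<Sum>m\<in>I. if n < m then ?a n m else 0)"
        by (rule sum.swap)
      also have "(\<Sum>n\<in>I. \<Sum>m\<in>I. if n < m then ?a n m else 0) = (\<Sum>n\<in>I. \<Sum>m\<in>{n<..<N}. ?a n m)"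
      proof (rule sum.cong[OF refl])
        fix n assume "n \<in> I"
        then have *: "{n<..<N} = {m\<in>I. n < m}" by (auto simp: I_def)
        show "(\<Sum>m\<in>I. if n < m then ?a n m else 0) = (\<Sum>m\<in>{n<..<N}. ?a n m)"
          unfolding * by (rule sum.inter_filter[symmetric]) (simp add: I_def)
      qed
      finally show ?thesis by simp
    qed
    also have "\<dots> \<le> (\<Sum>n\<in>I. prob (E n)) + 2 * (\<Sum>n\<in>I. K * prob (E n) * (1 + s N))"
      using K(2) unfolding s_def by (intro add_left_mono mult_left_mono sum_mono) (auto simp: I_def)
    also have "\<dots> = z * y"
      unfolding z_sum y_def by (simp add: sum_distrib_left sum_distrib_right sum.distrib algebra_simps)
    finally have EZ2: "expectation (\<lambda>\<omega>. Z \<omega> ^ 2) \<le> z * y" .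
    \<comment> \<open>Since 2 t Z - (t Z)^2 = 1 - (1 - t Z)^2, this variable is at most 1, and it
      vanishes where \<open>Z\<close> does. With t = 1 / y its mean is at least z / y; this takes
      the place of Cauchy-Schwarz.\<close>
    have "2 * (1 / y) * z - (1 / y)\<^sup>2 * expectation (\<lambda>\<omega>. Z \<omega> ^ 2) =
        expectation (\<lambda>\<omega>. 2 * (1 / y) * Z \<omega> - (1 / y)\<^sup>2 * Z \<omega> ^ 2)"
      using int EZ by simp
    also have "\<dots> \<le> expectation (indicator (U k))"
    proof (rule integral_mono)
      fix \<omega> assume "\<omega> \<in> space M"
      show "2 * (1 / y) * Z \<omega> - (1 / y)\<^sup>2 * Z \<omega> ^ 2 \<le> indicator (U k) \<omega>"
      proof (cases "\<omega> \<in> U k")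
        case True
        have "0 \<le> (1 - 1 / y * Z \<omega>)\<^sup>2" by simp
        then show ?thesis using True by (simp add: power2_diff power_mult_distrib power_divide)
      next
        case False
        then have "Z \<omega> = 0" by (auto simp: Z_def U_def I_def)
        then show ?thesis by simp
      qed
    qed (use int ind[OF U] in auto)
    also have "\<dots> = prob (U k)" by simp
    finally have "2 * (1 / y) * z - (1 / y)\<^sup>2 * (z * y) \<le> prob (U k)"
      using EZ2 mult_left_mono[OF EZ2, of "(1 / y)\<^sup>2"] by simp
    then have "z / y \<le> prob (U k)" using y by (simp add: power2_eq_square)
    moreover have "\<delta> \<le> z / y"
    proof -
      have "y \<le> (1 + 4 * K) * s N"
      proof -
        have "1 \<le> s N" using N s0 by simp
        moreover from this have "K * 1 \<le> K * s N" using K(1) by (intro mult_left_mono)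
        ultimately show ?thesis by (simp add: y_def algebra_simps)
      qed
      also have "\<dots> \<le> (1 + 4 * K) * (2 * z)"
        using N K(1) by (intro mult_left_mono) (auto simp: z_def)
      finally show ?thesis using K(1) y by (simp add: \<delta>_def field_simps)
    qed
    ultimately show ?thesis by simp
  qed
  have "(\<lambda>k. prob (U k)) \<longlonglongrightarrow> prob (\<Inter>k. U k)"
  proof (rule finite_Lim_measure_decseq)
    show "decseq U" unfolding decseq_def U_def by (intro allI impI UN_mono) auto
  qed auto
  then have "\<delta> \<le> prob (\<Inter>k. U k)"
    by (rule LIMSEQ_le_const) (use lower in auto)
  also have "(\<Inter>k. U k) = {\<omega> \<in> space M. \<exists>\<^sub>\<infinity>n. \<omega> \<in> E n}"
    using sets.sets_into_space[OF E] by (fastforce simp: U_def INFM_nat_le)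
  finally show ?thesis using \<delta> by simp
qed

lemma integrable_pmf_bounded:
  fixes f :: "'a \<Rightarrow> real"
  assumes "\<And>x. \<bar>f x\<bar> \<le> B"
  shows "integrable (measure_pmf p) f"
  by (rule measure_pmf.integrable_const_bound[of _ B]) (use assms in auto)

lemma expectation_pair_pmf:
  fixes f :: "'a \<times> 'b \<Rightarrow> real"
  assumes "\<And>x. 0 \<le> f x" "\<And>x. f x \<le> C"
  shows "measure_pmf.expectation (pair_pmf A B) f =
    measure_pmf.expectation A (\<lambda>a. measure_pmf.expectation B (\<lambda>b. f (a, b)))"
proof -
  have b: "\<bar>f x\<bar> \<le> C" for x using assms[of x] by simp
  have E: "0 \<le> measure_pmf.expectation B (\<lambda>b. f (a, b))" "measure_pmf.expectation B (\<lambda>b. f (a, b)) \<le> C" for a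
    using assms b by (auto intro!: integral_nonneg measure_pmf.integral_le_const integrable_pmf_bounded)
  have "ennreal (measure_pmf.expectation (pair_pmf A B) f) = (\<integral>\<^sup>+x. ennreal (f x) \<partial>measure_pmf (pair_pmf A B))"
    using assms b by (intro nn_integral_eq_integral[symmetric] integrable_pmf_bounded) auto
  also have "\<dots> = (\<integral>\<^sup>+a. \<integral>\<^sup>+b. ennreal (f (a, b)) \<partial>measure_pmf B \<partial>measure_pmf A)"
    by (rule nn_integral_pair_pmf')
  also have "\<dots> = (\<integral>\<^sup>+a. ennreal (measure_pmf.expectation B (\<lambda>b. f (a, b))) \<partial>measure_pmf A)"
    using assms b by (intro nn_integral_cong nn_integral_eq_integral integrable_pmf_bounded) auto
  also have "\<dots> = ennreal (measure_pmf.expectation A (\<lambda>a. measure_pmf.expectation B (\<lambda>b. f (a, b))))"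
    using E by (intro nn_integral_eq_integral integrable_pmf_bounded[of _ C]) (auto simp: abs_le_iff intro: order_trans)
  finally show ?thesis using assms E by (simp add: integral_nonneg)
qed

section \<open>Streams of i.i.d. words: Markov property and zero-one law\<close>

definition stream_path :: "('w \<Rightarrow> 'g::comm_monoid_add) \<Rightarrow> nat \<Rightarrow> 'w stream \<Rightarrow> 'g" where
  "stream_path J n s = sum_list (map J (stake n s))"

lemma stream_path_0 [simp]: "stream_path J 0 s = 0"
  by (simp add: stream_path_def)

lemma stream_path_add: "stream_path J (m + n) s = stream_path J m s + stream_path J n (sdrop m s)"
  by (simp add: stream_path_def flip: stake_add)

lemma map_path_replicate_pmf:
  "map_pmf (\<lambda>xs. sum_list (map J xs)) (replicate_pmf n q) = walk_pmf (map_pmf J q) n"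
proof (induction n)
  case (Suc n)
  show ?case
    unfolding walk_pmf.simps Suc.IH[symmetric]
    by (simp add: map_pmf_def pair_pmf_def bind_assoc_pmf bind_return_pmf)
qed simp

locale pmf_stream =
  fixes q :: "'w::countable pmf"
begin

definition S :: "'w stream measure" where "S = stream_space (measure_pmf q)"

lemma sets_S [measurable_cong]: "sets S = sets (stream_space (count_space UNIV))"
  unfolding S_def by (rule sets_stream_space_cong) simp

lemma space_S [simp]: "space S = UNIV"
  by (simp add: S_def space_stream_space)

sublocale S: prob_space S
  unfolding S_def by (rule prob_space.prob_space_stream_space[OF measure_pmf.prob_space_axioms])

text \<open>The Markov property in integral form: given the first \<open>n\<close> letters, the
  shifted stream is a fresh copy. The prefix has countably many values, so measurability of
  \<open>f\<close> in its second argument suffices.\<close>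

lemma nn_integral_stake_sdrop:
  assumes f[measurable]: "\<And>xs. f xs \<in> borel_measurable (stream_space (count_space UNIV))"
  shows "(\<integral>\<^sup>+s. f (stake n s) (sdrop n s) \<partial>S) =
    (\<integral>\<^sup>+xs. \<integral>\<^sup>+s. f xs s \<partial>S \<partial>measure_pmf (replicate_pmf n q))"
  using f
proof (induction n arbitrary: f)
  case (Suc n)
  have m: "(\<lambda>s. f (stake k s) (sdrop k s)) \<in> borel_measurable (stream_space (count_space UNIV))"
    if [measurable]: "\<And>xs. f xs \<in> borel_measurable (stream_space (count_space UNIV))"
    for f :: "'w list \<Rightarrow> 'w stream \<Rightarrow> ennreal" and k
    by (rule measurable_compose_countable[where f="\<lambda>i s. f i (sdrop k s)"]) measurable
  have "(\<integral>\<^sup>+s. f (stake (Suc n) s) (sdrop (Suc n) s) \<partial>S) =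
      (\<integral>\<^sup>+x. \<integral>\<^sup>+s. f (stake (Suc n) (x ## s)) (sdrop (Suc n) (x ## s)) \<partial>S \<partial>measure_pmf q)"
    unfolding S_def
    by (rule prob_space.nn_integral_stream_space[OF measure_pmf.prob_space_axioms])
      (use m[of f "Suc n", OF Suc.prems] in
        \<open>simp only: measurable_cong_sets[OF sets_S[unfolded S_def] refl]\<close>)
  also have "\<dots> = (\<integral>\<^sup>+x. \<integral>\<^sup>+xs. \<integral>\<^sup>+s. f (x # xs) s \<partial>S \<partial>measure_pmf (replicate_pmf n q) \<partial>measure_pmf q)"
  proof (rule nn_integral_cong)
    fix x
    show "(\<integral>\<^sup>+s. f (stake (Suc n) (x ## s)) (sdrop (Suc n) (x ## s)) \<partial>S) =
        (\<integral>\<^sup>+xs. \<integral>\<^sup>+s. f (x # xs) s \<partial>S \<partial>measure_pmf (replicate_pmf n q))"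
      using Suc.IH[of "\<lambda>xs. f (x # xs)"] Suc.prems by simp
  qed
  also have "\<dots> = (\<integral>\<^sup>+xs. \<integral>\<^sup>+s. f xs s \<partial>S \<partial>measure_pmf (replicate_pmf (Suc n) q))"
    by simp
  finally show ?case .
qed simp

lemma emeasure_stake_sdrop:
  assumes [measurable]: "\<And>xs. Measurable.pred (stream_space (count_space UNIV)) (P xs)"
  shows "emeasure S {s. P (stake n s) (sdrop n s)} =
    (\<integral>\<^sup>+xs. emeasure S {s. P xs s} \<partial>measure_pmf (replicate_pmf n q))"
proof -
  have "Measurable.pred S (\<lambda>s. P (stake n s) (sdrop n s))"
    by (rule measurable_compose_countable[where f="\<lambda>i s. P i (sdrop n s)"]) measurable
  then have [measurable]: "{s. P (stake n s) (sdrop n s)} \<in> S.events"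
    by (simp add: pred_def)
  have "Measurable.pred S (P xs)" for xs by measurable
  then have [measurable]: "{s. P xs s} \<in> S.events" for xs
    by (simp add: pred_def)
  have "emeasure S {s. P (stake n s) (sdrop n s)} = (\<integral>\<^sup>+s. indicator {(xs, s). P xs s} (stake n s, sdrop n s) \<partial>S)"
    by (subst nn_integral_indicator[symmetric])
      (auto intro!: nn_integral_cong simp: indicator_def simp del: nn_integral_indicator)
  also have "\<dots> = (\<integral>\<^sup>+xs. \<integral>\<^sup>+s. indicator {(xs, s). P xs s} (xs, s) \<partial>S \<partial>measure_pmf (replicate_pmf n q))"
    by (rule nn_integral_stake_sdrop[where f="\<lambda>xs s. indicator {(xs, s). P xs s} (xs, s)"])
      (simp add: indicator_def)
  also have "\<dots> = (\<integral>\<^sup>+xs. emeasure S {s. P xs s} \<partial>measure_pmf (replicate_pmf n q))"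
    by (intro nn_integral_cong, subst nn_integral_indicator[symmetric])
      (auto intro!: nn_integral_cong simp: indicator_def simp del: nn_integral_indicator)
  finally show ?thesis .
qed

lemma emeasure_stake:
  "emeasure S {s. P (stake n s)} = emeasure (measure_pmf (replicate_pmf n q)) {xs. P xs}"
  by (subst emeasure_stake_sdrop[of "\<lambda>xs _. P xs"])
    (auto simp: S.emeasure_space_1[simplified] nn_integral_indicator[symmetric] indicator_def
      simp del: nn_integral_indicator intro!: nn_integral_cong)

end

lemma pred_stake [measurable]:
  fixes P :: "'w::countable list \<Rightarrow> bool"
  shows "Measurable.pred (stream_space (count_space UNIV)) (\<lambda>s. P (stake n s))"
  by (rule measurable_compose[OF measurable_stake]) simp

lemma INFM_nat_shift: "(\<exists>\<^sub>\<infinity>n. P (n + m)) \<longleftrightarrow> (\<exists>\<^sub>\<infinity>n. P n)" for m :: nat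
  unfolding cofinite_eq_sequentially frequently_def eventually_sequentially_seg[of "\<lambda>n. \<not> P n" m] ..

text \<open>A relation between consecutive positions instead of a set of positions, because
  straddling concerns both ends of a jump. The start \<open>x\<close> is a parameter so that a
  prefix of the path can be absorbed into it.\<close>

definition steps_io ::
  "('w \<Rightarrow> 'g::comm_monoid_add) \<Rightarrow> ('g \<Rightarrow> 'g \<Rightarrow> bool) \<Rightarrow> 'g \<Rightarrow> 'w stream \<Rightarrow> bool" where
  "steps_io J R x s \<longleftrightarrow> (\<exists>\<^sub>\<infinity>n. R (x + stream_path J n s) (x + stream_path J (Suc n) s))"

text \<open>Finitely many initial steps cannot affect what happens infinitely often; they only move
  the starting point.\<close>

lemma steps_io_sdrop: "steps_io J R (x + stream_path J m s) (sdrop m s) \<longleftrightarrow> steps_io J R x s"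
proof -
  have "steps_io J R x s \<longleftrightarrow> (\<exists>\<^sub>\<infinity>n. R (x + stream_path J (m + n) s) (x + stream_path J (m + Suc n) s))"
    unfolding steps_io_def
    using INFM_nat_shift[of "\<lambda>n. R (x + stream_path J n s) (x + stream_path J (Suc n) s)" m]
    by (simp add: add.commute)
  then show ?thesis
    unfolding stream_path_add[of J m] steps_io_def by (simp add: add.assoc)
qed

text \<open>Step \<open>n\<close> is a function of the first \<open>Suc n\<close> letters;
  measurability follows because there are countably many letters.\<close>

lemma step_eq_stake:
  "R (x + stream_path J n s) (x + stream_path J (Suc n) s) \<longleftrightarrow>
    (\<lambda>xs. R (x + sum_list (map J (take n xs))) (x + sum_list (map J xs))) (stake (Suc n) s)"
  by (simp add: stream_path_def take_stake min_def del: stake.simps)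

lemma pred_step [measurable]:
  fixes J :: "'w::countable \<Rightarrow> 'g::comm_monoid_add"
  shows "Measurable.pred (stream_space (count_space UNIV))
    (\<lambda>s. R (x + stream_path J n s) (x + stream_path J (Suc n) s))"
  unfolding step_eq_stake by (rule pred_stake)

lemma pred_steps_io [measurable]:
  fixes J :: "'w::countable \<Rightarrow> 'g::comm_monoid_add"
  shows "Measurable.pred (stream_space (count_space UNIV)) (steps_io J R x)"
  unfolding steps_io_def INFM_nat_le by measurable

lemma expectation_square_diff:
  fixes f :: "'a \<Rightarrow> real"
  assumes "\<And>x. \<bar>f x\<bar> \<le> 1"
  shows "measure_pmf.expectation p (\<lambda>y. (c - f y)\<^sup>2) =
    c\<^sup>2 + measure_pmf.expectation p (\<lambda>y. (f y)\<^sup>2) - 2 * c * measure_pmf.expectation p f"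
proof -
  have sq: "\<bar>(f x)\<^sup>2\<bar> \<le> 1" for x using assms[of x] by (simp add: abs_square_le_1)
  have int: "integrable (measure_pmf p) (\<lambda>y. (f y)\<^sup>2)" "integrable (measure_pmf p) f"
    by (rule integrable_pmf_bounded[OF sq], rule integrable_pmf_bounded[OF assms])
  have "measure_pmf.expectation p (\<lambda>y. (c - f y)\<^sup>2) =
      measure_pmf.expectation p (\<lambda>y. (c\<^sup>2 + (f y)\<^sup>2) - 2 * c * f y)"
    by (simp add: power2_diff)
  also have "\<dots> = measure_pmf.expectation p (\<lambda>y. c\<^sup>2 + (f y)\<^sup>2) - measure_pmf.expectation p (\<lambda>y. 2 * c * f y)"
    by (rule Bochner_Integration.integral_diff) (use int in auto)
  also have "measure_pmf.expectation p (\<lambda>y. c\<^sup>2 + (f y)\<^sup>2) = c\<^sup>2 + measure_pmf.expectation p (\<lambda>y. (f y)\<^sup>2)"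
    using int by (subst Bochner_Integration.integral_add) auto
  finally show ?thesis by simp
qed

context pmf_stream
begin

lemma pred_imp_event: "Measurable.pred (stream_space (count_space UNIV)) P \<Longrightarrow> {s. P s} \<in> S.events"
proof -
  assume [measurable]: "Measurable.pred (stream_space (count_space UNIV)) P"
  have "Measurable.pred S P" by measurable
  then show ?thesis by (simp add: pred_def)
qed

text \<open>Conditionally on the first \<open>m\<close> steps, the walk visits \<open>R\<close> infinitely often with
  probability \<open>h (S_m)\<close>. Since \<open>S_2m\<close> is invariant under exchanging the first and the second \<open>m\<close>
  steps, the variances \<open>v\<close> of \<open>h (S_m)\<close> satisfy \<open>v m \<le> 2 (v (2 m) - v m)\<close>; being bounded, they
  vanish, so \<open>h\<close> is constant along the walk.\<close>

lemma io_const: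
  fixes J :: "'w \<Rightarrow> 'g::ab_group_add" and R :: "'g \<Rightarrow> 'g \<Rightarrow> bool"
  assumes y: "y \<in> set_pmf (walk_pmf (map_pmf J q) m)"
  shows "S.prob {s. steps_io J R y s} = S.prob {s. steps_io J R 0 s}"
proof -
  define h where "h x = S.prob {s. steps_io J R x s}" for x
  define W where "W = walk_pmf (map_pmf J q)"
  let ?E = measure_pmf.expectation
  have h: "0 \<le> h x" "h x \<le> 1" for x by (simp_all add: h_def)
  have habs: "\<bar>h x\<bar> \<le> 1" for x using h[of x] by simp
  have h2: "\<bar>(h x)\<^sup>2\<bar> \<le> 1" for x using h[of x] by (simp add: power_le_one)
  have hd2: "(h x - h y)\<^sup>2 \<le> 1" for x y
    using h[of x] h[of y] by (simp add: abs_square_le_1 abs_le_iff)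
  note int = integrable_pmf_bounded[OF habs] integrable_pmf_bounded[OF h2]
  have int': "integrable (measure_pmf p) h" "integrable (measure_pmf p) (\<lambda>x. (h x)\<^sup>2)" for p :: "'g pmf"
    by (rule int)+
  \<comment> \<open>\<open>h\<close> is harmonic for the walk; in particular all the means
    \<open>?E (W m) h\<close> equal \<open>h 0\<close>.\<close>
  have harm: "h x = ?E (W m) (\<lambda>y. h (x + y))" for x m
  proof -
    have "{s. steps_io J R x s} = {s. (\<lambda>xs s. steps_io J R (x + sum_list (map J xs)) s) (stake m s) (sdrop m s)}"
      using steps_io_sdrop[of J R x m] by (simp add: stream_path_def)
    then have "emeasure S {s. steps_io J R x s} =
        (\<integral>\<^sup>+xs. emeasure S {s. steps_io J R (x + sum_list (map J xs)) s} \<partial>measure_pmf (replicate_pmf m q))"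
      by (simp only:, subst emeasure_stake_sdrop) auto
    also have "\<dots> = (\<integral>\<^sup>+y. ennreal (h (x + y)) \<partial>measure_pmf (W m))"
      unfolding W_def map_path_replicate_pmf[symmetric] by (simp add: h_def S.emeasure_eq_measure)
    also have "\<dots> = ennreal (?E (W m) (\<lambda>y. h (x + y)))"
      using h by (intro nn_integral_eq_integral int) auto
    finally show ?thesis using h by (simp add: h_def S.emeasure_eq_measure integral_nonneg)
  qed
  define u where "u m = ?E (W m) (\<lambda>x. (h x)\<^sup>2)" for m
  define \<theta> where "\<theta> = h 0"
  have mean: "?E (W m) h = \<theta>" for m using harm[of 0 m] by (simp add: \<theta>_def)
  have var: "?E (W m) (\<lambda>x. (h x - \<theta>)\<^sup>2) = u m - \<theta>\<^sup>2" for m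
    unfolding power2_commute[of _ \<theta>] expectation_square_diff[OF habs] u_def[symmetric] mean
    by (simp add: power2_eq_square)
  \<comment> \<open>The values of \<open>h\<close> along the walk form a martingale, and
    orthogonality of increments turns a mean square increment into a difference of second
    moments.\<close>
  have shift: "?E (pair_pmf (W m) (W m)) (\<lambda>(x, y). (h (x + y) - h x)\<^sup>2) = u (m + m) - u m" for m
  proof -
    have "?E (pair_pmf (W m) (W m)) (\<lambda>(x, y). (h (x + y) - h x)\<^sup>2) =
        ?E (W m) (\<lambda>x. ?E (W m) (\<lambda>y. (h (x + y) - h x)\<^sup>2))"
      by (subst expectation_pair_pmf[of _ 1]) (auto simp: hd2)
    also have "\<dots> = ?E (W m) (\<lambda>x. ?E (W m) (\<lambda>y. (h (x + y))\<^sup>2) - (h x)\<^sup>2)"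
    proof (rule arg_cong[where f="?E (W m)"], rule ext)
      fix x
      show "?E (W m) (\<lambda>y. (h (x + y) - h x)\<^sup>2) = ?E (W m) (\<lambda>y. (h (x + y))\<^sup>2) - (h x)\<^sup>2"
        unfolding power2_commute[of _ "h x"] expectation_square_diff[of "\<lambda>y. h (x + y)", OF habs]
          harm[of x m, symmetric]
        by (simp add: power2_eq_square)
    qed
    also have "\<dots> = ?E (W m) (\<lambda>x. ?E (W m) (\<lambda>y. (h (x + y))\<^sup>2)) - u m"
    proof -
      have "\<bar>?E (W m) (\<lambda>y. (h (x + y))\<^sup>2)\<bar> \<le> 1" for x
        using h2 by (auto simp: abs_le_iff intro!: measure_pmf.integral_le_const int order_trans[OF _ integral_nonneg])
      then show ?thesis unfolding u_def by (intro Bochner_Integration.integral_diff int integrable_pmf_bounded)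
    qed
    also have "?E (W m) (\<lambda>x. ?E (W m) (\<lambda>y. (h (x + y))\<^sup>2)) =
        ?E (pair_pmf (W m) (W m)) (\<lambda>z. (h (fst z + snd z))\<^sup>2)"
      using h2 by (subst expectation_pair_pmf[of _ 1]) auto
    also have "\<dots> = u (m + m)"
      unfolding u_def W_def walk_pmf_add by (simp add: case_prod_beta)
    finally show ?thesis .
  qed
  \<comment> \<open>Twice the variance is the mean of (h x - h y)^2 for independent x and y.
    Inserting h (x + y) and using (a - b)^2 <= 2 a^2 + 2 b^2 leaves two increments, which have the
    same law because x + y is symmetric in x and y.\<close>
  have contract: "u m - \<theta>\<^sup>2 \<le> 2 * (u (m + m) - u m)" for m
  proof -
    let ?P = "pair_pmf (W m) (W m)"
    have bd: "\<bar>(\<lambda>(x, y). (h (f x y) - h (g x y))\<^sup>2) z\<bar> \<le> 1" for f g and z :: "'g \<times> 'g"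
      by (simp add: case_prod_beta hd2)
    have "2 * (u m - \<theta>\<^sup>2) = ?E (W m) (\<lambda>x. ?E (W m) (\<lambda>y. (h x - h y)\<^sup>2))"
    proof -
      have "?E (W m) (\<lambda>y. (h x - h y)\<^sup>2) = (h x)\<^sup>2 + u m - (2 * \<theta>) * h x" for x
        unfolding expectation_square_diff[OF habs] u_def mean by simp
      then have "?E (W m) (\<lambda>x. ?E (W m) (\<lambda>y. (h x - h y)\<^sup>2)) = ?E (W m) (\<lambda>x. (h x)\<^sup>2 + u m - (2 * \<theta>) * h x)"
        by simp
      also have "\<dots> = ?E (W m) (\<lambda>x. (h x)\<^sup>2 + u m) - ?E (W m) (\<lambda>x. (2 * \<theta>) * h x)"
        by (rule Bochner_Integration.integral_diff) (use int' in auto)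
      also have "?E (W m) (\<lambda>x. (h x)\<^sup>2 + u m) = u m + u m"
        using int' by (subst Bochner_Integration.integral_add) (auto simp: u_def)
      also have "?E (W m) (\<lambda>x. (2 * \<theta>) * h x) = 2 * \<theta> * \<theta>"
        by (simp add: mean)
      finally show ?thesis by (simp add: power2_eq_square)
    qed
    also have "\<dots> = ?E ?P (\<lambda>(x, y). (h x - h y)\<^sup>2)"
      by (subst expectation_pair_pmf[of _ 1]) (auto simp: hd2)
    also have "\<dots> \<le> ?E ?P (\<lambda>z. 2 * (\<lambda>(x, y). (h (x + y) - h x)\<^sup>2) z + 2 * (\<lambda>(x, y). (h (x + y) - h y)\<^sup>2) z)"
    proof (rule integral_mono)
      fix z :: "'g \<times> 'g"
      obtain x y where [simp]: "z = (x, y)" by (cases z)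
      have "0 \<le> (h (x + y) - h x + (h (x + y) - h y))\<^sup>2" by simp
      then show "(case z of (x, y) \<Rightarrow> (h x - h y)\<^sup>2) \<le>
          2 * (case z of (x, y) \<Rightarrow> (h (x + y) - h x)\<^sup>2) + 2 * (case z of (x, y) \<Rightarrow> (h (x + y) - h y)\<^sup>2)"
        by (simp add: power2_eq_square algebra_simps)
    qed (intro Bochner_Integration.integrable_add integrable_mult_right integrable_pmf_bounded[OF bd])+
    also have "\<dots> = 2 * ?E ?P (\<lambda>(x, y). (h (x + y) - h x)\<^sup>2) + 2 * ?E ?P (\<lambda>(x, y). (h (x + y) - h y)\<^sup>2)"
      by (subst Bochner_Integration.integral_add, (intro integrable_mult_right integrable_pmf_bounded[OF bd])+) simp
    also have "?E ?P (\<lambda>(x, y). (h (x + y) - h y)\<^sup>2) = ?E ?P (\<lambda>(x, y). (h (x + y) - h x)\<^sup>2)"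
      by (subst pair_commute_pmf) (simp add: case_prod_unfold add.commute)
    finally show ?thesis unfolding shift by simp
  qed
  have "u m - \<theta>\<^sup>2 \<le> 0"
  proof -
    \<comment> \<open>Rearranged, \<open>contract\<close> says that doubling \<open>m\<close>
      multiplies the variance by at least 3/2.\<close>
    have grow: "(3 / 2) ^ k * (u m - \<theta>\<^sup>2) \<le> u (2 ^ k * m) - \<theta>\<^sup>2" for k
    proof (induction k)
      case (Suc k)
      have "(3 / 2) ^ Suc k * (u m - \<theta>\<^sup>2) \<le> 3 / 2 * (u (2 ^ k * m) - \<theta>\<^sup>2)"
        using mult_left_mono[OF Suc.IH, of "3 / 2"] by (simp add: mult.assoc)
      also have "\<dots> \<le> u (2 ^ k * m + 2 ^ k * m) - \<theta>\<^sup>2"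
        using contract[of "2 ^ k * m"] by simp
      finally show ?case by (simp add: mult_2 distrib_right)
    qed simp
    have "(u m - \<theta>\<^sup>2) \<le> 1 / (3 / 2) ^ k" for k
    proof -
      have "u (2 ^ k * m) \<le> 1"
        unfolding u_def using h2 by (auto intro!: measure_pmf.integral_le_const int simp: abs_le_iff)
      moreover have "0 \<le> \<theta>\<^sup>2" by simp
      ultimately have "(3 / 2) ^ k * (u m - \<theta>\<^sup>2) \<le> 1" using grow[of k] by linarith
      then show ?thesis by (simp add: field_simps)
    qed
    then have "\<forall>k. u m - \<theta>\<^sup>2 \<le> (2 / 3) ^ k" by (simp add: power_divide)
    then show ?thesis by (intro LIMSEQ_le_const[OF LIMSEQ_realpow_zero[of "2 / 3"]]) auto
  qed
  then have "?E (W m) (\<lambda>x. (h x - \<theta>)\<^sup>2) = 0"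
    unfolding var[symmetric] by (intro antisym integral_nonneg) auto
  then have "AE x in measure_pmf (W m). (h x - \<theta>)\<^sup>2 = 0"
    by (subst (asm) integral_nonneg_eq_0_iff_AE) (auto intro!: integrable_pmf_bounded[of _ 1] simp: hd2 \<theta>_def)
  then show ?thesis using y by (auto simp: AE_measure_pmf_iff W_def h_def \<theta>_def)
qed

text \<open>By \<open>io_const\<close> the event \<open>B\<close> is independent of every event of a
  finite prefix. The prefix events \<open>F N\<close>, that \<open>R\<close> occurs at some time in
  \<open>{k..<N}\<close>, increase to an event that contains \<open>B\<close>. The limit of P(F N
  and B) = P(F N) \<theta> is therefore \<theta> = P(R occurs after k) \<theta>, and \<theta>
  cancels. Hence \<open>R\<close> occurs after every \<open>k\<close> almost surely.\<close>

lemma io_zero_one: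
  fixes J :: "'w \<Rightarrow> 'g::ab_group_add" and R :: "'g \<Rightarrow> 'g \<Rightarrow> bool"
  assumes pos: "0 < S.prob {s. steps_io J R 0 s}"
  shows "S.prob {s. steps_io J R 0 s} = 1"
proof -
  define B where "B = {s. steps_io J R 0 s}"
  define \<theta> where "\<theta> = S.prob B"
  have B[measurable]: "B \<in> S.events" unfolding B_def by (rule pred_imp_event) measurable
  have indep: "emeasure S ({s. P (stake m s)} \<inter> B) = emeasure S {s. P (stake m s)} * ennreal \<theta>" for P m
  proof -
    let ?r = "replicate_pmf m q"
    have "{s. P (stake m s)} \<inter> B =
        {s. (\<lambda>xs s. P xs \<and> steps_io J R (0 + sum_list (map J xs)) s) (stake m s) (sdrop m s)}"
      using steps_io_sdrop[of J R 0 m] by (auto simp: stream_path_def B_def)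
    then have "emeasure S ({s. P (stake m s)} \<inter> B) =
        (\<integral>\<^sup>+xs. emeasure S {s. P xs \<and> steps_io J R (0 + sum_list (map J xs)) s} \<partial>measure_pmf ?r)"
      by (simp only:, subst emeasure_stake_sdrop) auto
    also have "\<dots> = (\<integral>\<^sup>+xs. indicator {xs. P xs} xs * ennreal \<theta> \<partial>measure_pmf ?r)"
    proof (intro nn_integral_cong_AE AE_pmfI)
      fix xs assume "xs \<in> set_pmf ?r"
      then have "sum_list (map J xs) \<in> set_pmf (walk_pmf (map_pmf J q) m)"
        unfolding map_path_replicate_pmf[symmetric] by auto
      from io_const[OF this, of R]
      show "emeasure S {s. P xs \<and> steps_io J R (0 + sum_list (map J xs)) s} = indicator {xs. P xs} xs * ennreal \<theta>"
        by (cases "P xs") (simp_all add: S.emeasure_eq_measure \<theta>_def B_def)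
    qed
    also have "\<dots> = emeasure (measure_pmf ?r) {xs. P xs} * ennreal \<theta>"
      by (simp add: nn_integral_multc)
    finally show ?thesis by (simp add: emeasure_stake)
  qed
  define R' where "R' n s = R (0 + stream_path J n s) (0 + stream_path J (Suc n) s)" for n s
  have U1: "S.prob {s. \<exists>n\<ge>k. R' n s} = 1" for k
  proof -
    define F where "F N = {s. \<exists>n\<in>{k..<N}. R' n s}" for N
    have "R' n s = (\<lambda>xs. R (sum_list (map J (take n xs))) (sum_list (map J (take (Suc n) xs)))) (stake N s)"
      if "n < N" for n N s
      using that by (simp add: R'_def stream_path_def take_stake min_def del: stake.simps)
    then have F_eq: "F N = {s. (\<lambda>xs. \<exists>n\<in>{k..<N}. R (sum_list (map J (take n xs))) (sum_list (map J (take (Suc n) xs)))) (stake N s)}" for N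
      unfolding F_def by (intro Collect_cong bex_cong refl) simp
    have F[measurable]: "F N \<in> S.events" for N
      unfolding F_eq by (rule pred_imp_event) measurable
    have FB: "S.prob (F N \<inter> B) = S.prob (F N) * \<theta>" for N
    proof -
      have "emeasure S (F N \<inter> B) = emeasure S (F N) * ennreal \<theta>"
        using indep[of "\<lambda>xs. \<exists>n\<in>{k..<N}. R (sum_list (map J (take n xs))) (sum_list (map J (take (Suc n) xs)))" N]
        unfolding F_eq .
      then show ?thesis by (simp add: S.emeasure_eq_measure \<theta>_def flip: ennreal_mult)
    qed
    have inc: "incseq F" by (auto simp: incseq_def F_def)
    have "(\<lambda>N. S.prob (F N \<inter> B)) \<longlonglongrightarrow> S.prob (\<Union>N. F N \<inter> B)"
      by (rule S.finite_Lim_measure_incseq) (use inc in \<open>auto simp: incseq_def\<close>)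
    moreover have "(\<Union>N. F N \<inter> B) = B"
      unfolding B_def F_def steps_io_def INFM_nat_le R'_def by fastforce
    moreover have "(\<lambda>N. S.prob (F N) * \<theta>) \<longlonglongrightarrow> S.prob (\<Union>N. F N) * \<theta>"
      by (intro tendsto_mult_right S.finite_Lim_measure_incseq inc) auto
    ultimately have "\<theta> = S.prob (\<Union>N. F N) * \<theta>"
      unfolding FB using LIMSEQ_unique by (metis \<theta>_def)
    moreover have "(\<Union>N. F N) = {s. \<exists>n\<ge>k. R' n s}"
      by (auto simp: F_def) (meson lessI atLeastLessThan_iff)
    ultimately show ?thesis using pos by (simp add: \<theta>_def B_def)
  qed
  have "(AE s in S. \<exists>n\<ge>k. R' n s)" for k
    using S.AE_prob_1[OF U1[of k]] by simp
  then have "AE s in S. \<forall>k. \<exists>n\<ge>k. R' n s" by (simp add: AE_all_countable)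
  then have "AE s in S. s \<in> B"
    by eventually_elim (simp add: B_def steps_io_def INFM_nat_le R'_def)
  then show ?thesis using S.prob_eq_1[OF B] by (simp add: B_def)
qed

end

section \<open>Two independent coordinates\<close>

lemma map_fst_snd_replicate_pmf:
  "map_pmf (\<lambda>xs. (map fst xs, map snd xs)) (replicate_pmf n (pair_pmf \<mu> \<nu>)) =
    pair_pmf (replicate_pmf n \<mu>) (replicate_pmf n \<nu>)"
proof (induction n)
  case (Suc n)
  have "map_pmf (\<lambda>xs. (map fst xs, map snd xs)) (replicate_pmf (Suc n) (pair_pmf \<mu> \<nu>)) =
      do {a \<leftarrow> \<mu>; b \<leftarrow> \<nu>; (xs, ys) \<leftarrow> map_pmf (\<lambda>xs. (map fst xs, map snd xs)) (replicate_pmf n (pair_pmf \<mu> \<nu>));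
        return_pmf (a # xs, b # ys)}"
    by (simp add: map_pmf_def pair_pmf_def bind_assoc_pmf bind_return_pmf)
  also have "\<dots> = do {a \<leftarrow> \<mu>; b \<leftarrow> \<nu>; xs \<leftarrow> replicate_pmf n \<mu>; ys \<leftarrow> replicate_pmf n \<nu>;
        return_pmf (a # xs, b # ys)}"
    unfolding Suc.IH by (simp add: pair_pmf_def bind_assoc_pmf bind_return_pmf)
  also have "\<dots> = do {a \<leftarrow> \<mu>; xs \<leftarrow> replicate_pmf n \<mu>; b \<leftarrow> \<nu>; ys \<leftarrow> replicate_pmf n \<nu>;
        return_pmf (a # xs, b # ys)}"
    by (subst bind_commute_pmf[of \<nu>]) simp
  also have "\<dots> = pair_pmf (replicate_pmf (Suc n) \<mu>) (replicate_pmf (Suc n) \<nu>)"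
    by (simp add: pair_pmf_def bind_assoc_pmf bind_return_pmf)
  finally show ?case .
qed simp

lemma map_map_replicate_pmf: "map_pmf (map f) (replicate_pmf n q) = replicate_pmf n (map_pmf f q)"
proof (induction n)
  case (Suc n)
  show ?case
    unfolding replicate_pmf.simps Suc.IH[symmetric]
    by (simp add: map_pmf_def bind_assoc_pmf bind_return_pmf)
qed simp

lemma pmf_replicate_pmf: "length xs = n \<Longrightarrow> pmf (replicate_pmf n q) xs = prod_list (map (pmf q) xs)"
proof (induction n arbitrary: xs)
  case (Suc n)
  then obtain x xs' where xs: "xs = x # xs'" "length xs' = n" by (cases xs) auto
  have "replicate_pmf (Suc n) q = map_pmf (\<lambda>(x, xs). x # xs) (pair_pmf q (replicate_pmf n q))"
    by (simp add: map_pmf_def pair_pmf_def bind_assoc_pmf bind_return_pmf)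
  then have "pmf (replicate_pmf (Suc n) q) xs = pmf (pair_pmf q (replicate_pmf n q)) (x, xs')"
    using pmf_map_inj'[of "\<lambda>(x, xs). x # xs" _ "(x, xs')"] by (simp add: xs inj_on_def)
  then show ?case using Suc.IH[OF xs(2)] by (simp add: xs pmf_pair)
qed simp

lemma fst_sum_list: "fst (sum_list xs) = sum_list (map fst xs)"
  by (induction xs) auto

lemma snd_sum_list: "snd (sum_list xs) = sum_list (map snd xs)"
  by (induction xs) auto

context pmf_stream
begin

lemma prob_stake: "S.prob {s. P (stake n s)} = measure_pmf.prob (replicate_pmf n q) {xs. P xs}"
  using emeasure_stake[of P n] by (simp add: S.emeasure_eq_measure measure_pmf.emeasure_eq_measure)

lemma prob_path: "S.prob {s. P (stream_path J n s)} = measure_pmf.prob (walk_pmf (map_pmf J q) n) {x. P x}"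
  unfolding map_path_replicate_pmf[symmetric] measure_map_pmf stream_path_def
    prob_stake[of "\<lambda>xs. P (sum_list (map J xs))"]
  by (rule arg_cong[where f="measure _"]) auto

lemma prob_stake_sdrop_le:
  assumes [measurable]: "\<And>xs. Measurable.pred (stream_space (count_space UNIV)) (Q xs)"
    and Q: "\<And>xs. P xs \<Longrightarrow> S.prob {s. Q xs s} \<le> c" and c: "0 \<le> c"
  shows "S.prob {s. P (stake n s) \<and> Q (stake n s) (sdrop n s)} \<le> S.prob {s. P (stake n s)} * c"
proof -
  have "emeasure S {s. P (stake n s) \<and> Q (stake n s) (sdrop n s)} =
      (\<integral>\<^sup>+xs. emeasure S {s. P xs \<and> Q xs s} \<partial>measure_pmf (replicate_pmf n q))"
    by (rule emeasure_stake_sdrop[of "\<lambda>xs s. P xs \<and> Q xs s"]) measurable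
  also have "\<dots> \<le> (\<integral>\<^sup>+xs. indicator {xs. P xs} xs * ennreal c \<partial>measure_pmf (replicate_pmf n q))"
  proof (rule nn_integral_mono)
    fix xs
    show "emeasure S {s. P xs \<and> Q xs s} \<le> indicator {xs. P xs} xs * ennreal c"
      using Q[of xs] by (cases "P xs") (auto simp: S.emeasure_eq_measure intro!: ennreal_leI)
  qed
  also have "\<dots> = emeasure (measure_pmf (replicate_pmf n q)) {xs. P xs} * ennreal c"
    by (simp add: nn_integral_multc)
  also have "\<dots> = ennreal (S.prob {s. P (stake n s)} * c)"
    using c by (simp add: ennreal_mult S.emeasure_eq_measure flip: emeasure_stake)
  finally show ?thesis using c by (simp add: S.emeasure_eq_measure)
qed

lemma prob_path_snth:
  "S.prob {s. P (stream_path J n s) (s !! n)} =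
    measure_pmf.prob (pair_pmf (walk_pmf (map_pmf J q) n) q) {(x, w). P x w}"
proof -
  have *: "emeasure S {s. P (y s) (shd s)} = emeasure (measure_pmf q) {w. P x w}" if "\<And>s. y s = x" for y x
  proof -
    have "emeasure S {s. P (y s) (shd s)} = emeasure S {s. (\<lambda>xs. P x (hd xs)) (stake 1 s)}"
      using that by simp
    also have "\<dots> = emeasure (measure_pmf q) {w. P x w}"
      unfolding emeasure_stake[of "\<lambda>xs. P x (hd xs)" 1] replicate_pmf_1 emeasure_map_pmf by (simp add: vimage_def)
    finally show ?thesis .
  qed
  have "emeasure S {s. P (stream_path J n s) (s !! n)} =
      emeasure S {s. (\<lambda>xs s. P (sum_list (map J xs)) (shd s)) (stake n s) (sdrop n s)}"
    by (simp add: stream_path_def)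
  also have "\<dots> = (\<integral>\<^sup>+xs. emeasure (measure_pmf q) {w. P (sum_list (map J xs)) w} \<partial>measure_pmf (replicate_pmf n q))"
  proof (subst emeasure_stake_sdrop)
    show "Measurable.pred (stream_space (count_space UNIV)) (\<lambda>s. P (sum_list (map J xs)) (shd s))" for xs
      by (rule measurable_compose[OF measurable_shd]) simp
  qed (simp add: *)
  also have "\<dots> = emeasure (measure_pmf (pair_pmf (walk_pmf (map_pmf J q) n) q)) {(x, w). P x w}"
    unfolding map_path_replicate_pmf[symmetric] emeasure_pair_pmf by simp
  finally show ?thesis by (simp add: S.emeasure_eq_measure measure_pmf.emeasure_eq_measure)
qed

lemma stream_path_Suc: "stream_path J (Suc n) s = stream_path J n s + J (s !! n)"
  using stream_path_add[of J n 1 s] by (simp add: stream_path_def)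

lemma prob_path_two_returns:
  fixes J :: "'w \<Rightarrow> int"
  shows "S.prob {s. stream_path J m s = 0 \<and> stream_path J (m + n) s = 0} \<le>
    ret_prob (map_pmf J q) m * ret_prob (map_pmf J q) n"
proof -
  have ret: "S.prob {s. stream_path J n s = 0} = ret_prob (map_pmf J q) n" for n
    using prob_path[of "\<lambda>x. x = 0" J n] by (simp add: ret_prob_def measure_pmf_single)
  have "{s. stream_path J m s = 0 \<and> stream_path J (m + n) s = 0} =
      {s. (\<lambda>xs. sum_list (map J xs) = 0) (stake m s) \<and> (\<lambda>_ s. stream_path J n s = 0) (stake m s) (sdrop m s)}"
    by (auto simp: stream_path_add[of J m n]) (auto simp: stream_path_def)
  also have "S.prob \<dots> \<le> S.prob {s. (\<lambda>xs. sum_list (map J xs) = 0) (stake m s)} * ret_prob (map_pmf J q) n"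
  proof (rule prob_stake_sdrop_le)
    show "Measurable.pred (stream_space (count_space UNIV)) (\<lambda>s. stream_path J n s = 0)"
      unfolding stream_path_def by (rule pred_stake[of "\<lambda>xs. sum_list (map J xs) = 0"])
  qed (simp_all add: ret, simp add: ret_prob_def)
  finally show ?thesis unfolding ret[symmetric] by (simp add: stream_path_def)
qed

lemma prob_path_between:
  fixes J :: "'w \<Rightarrow> int"
  shows "S.prob {s. weakly_between y (stream_path J n s) (stream_path J (Suc n) s)} =
    measure_pmf.prob (pair_pmf (walk_pmf (map_pmf J q) n) (map_pmf J q)) {(x, j). weakly_between y x (x + j)}"
  unfolding stream_path_Suc prob_path_snth[of "\<lambda>x w. weakly_between y x (x + J w)"]
    pair_map_pmf2 measure_map_pmf
  by (rule arg_cong[where f="measure _"]) auto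

text \<open>After the first crossing the walk starts afresh from an arbitrary point, and the second
  crossing is one of the level shifted by that point. This is where a bound uniform in
  \<open>y\<close> is needed.\<close>

lemma prob_path_two_between:
  fixes J :: "'w \<Rightarrow> int"
  assumes C: "\<And>y. measure_pmf.prob (pair_pmf (walk_pmf (map_pmf J q) n) (map_pmf J q))
      {(x, j). weakly_between y x (x + j)} \<le> c"
  shows "S.prob {s. weakly_between 0 (stream_path J m s) (stream_path J (Suc m) s) \<and>
      weakly_between 0 (stream_path J (Suc m + n) s) (stream_path J (Suc (Suc m + n)) s)} \<le>
    S.prob {s. weakly_between 0 (stream_path J m s) (stream_path J (Suc m) s)} * c"
proof -
  let ?P = "\<lambda>xs. weakly_between 0 (0 + sum_list (map J (take m xs))) (0 + sum_list (map J xs))"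
  let ?Q = "\<lambda>xs s. weakly_between (- sum_list (map J xs)) (stream_path J n s) (stream_path J (Suc n) s)"
  have P: "weakly_between 0 (stream_path J m s) (stream_path J (Suc m) s) \<longleftrightarrow> ?P (stake (Suc m) s)" for s
    using step_eq_stake[of "weakly_between 0" 0 J m s] by simp
  have sh: "weakly_between (- a) b c \<longleftrightarrow> weakly_between 0 (a + b) (a + c)" for a b c
    by (auto simp: weakly_between_def)
  have Q: "weakly_between 0 (stream_path J (Suc m + n) s) (stream_path J (Suc (Suc m + n)) s) \<longleftrightarrow>
      ?Q (stake (Suc m) s) (sdrop (Suc m) s)" for s
    using stream_path_add[of J "Suc m" n s] stream_path_add[of J "Suc m" "Suc n" s]
    unfolding sh by (simp add: stream_path_def[of J "Suc m"])
  have c: "0 \<le> c" using C[of 0] measure_nonneg order_trans by blast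
  have mQ: "Measurable.pred (stream_space (count_space UNIV)) (?Q xs)" for xs
    using pred_step[of "weakly_between (- sum_list (map J xs))" 0 J n] by (simp only: add_0_left)
  have "S.prob {s. weakly_between 0 (stream_path J m s) (stream_path J (Suc m) s) \<and>
      weakly_between 0 (stream_path J (Suc m + n) s) (stream_path J (Suc (Suc m + n)) s)} =
    S.prob {s. ?P (stake (Suc m) s) \<and> ?Q (stake (Suc m) s) (sdrop (Suc m) s)}"
    by (intro arg_cong[where f="S.prob"] Collect_cong arg_cong2[where f="(\<and>)"] P Q)
  also have "\<dots> \<le> S.prob {s. ?P (stake (Suc m) s)} * c"
    by (rule prob_stake_sdrop_le[of ?Q ?P c "Suc m", OF mQ _ c]) (unfold prob_path_between, rule C)
  also have "S.prob {s. ?P (stake (Suc m) s)} =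
      S.prob {s. weakly_between 0 (stream_path J m s) (stream_path J (Suc m) s)}"
    by (intro arg_cong[where f="S.prob"] Collect_cong P[symmetric])
  finally show ?thesis .
qed

text \<open>Both events look at a prefix of the same length \<open>N\<close>, and projecting it to
  the coordinates gives two independent lists.\<close>

lemma prob_two_coordinates:
  fixes J :: "'w \<Rightarrow> 'a::countable \<times> 'b::countable"
  assumes J: "map_pmf J q = pair_pmf \<mu> \<nu>"
  shows "S.prob {s. P (map (\<lambda>w. fst (J w)) (stake N s)) \<and> Q (map (\<lambda>w. snd (J w)) (stake N s))} =
    S.prob {s. P (map (\<lambda>w. fst (J w)) (stake N s))} * S.prob {s. Q (map (\<lambda>w. snd (J w)) (stake N s))}"
proof -
  let ?r = "replicate_pmf N q"
  have "map_pmf (\<lambda>xs. (map (\<lambda>w. fst (J w)) xs, map (\<lambda>w. snd (J w)) xs)) ?r =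
      map_pmf (\<lambda>xs. (map fst xs, map snd xs)) (map_pmf (map J) ?r)"
    by (simp add: pmf.map_comp o_def)
  then have eq: "map_pmf (\<lambda>xs. (map (\<lambda>w. fst (J w)) xs, map (\<lambda>w. snd (J w)) xs)) ?r =
      pair_pmf (replicate_pmf N \<mu>) (replicate_pmf N \<nu>)"
    unfolding map_map_replicate_pmf J map_fst_snd_replicate_pmf .
  have pr: "S.prob {s. P (map (\<lambda>w. fst (J w)) (stake N s)) \<and> Q (map (\<lambda>w. snd (J w)) (stake N s))} =
      measure_pmf.prob (replicate_pmf N \<mu>) {xs. P xs} * measure_pmf.prob (replicate_pmf N \<nu>) {xs. Q xs}" for P Q
  proof -
    have "S.prob {s. P (map (\<lambda>w. fst (J w)) (stake N s)) \<and> Q (map (\<lambda>w. snd (J w)) (stake N s))} =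
        measure_pmf.prob ?r {xs. P (map (\<lambda>w. fst (J w)) xs) \<and> Q (map (\<lambda>w. snd (J w)) xs)}"
      by (rule prob_stake)
    also have "\<dots> = measure_pmf.prob (pair_pmf (replicate_pmf N \<mu>) (replicate_pmf N \<nu>)) ({xs. P xs} \<times> {xs. Q xs})"
      unfolding eq[symmetric] measure_map_pmf by (rule arg_cong[where f="measure _"]) auto
    also have "\<dots> = measure_pmf.prob (replicate_pmf N \<mu>) {xs. P xs} * measure_pmf.prob (replicate_pmf N \<nu>) {xs. Q xs}"
      by (rule prob_pair_pmf_Times)
    finally show ?thesis .
  qed
  show ?thesis
    using pr[of P Q] pr[of P "\<lambda>_. True"] pr[of "\<lambda>_. True" Q] by simp
qed


text \<open>\<open>b\<close> tells when the first coordinate is read: at the end of step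
  \<open>n\<close> (\<open>b = 1\<close>) for vertical blocks, which follow the horizontal jump of
  their cycle, and at its start (\<open>b = 0\<close>) for horizontal blocks, with the coordinates
  exchanged. Divergence of the same series is assumed in both cases.\<close>

lemma straddle_io_prob_1:
  fixes J :: "'w \<Rightarrow> int \<times> int"
  assumes J: "map_pmf J q = pair_pmf \<mu> \<nu>"
    and sym: "symmetric_walk \<nu>"
    and div: "\<not> summable (\<lambda>n. ret_prob \<mu> (Suc n) * straddle_prob \<nu> n)"
    and b: "b \<le> (1::nat)"
  shows "S.prob {s. \<exists>\<^sub>\<infinity>n. fst (stream_path J (n + b) s) = 0 \<and>
    weakly_between 0 (snd (stream_path J n s)) (snd (stream_path J (Suc n) s))} = 1"
proof -
  interpret \<nu>: symmetric_walk \<nu> by (rule sym)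
  let ?U = "\<lambda>w. fst (J w)" and ?V = "\<lambda>w. snd (J w)"
  have fst_path: "fst (stream_path J n s) = stream_path ?U n s" for n s
    unfolding stream_path_def by (simp add: fst_sum_list o_def)
  have snd_path: "snd (stream_path J n s) = stream_path ?V n s" for n s
    unfolding stream_path_def by (simp add: snd_sum_list o_def)
  have \<mu>: "map_pmf ?U q = \<mu>"
    using arg_cong[OF J, of "map_pmf fst"] by (simp add: pmf.map_comp o_def map_fst_pair_pmf)
  have \<nu>: "map_pmf ?V q = \<nu>"
    using arg_cong[OF J, of "map_pmf snd"] by (simp add: pmf.map_comp o_def map_snd_pair_pmf)
  \<comment> \<open>Given \<open>E n\<close>, the event \<open>E (Suc n + k)\<close> demands a
    return of the first coordinate after \<open>Suc k\<close> steps, whereas the second coordinate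
    has only \<open>k\<close> fresh steps after the crossing from \<open>n\<close> to
    \<open>Suc n\<close>. This offset produces exactly the term of the given series.\<close>
  define f where "f k = ret_prob \<mu> (Suc k) * straddle_prob \<nu> k" for k
  have f0: "0 \<le> f k" for k
    by (simp add: f_def \<nu>.straddle_prob_nonneg ret_prob_def)
  obtain C where C: "C > 0" "\<And>n y. measure_pmf.prob (pair_pmf (walk_pmf \<nu> n) \<nu>)
      {(x, j). weakly_between y x (x + j)} \<le> C * straddle_prob \<nu> n"
    using \<nu>.between_le by auto
  obtain c where c: "c > 0" "\<And>n. c * straddle_prob \<nu> n \<le> straddle_prob \<nu> (Suc n)"
    using \<nu>.straddle_Suc by auto
  define A where "A n s \<longleftrightarrow> stream_path ?U (n + b) s = 0" for n s
  define B where "B n s \<longleftrightarrow> weakly_between 0 (stream_path ?V n s) (stream_path ?V (Suc n) s)" for n s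
  define E where "E n = {s. A n s \<and> B n s}" for n
  have path_stake: "stream_path f n s = sum_list (take n (map f (stake N s)))" if "n \<le> N" for f :: "'w \<Rightarrow> int" and n N s
    using that by (simp add: stream_path_def take_map take_stake min_def)
  have factor: "S.prob {s. P s \<and> Q s} = S.prob {s. P s} * S.prob {s. Q s}"
    if "\<And>s. P s \<longleftrightarrow> P' (map ?U (stake N s))" "\<And>s. Q s \<longleftrightarrow> Q' (map ?V (stake N s))" for P Q P' Q' N
    unfolding that by (rule prob_two_coordinates[OF J])
  have e: "S.prob (E n) = S.prob {s. A n s} * S.prob {s. B n s}" for n
    unfolding E_def
  proof (rule factor)
    show "A n s \<longleftrightarrow> (\<lambda>xs. sum_list (take (n + b) xs) = 0) (map ?U (stake (Suc n) s))" for s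
      using b unfolding A_def by (subst path_stake[of _ "Suc n"]) auto
    show "B n s \<longleftrightarrow> (\<lambda>xs. weakly_between 0 (sum_list (take n xs)) (sum_list (take (Suc n) xs))) (map ?V (stake (Suc n) s))" for s
      unfolding B_def by (subst (1 2) path_stake[of _ "Suc n"]) auto
  qed
  have PA: "S.prob {s. A n s} = ret_prob \<mu> (n + b)" for n
    using prob_path[of "\<lambda>x. x = 0" ?U "n + b"] by (simp add: A_def ret_prob_def measure_pmf_single \<mu>)
  have PB: "straddle_prob \<nu> n \<le> S.prob {s. B n s}" for n
    using \<nu>.between_0_ge[of n] unfolding B_def prob_path_between \<nu> .
  have e_ge: "ret_prob \<mu> (n + b) * straddle_prob \<nu> n \<le> S.prob (E n)" for n
    unfolding e PA by (intro mult_left_mono PB) (simp add: ret_prob_def)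
  have two: "S.prob (E n \<inter> E (Suc n + k)) \<le> S.prob (E n) * (C * f k)" for n k
  proof -
    let ?m = "Suc n + k"
    have "S.prob (E n \<inter> E ?m) = S.prob {s. (A n s \<and> A ?m s) \<and> (B n s \<and> B ?m s)}"
      unfolding E_def by (rule arg_cong[where f="S.prob"]) auto
    also have "\<dots> = S.prob {s. A n s \<and> A ?m s} * S.prob {s. B n s \<and> B ?m s}"
    proof (rule factor)
      show "A n s \<and> A ?m s \<longleftrightarrow> (\<lambda>xs. sum_list (take (n + b) xs) = 0 \<and> sum_list (take (?m + b) xs) = 0)
          (map ?U (stake (Suc ?m) s))" for s
        using b unfolding A_def by (subst (1 2) path_stake[of _ "Suc ?m"]) (simp_all del: stake.simps take_map)
      show "B n s \<and> B ?m s \<longleftrightarrow> (\<lambda>xs. weakly_between 0 (sum_list (take n xs)) (sum_list (take (Suc n) xs)) \<and>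
          weakly_between 0 (sum_list (take ?m xs)) (sum_list (take (Suc ?m) xs)))
          (map ?V (stake (Suc ?m) s))" for s
        unfolding B_def by (subst (1 2 3 4) path_stake[of _ "Suc ?m"]) (simp_all del: stake.simps take_map)
    qed
    also have "\<dots> \<le> (ret_prob \<mu> (n + b) * ret_prob \<mu> (Suc k)) * (S.prob {s. B n s} * (C * straddle_prob \<nu> k))"
    proof (rule mult_mono)
      show "S.prob {s. A n s \<and> A ?m s} \<le> ret_prob \<mu> (n + b) * ret_prob \<mu> (Suc k)"
        using prob_path_two_returns[of ?U "n + b" "Suc k"] unfolding A_def \<mu> by (simp add: ac_simps)
      show "S.prob {s. B n s \<and> B ?m s} \<le> S.prob {s. B n s} * (C * straddle_prob \<nu> k)"
        unfolding B_def by (rule prob_path_two_between) (unfold \<nu>, rule C(2))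
    qed (simp_all add: ret_prob_def)
    also have "\<dots> = S.prob (E n) * (C * f k)"
      unfolding e PA by (simp add: f_def)
    finally show ?thesis .
  qed
  \<comment> \<open>For \<open>b = 0\<close> the event with return time \<open>Suc k\<close> is
    \<open>E (Suc k)\<close>, whose crossing is one step later than the one in \<open>f k\<close>;
    \<open>straddle_Suc\<close> pays 1 / c for it. For \<open>b = 1\<close> the times agree.\<close>
  define K where "K = max 1 (1 / c)"
  have K: "K \<ge> 1" "1 / c \<le> K" by (simp_all add: K_def)
  have f_le: "f k \<le> K * S.prob (E (Suc k - b))" for k
  proof (cases "b = 0")
    case True
    have "straddle_prob \<nu> k \<le> 1 / c * straddle_prob \<nu> (Suc k)"
      using c(1) c(2)[of k] by (simp add: field_simps)
    also have "\<dots> \<le> K * straddle_prob \<nu> (Suc k)"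
      by (intro mult_right_mono K \<nu>.straddle_prob_nonneg)
    finally have "f k \<le> ret_prob \<mu> (Suc k) * (K * straddle_prob \<nu> (Suc k))"
      unfolding f_def by (intro mult_left_mono) (auto simp: ret_prob_def)
    also have "\<dots> = K * (ret_prob \<mu> (Suc k) * straddle_prob \<nu> (Suc k))" by simp
    also have "\<dots> \<le> K * S.prob (E (Suc k))"
      using e_ge[of "Suc k"] K True by (intro mult_left_mono) auto
    finally show ?thesis using True by simp
  next
    case False
    with b have b1: "b = 1" by simp
    have "f k \<le> 1 * S.prob (E k)" using e_ge[of k] by (simp add: f_def b1)
    also have "\<dots> \<le> K * S.prob (E k)" using K by (intro mult_right_mono) auto
    finally show ?thesis by (simp add: b1)
  qed
  have E_event: "E n \<in> S.events" for n
  proof -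
    have [measurable]: "Measurable.pred (stream_space (count_space UNIV)) (A n)"
      unfolding A_def stream_path_def by (rule pred_stake[of "\<lambda>xs. sum_list (map ?U xs) = 0"])
    have [measurable]: "Measurable.pred (stream_space (count_space UNIV)) (B n)"
      using pred_step[of "weakly_between 0" 0 ?V n] unfolding B_def[abs_def] by (simp only: add_0_left)
    show ?thesis unfolding E_def by (rule pred_imp_event) measurable
  qed
  have "0 < S.prob {s \<in> space S. \<exists>\<^sub>\<infinity>n. s \<in> E n}"
  proof (rule S.kochen_stone[where K="C * K"])
    show "\<not> summable (\<lambda>n. S.prob (E n))"
    proof
      assume "summable (\<lambda>n. S.prob (E n))"
      then have "summable (\<lambda>n. S.prob (E (n + (1 - b))))" by (rule summable_ignore_initial_segment)
      moreover have "n + (1 - b) = Suc n - b" for n using b by auto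
      ultimately have "summable (\<lambda>n. K * S.prob (E (Suc n - b)))" by (auto intro: summable_mult)
      then have "summable f" by (rule summable_comparison_test[rotated]) (use f0 f_le in auto)
      with div show False by (simp add: f_def[abs_def])
    qed
    show "(\<Sum>m\<in>{n<..<N}. S.prob (E n \<inter> E m)) \<le> C * K * S.prob (E n) * (1 + (\<Sum>m<N. S.prob (E m)))"
      if "n < N" for n N
    proof -
      have "(\<Sum>m\<in>{n<..<N}. S.prob (E n \<inter> E m)) = (\<Sum>k<N - Suc n. S.prob (E n \<inter> E (Suc n + k)))"
        by (rule sum.reindex_bij_witness[of _ "\<lambda>k. Suc n + k" "\<lambda>m. m - Suc n"]) auto
      also have "\<dots> \<le> (\<Sum>k<N - Suc n. S.prob (E n) * (C * f k))"
        by (intro sum_mono two)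
      also have "\<dots> \<le> (\<Sum>k<N - 1. S.prob (E n) * (C * f k))"
        using C(1) f0 by (intro sum_mono2) auto
      also have "\<dots> \<le> (\<Sum>k<N - 1. S.prob (E n) * (C * (K * S.prob (E (Suc k - b)))))"
        using C(1) by (intro sum_mono mult_left_mono f_le) auto
      also have "\<dots> = C * K * S.prob (E n) * (\<Sum>k<N - 1. S.prob (E (Suc k - b)))"
        by (simp add: sum_distrib_left ac_simps)
      also have "\<dots> \<le> C * K * S.prob (E n) * (1 + (\<Sum>m<N. S.prob (E m)))"
      proof (intro mult_left_mono)
        have "(\<Sum>k<N - 1. S.prob (E (Suc k - b))) = (\<Sum>m\<in>(\<lambda>k. Suc k - b) ` {..<N - 1}. S.prob (E m))"
          by (subst sum.reindex) (use b in \<open>auto simp: inj_on_def\<close>)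
        also have "\<dots> \<le> (\<Sum>m<N. S.prob (E m))" by (intro sum_mono2) auto
        finally show "(\<Sum>k<N - 1. S.prob (E (Suc k - b))) \<le> 1 + (\<Sum>m<N. S.prob (E m))" by simp
      qed (use C(1) K in auto)
      finally show ?thesis .
    qed
  qed (use C(1) K E_event in auto)
  \<comment> \<open>A relation between the two ends of a step can read the first coordinate at
    either end, so both values of \<open>b\<close> fit the zero-one law.\<close>
  moreover define R where "R p p' \<longleftrightarrow> (if b = 0 then fst p else fst p') = (0::int) \<and> weakly_between 0 (snd p) (snd p')"
    for p p' :: "int \<times> int"
  have "s \<in> E n \<longleftrightarrow> R (0 + stream_path J n s) (0 + stream_path J (Suc n) s)" for s n
    using b by (cases b) (auto simp: E_def A_def B_def R_def fst_path snd_path)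
  then have "{s \<in> space S. \<exists>\<^sub>\<infinity>n. s \<in> E n} = {s. steps_io J R 0 s}"
    by (simp add: steps_io_def)
  ultimately have "S.prob {s \<in> space S. \<exists>\<^sub>\<infinity>n. s \<in> E n} = 1"
    using io_zero_one[of J R] by simp
  then show ?thesis by (simp add: E_def A_def B_def fst_path snd_path)
qed

end

section \<open>Cycles of a horizontal and a vertical block\<close>

instance dir :: countable
  by countable_datatype

fun alternating :: "dir \<Rightarrow> nat list \<Rightarrow> (dir \<times> nat) list" where
  "alternating d [] = []"
| "alternating d (l # ls) = (d, l) # alternating (opposite d) ls"

fun displacement :: "(dir \<times> nat) list \<Rightarrow> int \<times> int" where
  "displacement [] = 0"
| "displacement ((d, l) # w) = (int l * fst (step d), int l * snd (step d)) + displacement w"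

text \<open>The offset \<open>t\<close> includes both endpoints, so a visit at a turning point is
  credited to two runs. This agrees with the closed intervals of \<open>weakly_between\<close> and
  does not affect whether visits are infinitely many.\<close>

fun hits_origin :: "int \<times> int \<Rightarrow> (dir \<times> nat) list \<Rightarrow> bool" where
  "hits_origin p [] \<longleftrightarrow> False"
| "hits_origin p ((d, l) # w) \<longleftrightarrow>
    (\<exists>t\<le>l. p + (int t * fst (step d), int t * snd (step d)) = 0) \<or>
    hits_origin (p + (int l * fst (step d), int l * snd (step d))) w"

definition hdir :: "int \<Rightarrow> dir" where "hdir \<epsilon> = (if \<epsilon> = 1 then East else West)"
definition vdir :: "int \<Rightarrow> dir" where "vdir \<epsilon> = (if \<epsilon> = 1 then North else South)"

fun cycle_word :: "(int \<times> nat list) \<times> (int \<times> nat list) \<Rightarrow> (dir \<times> nat) list" where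
  "cycle_word ((\<epsilon>, ls), (\<delta>, ms)) = alternating (hdir \<epsilon>) ls @ alternating (vdir \<delta>) ms"

lemma displacement_append: "displacement (w @ w') = displacement w + displacement w'"
  by (induction w rule: displacement.induct) (auto simp: add.assoc)

lemma hits_origin_append:
  "hits_origin p (w @ w') \<longleftrightarrow> hits_origin p w \<or> hits_origin (p + displacement w) w'"
  by (induction p w rule: hits_origin.induct) (auto simp: add.assoc)

lemma displacement_hdir: "\<epsilon> \<in> {- 1, 1} \<Longrightarrow> displacement (alternating (hdir \<epsilon>) ls) = (altsum \<epsilon> ls, 0)"
proof (induction ls arbitrary: \<epsilon>)
  case (Cons l ls)
  have "opposite (hdir \<epsilon>) = hdir (- \<epsilon>)" "fst (step (hdir \<epsilon>)) = \<epsilon>" "snd (step (hdir \<epsilon>)) = 0"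
    using Cons.prems by (auto simp: hdir_def)
  moreover have "- \<epsilon> \<in> {- 1, 1}" using Cons.prems by auto
  ultimately show ?case using Cons.IH[of "- \<epsilon>"] by (simp add: mult.commute)
qed (simp add: zero_prod_def)

lemma displacement_vdir: "\<epsilon> \<in> {- 1, 1} \<Longrightarrow> displacement (alternating (vdir \<epsilon>) ls) = (0, altsum \<epsilon> ls)"
proof (induction ls arbitrary: \<epsilon>)
  case (Cons l ls)
  have "opposite (vdir \<epsilon>) = vdir (- \<epsilon>)" "fst (step (vdir \<epsilon>)) = 0" "snd (step (vdir \<epsilon>)) = \<epsilon>"
    using Cons.prems by (auto simp: vdir_def)
  moreover have "- \<epsilon> \<in> {- 1, 1}" using Cons.prems by auto
  ultimately show ?case using Cons.IH[of "- \<epsilon>"] by (simp add: mult.commute)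
qed (simp add: zero_prod_def)

lemma weakly_between_0_iff:
  assumes "\<epsilon> \<in> {- 1, 1}"
  shows "weakly_between 0 x (x + \<epsilon> * int l) \<longleftrightarrow> (\<exists>t\<le>l. x + \<epsilon> * int t = 0)"
proof
  assume "weakly_between 0 x (x + \<epsilon> * int l)"
  then show "\<exists>t\<le>l. x + \<epsilon> * int t = 0"
    using assms by (intro exI[of _ "nat \<bar>x\<bar>"]) (auto simp: weakly_between_def)
next
  assume "\<exists>t\<le>l. x + \<epsilon> * int t = 0"
  then show "weakly_between 0 x (x + \<epsilon> * int l)"
    using assms by (auto simp: weakly_between_def)
qed

lemma hits_origin_hdir:
  "\<epsilon> \<in> {- 1, 1} \<Longrightarrow> hits_origin (x, y) (alternating (hdir \<epsilon>) ls) \<longleftrightarrow> y = 0 \<and> line_hit x \<epsilon> ls"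
proof (induction ls arbitrary: x \<epsilon>)
  case (Cons l ls)
  have "opposite (hdir \<epsilon>) = hdir (- \<epsilon>)" "fst (step (hdir \<epsilon>)) = \<epsilon>" "snd (step (hdir \<epsilon>)) = 0"
    using Cons.prems by (auto simp: hdir_def)
  moreover have "- \<epsilon> \<in> {- 1, 1}" using Cons.prems by auto
  ultimately show ?case
    using Cons.IH[of "- \<epsilon>" "x + \<epsilon> * int l"] weakly_between_0_iff[OF Cons.prems, of x l]
    by (auto simp: zero_prod_def mult.commute)
qed simp

lemma hits_origin_vdir:
  "\<epsilon> \<in> {- 1, 1} \<Longrightarrow> hits_origin (x, y) (alternating (vdir \<epsilon>) ls) \<longleftrightarrow> x = 0 \<and> line_hit y \<epsilon> ls"
proof (induction ls arbitrary: y \<epsilon>)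
  case (Cons l ls)
  have "opposite (vdir \<epsilon>) = vdir (- \<epsilon>)" "fst (step (vdir \<epsilon>)) = 0" "snd (step (vdir \<epsilon>)) = \<epsilon>"
    using Cons.prems by (auto simp: vdir_def)
  moreover have "- \<epsilon> \<in> {- 1, 1}" using Cons.prems by auto
  ultimately show ?case
    using Cons.IH[of "- \<epsilon>" "y + \<epsilon> * int l"] weakly_between_0_iff[OF Cons.prems, of y l]
    by (auto simp: zero_prod_def mult.commute)
qed simp

lemma set_pmf_block_subset: "set_pmf (block_pmf \<nu> p) \<subseteq> {- 1, 1} \<times> {ls. ls \<noteq> []}"
  by (auto simp: block_pmf_def runs_pmf_def set_replicate_pmf)

lemma pair_pair_swap_pmf:
  "pair_pmf (pair_pmf A B) (pair_pmf C D) =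
    map_pmf (\<lambda>((a, c), (b, d)). ((a, b), (c, d))) (pair_pmf (pair_pmf A C) (pair_pmf B D))"
proof -
  have "pair_pmf (pair_pmf A B) (pair_pmf C D) =
      do {a \<leftarrow> A; b \<leftarrow> B; c \<leftarrow> C; d \<leftarrow> D; return_pmf ((a, b), (c, d))}"
    by (simp add: pair_pmf_def bind_assoc_pmf bind_return_pmf)
  also have "\<dots> = do {a \<leftarrow> A; c \<leftarrow> C; b \<leftarrow> B; d \<leftarrow> D; return_pmf ((a, b), (c, d))}"
    by (subst bind_commute_pmf[of B]) simp
  finally show ?thesis
    by (simp add: map_pmf_def pair_pmf_def bind_assoc_pmf bind_return_pmf)
qed

section \<open>Cycles that hit the origin\<close>

context drrw_parameters
begin

text \<open>The first direction is a fair choice between east and west, so that all cycles have the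
  same law; the start of the walk with \<open>East\<close> conditions the first word only.\<close>

definition word_pmf :: "(dir \<times> nat) list pmf" where
  "word_pmf = map_pmf cycle_word (pair_pmf (block_pmf \<nu>\<^sub>h p\<^sub>h) (block_pmf \<nu>\<^sub>v p\<^sub>v))"

abbreviation "\<mu>\<^sub>h \<equiv> jump_pmf \<nu>\<^sub>h p\<^sub>h"
abbreviation "\<mu>\<^sub>v \<equiv> jump_pmf \<nu>\<^sub>v p\<^sub>v"

sublocale words: pmf_stream word_pmf .

lemma set_word_pmfE:
  assumes "w \<in> set_pmf word_pmf"
  obtains \<epsilon> ls \<delta> ms where "w = alternating (hdir \<epsilon>) ls @ alternating (vdir \<delta>) ms"
    "\<epsilon> \<in> {- 1, 1}" "\<delta> \<in> {- 1, 1}" "ls \<noteq> []" "ms \<noteq> []"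
  using assms set_pmf_block_subset[of \<nu>\<^sub>h p\<^sub>h] set_pmf_block_subset[of \<nu>\<^sub>v p\<^sub>v]
  unfolding word_pmf_def by fastforce

lemma map_displacement_word_pmf: "map_pmf displacement word_pmf = pair_pmf \<mu>\<^sub>h \<mu>\<^sub>v"
proof -
  have "map_pmf displacement word_pmf = map_pmf (\<lambda>(b, c). ((\<lambda>(\<epsilon>, ls). altsum \<epsilon> ls) b, (\<lambda>(\<epsilon>, ls). altsum \<epsilon> ls) c))
      (pair_pmf (block_pmf \<nu>\<^sub>h p\<^sub>h) (block_pmf \<nu>\<^sub>v p\<^sub>v))"
    unfolding word_pmf_def pmf.map_comp
    using set_pmf_block_subset[of \<nu>\<^sub>h p\<^sub>h] set_pmf_block_subset[of \<nu>\<^sub>v p\<^sub>v]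
    by (intro map_pmf_cong refl)
      (fastforce simp: displacement_append displacement_hdir displacement_vdir)
  then show ?thesis unfolding map_pair map_altsum_block_pmf .
qed

abbreviation "word_path \<equiv> stream_path displacement"

definition word_hit :: "nat \<Rightarrow> (dir \<times> nat) list stream \<Rightarrow> bool" where
  "word_hit k s \<longleftrightarrow> hits_origin (word_path k s) (s !! k)"

lemma pred_word_hit [measurable]:
  "Measurable.pred (stream_space (count_space UNIV)) (word_hit k)"
proof -
  have "word_hit k = (\<lambda>s. (\<lambda>ws. hits_origin (sum_list (map displacement (take k ws))) (last ws)) (stake (Suc k) s))"
    by (auto simp: word_hit_def stream_path_def take_stake min_def last_conv_nth stake_nth fun_eq_iff simp del: stake.simps)
  then show ?thesis
    using pred_stake[of "\<lambda>ws. hits_origin (sum_list (map displacement (take k ws))) (last ws)" "Suc k"]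
    by metis
qed

lemma AE_words: "AE s in words.S. \<forall>k. s !! k \<in> set_pmf word_pmf"
proof -
  have "AE s in words.S. stream_all (\<lambda>w. w \<in> set_pmf word_pmf) s"
    unfolding words.S_def
    by (rule prob_space.AE_stream_all[OF measure_pmf.prob_space_axioms]) (auto simp: AE_measure_pmf_iff)
  then show ?thesis by eventually_elim (auto simp: stream_all_def)
qed

definition return_v :: "nat \<Rightarrow> real" where
  "return_v n = ret_prob \<mu>\<^sub>h (Suc n) * straddle_prob \<mu>\<^sub>v n"

text \<open>The return is taken at \<open>Suc n\<close> although the horizontal block of cycle
  \<open>n\<close> lives at the ordinate \<open>V n\<close>; \<open>word_hits_finite\<close> and the
  case \<open>b = 0\<close> above bridge this gap.\<close>

definition return_h :: "nat \<Rightarrow> real" where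
  "return_h n = ret_prob \<mu>\<^sub>v (Suc n) * straddle_prob \<mu>\<^sub>h n"

sublocale h: symmetric_walk "\<mu>\<^sub>h" by (rule symmetric_walk_jump)
sublocale v: symmetric_walk "\<mu>\<^sub>v" by (rule symmetric_walk_jump)

text \<open>In cycle \<open>k\<close> the horizontal block moves at ordinate \<open>V k\<close>,
  which must be 0 for a hit; the vertical block moves at the abscissa \<open>H (k + 1)\<close>
  reached by then. Independence of the coordinates makes both bounds products.\<close>

lemma prob_word_hit_le:
  "words.S.prob {s. word_hit k s} \<le>
    2 / (1 - p\<^sub>h) * (ret_prob \<mu>\<^sub>v k * straddle_prob \<mu>\<^sub>h k) + 2 / (1 - p\<^sub>v) * return_v k"
proof -
  let ?Wh = "walk_pmf \<mu>\<^sub>h k" and ?Wv = "walk_pmf \<mu>\<^sub>v k"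
  let ?Bh = "block_pmf \<nu>\<^sub>h p\<^sub>h" and ?Bv = "block_pmf \<nu>\<^sub>v p\<^sub>v"
  let ?P = "measure_pmf.prob (pair_pmf (pair_pmf ?Wh ?Bh) (pair_pmf ?Wv ?Bv))"
  have "words.S.prob {s. word_hit k s} = measure_pmf.prob (pair_pmf (pair_pmf ?Wh ?Wv) word_pmf) {(p, w). hits_origin p w}"
    unfolding word_hit_def words.prob_path_snth map_displacement_word_pmf walk_pmf_pair ..
  also have "\<dots> = ?P {((x, b), (y, c)). hits_origin (x, y) (cycle_word (b, c))}"
    unfolding word_pmf_def pair_map_pmf2 pair_pair_swap_pmf[of ?Wh ?Wv ?Bh ?Bv] measure_map_pmf
    by (rule arg_cong[where f="measure _"]) auto
  also have "\<dots> \<le> ?P ({(x, (\<epsilon>, ls)). line_hit x \<epsilon> ls} \<times> ({0} \<times> UNIV) \<union>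
      {(x, (\<epsilon>, ls)). x + altsum \<epsilon> ls = 0} \<times> {(y, (\<delta>, ms)). line_hit y \<delta> ms})"
  proof (rule measure_pmf.finite_measure_mono_AE, intro AE_pmfI impI)
    fix z assume "z \<in> set_pmf (pair_pmf (pair_pmf ?Wh ?Bh) (pair_pmf ?Wv ?Bv))"
      and z: "z \<in> {((x, b), (y, c)). hits_origin (x, y) (cycle_word (b, c))}"
    then obtain x \<epsilon> ls y \<delta> ms where "z = ((x, (\<epsilon>, ls)), (y, (\<delta>, ms)))" "\<epsilon> \<in> {- 1, 1}" "\<delta> \<in> {- 1, 1}"
      using set_pmf_block_subset[of \<nu>\<^sub>h p\<^sub>h] set_pmf_block_subset[of \<nu>\<^sub>v p\<^sub>v] by fastforce
    with z show "z \<in> {(x, (\<epsilon>, ls)). line_hit x \<epsilon> ls} \<times> ({0} \<times> UNIV) \<union>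
      {(x, (\<epsilon>, ls)). x + altsum \<epsilon> ls = 0} \<times> {(y, (\<delta>, ms)). line_hit y \<delta> ms}"
      by (auto simp: hits_origin_append displacement_hdir hits_origin_hdir hits_origin_vdir)
  qed auto
  also have "\<dots> \<le> ?P ({(x, (\<epsilon>, ls)). line_hit x \<epsilon> ls} \<times> ({0} \<times> UNIV)) +
      ?P ({(x, (\<epsilon>, ls)). x + altsum \<epsilon> ls = 0} \<times> {(y, (\<delta>, ms)). line_hit y \<delta> ms})"
    by (rule measure_Un_le) auto
  also have "\<dots> \<le> (2 / (1 - p\<^sub>h) * straddle_prob \<mu>\<^sub>h k) * ret_prob \<mu>\<^sub>v k +
      ret_prob \<mu>\<^sub>h (Suc k) * (2 / (1 - p\<^sub>v) * straddle_prob \<mu>\<^sub>v k)"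
  proof -
    have "measure_pmf.prob (pair_pmf ?Wh ?Bh) {(x, (\<epsilon>, ls)). x + altsum \<epsilon> ls = 0} =
        measure_pmf.prob (walk_pmf \<mu>\<^sub>h (k + 1)) {0}"
      unfolding walk_pmf_add One_nat_def walk_pmf_1 map_altsum_block_pmf[symmetric] pair_map_pmf2 measure_map_pmf
      by (rule arg_cong[where f="measure _"]) auto
    then have "measure_pmf.prob (pair_pmf ?Wh ?Bh) {(x, (\<epsilon>, ls)). x + altsum \<epsilon> ls = 0} = ret_prob \<mu>\<^sub>h (Suc k)"
      by (simp only: measure_pmf_single ret_prob_def Suc_eq_plus1)
    then show ?thesis
      unfolding prob_pair_pmf_Times
      using walk_line_hit_le[OF turn_range(1,2), of \<nu>\<^sub>h k] walk_line_hit_le[OF turn_range(3,4), of \<nu>\<^sub>v k] turn_range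
      by (intro add_mono mult_mono) (auto simp: measure_pmf_single ret_prob_def h.straddle_prob_nonneg)
  qed
  finally show ?thesis by (simp add: return_v_def ac_simps)
qed

lemma word_hits_finite:
  assumes "summable return_v" "summable return_h"
  shows "words.S.prob {s. \<exists>\<^sub>\<infinity>k. word_hit k s} = 0"
proof -
  obtain c where c: "c > 0" "\<And>n. c * straddle_prob \<mu>\<^sub>h n \<le> straddle_prob \<mu>\<^sub>h (Suc n)"
    using h.straddle_Suc by auto
  define c' where "c' = ret_prob \<mu>\<^sub>v 2 * c"
  have c': "c' > 0" using c(1) v.ret_prob_2_pos by (simp add: c'_def)
  \<comment> \<open>The return is delayed by 2, since parity may forbid a delay by 1, and the
    crossing by 1; these are the indices of \<open>return_h (Suc k)\<close>.\<close>
  have le: "ret_prob \<mu>\<^sub>v k * straddle_prob \<mu>\<^sub>h k \<le> 1 / c' * return_h (Suc k)" for k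
  proof -
    have "c' * (ret_prob \<mu>\<^sub>v k * straddle_prob \<mu>\<^sub>h k) =
        (ret_prob \<mu>\<^sub>v k * ret_prob \<mu>\<^sub>v 2) * (c * straddle_prob \<mu>\<^sub>h k)"
      by (simp add: c'_def)
    also have "\<dots> \<le> ret_prob \<mu>\<^sub>v (k + 2) * straddle_prob \<mu>\<^sub>h (Suc k)"
      by (intro mult_mono v.ret_prob_mult_le c(2))
        (use c(1) h.straddle_prob_nonneg in \<open>auto simp: ret_prob_def\<close>)
    finally show ?thesis using c' by (simp add: return_h_def field_simps)
  qed
  have "summable (\<lambda>k. ret_prob \<mu>\<^sub>v k * straddle_prob \<mu>\<^sub>h k)"
  proof (rule summable_comparison_test[OF _ summable_mult])
    show "summable (\<lambda>k. return_h (Suc k))" using assms(2) by (simp add: summable_Suc_iff)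
    show "\<exists>N. \<forall>n\<ge>N. norm (ret_prob \<mu>\<^sub>v n * straddle_prob \<mu>\<^sub>h n) \<le> 1 / c' * return_h (Suc n)"
      using le by (auto simp: ret_prob_def h.straddle_prob_nonneg)
  qed
  then have "summable (\<lambda>k. 2 / (1 - p\<^sub>h) * (ret_prob \<mu>\<^sub>v k * straddle_prob \<mu>\<^sub>h k) + 2 / (1 - p\<^sub>v) * return_v k)"
    by (intro summable_add summable_mult assms)
  then have "summable (\<lambda>k. words.S.prob {s. word_hit k s})"
    by (rule summable_comparison_test[rotated]) (use prob_word_hit_le in auto)
  moreover have "{s. word_hit k s} \<in> words.S.events" for k
    by (rule words.pred_imp_event) measurable
  ultimately have "AE s in words.S. \<forall>\<^sub>F k in sequentially. s \<in> space words.S - {s. word_hit k s}"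
    by (intro borel_cantelli_AE1) (auto simp: words.S.emeasure_eq_measure)
  then have "AE s in words.S. s \<notin> {s. \<exists>\<^sub>\<infinity>k. word_hit k s}"
    by eventually_elim (auto simp: frequently_def cofinite_eq_sequentially)
  moreover have "{s. \<exists>\<^sub>\<infinity>k. word_hit k s} \<in> words.S.events"
    unfolding INFM_nat_le by (rule words.pred_imp_event) measurable
  ultimately show ?thesis by (simp add: words.S.prob_eq_0)
qed

lemma word_hits_infinite:
  assumes "\<not> summable return_v \<or> \<not> summable return_h"
  shows "words.S.prob {s. \<exists>\<^sub>\<infinity>k. word_hit k s} = 1"
proof -
  have ev: "{s. \<exists>\<^sub>\<infinity>k. word_hit k s} \<in> words.S.events"
    unfolding INFM_nat_le by (rule words.pred_imp_event) measurable
  have *: "words.S.prob {s. \<exists>\<^sub>\<infinity>k. word_hit k s} = 1"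
    if "words.S.prob {s. \<exists>\<^sub>\<infinity>k. P k s} = 1" "\<And>s k. s !! k \<in> set_pmf word_pmf \<Longrightarrow> P k s \<Longrightarrow> word_hit k s" for P
  proof -
    have "AE s in words.S. s \<in> {s. \<exists>\<^sub>\<infinity>k. P k s}" by (rule words.S.AE_prob_1[OF that(1)])
    with AE_words have "AE s in words.S. s \<in> {s. \<exists>\<^sub>\<infinity>k. word_hit k s}"
      by eventually_elim (auto intro: that(2) elim!: INFM_mono)
    then show ?thesis using words.S.prob_eq_1[OF ev] by simp
  qed
  have jump: "word_path (Suc k) s = word_path k s + displacement (s !! k)" for k s
    by (rule words.stream_path_Suc)
  from assms show ?thesis
  proof
    assume "\<not> summable return_v"
    then have nsum: "\<not> summable (\<lambda>n. ret_prob \<mu>\<^sub>h (Suc n) * straddle_prob \<mu>\<^sub>v n)"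
      by (simp add: return_v_def[abs_def])
    \<comment> \<open>\<open>order_refl\<close> selects \<open>b = 1\<close>: the vertical block
      begins after the horizontal jump of its cycle.\<close>
    show ?thesis
    proof (rule *[OF words.straddle_io_prob_1[OF map_displacement_word_pmf symmetric_walk_jump nsum order_refl]])
      fix s k assume "s !! k \<in> set_pmf word_pmf" and h: "fst (word_path (k + 1) s) = 0 \<and>
        weakly_between 0 (snd (word_path k s)) (snd (word_path (Suc k) s))"
      then obtain \<epsilon> ls \<delta> ms where w: "s !! k = alternating (hdir \<epsilon>) ls @ alternating (vdir \<delta>) ms"
        "\<epsilon> \<in> {- 1, 1}" "\<delta> \<in> {- 1, 1}" "ls \<noteq> []" "ms \<noteq> []"
        using set_word_pmfE by blast
      obtain x y where xy: "word_path k s = (x, y)" by (cases "word_path k s")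
      have "line_hit y \<delta> ms"
        using h w line_hit_if_between[of ms y \<delta>]
        by (simp add: jump displacement_append displacement_hdir displacement_vdir xy)
      then show "word_hit k s"
        using h w by (simp add: word_hit_def jump displacement_append displacement_hdir displacement_vdir xy
          hits_origin_append hits_origin_vdir)
    qed
  next
    assume "\<not> summable return_h"
    then have nsum: "\<not> summable (\<lambda>n. ret_prob \<mu>\<^sub>v (Suc n) * straddle_prob \<mu>\<^sub>h n)"
      by (simp add: return_h_def[abs_def])
    \<comment> \<open>The same result is applied to the exchanged coordinates, with
      \<open>b = 0\<close>: the horizontal block runs before the ordinate changes.\<close>
    let ?J = "\<lambda>w. prod.swap (displacement w)"
    have J: "map_pmf ?J word_pmf = pair_pmf \<mu>\<^sub>v \<mu>\<^sub>h"
    proof -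
      have "map_pmf ?J word_pmf = map_pmf prod.swap (pair_pmf \<mu>\<^sub>h \<mu>\<^sub>v)"
        unfolding map_displacement_word_pmf[symmetric] by (simp add: pmf.map_comp o_def)
      also have "(prod.swap :: int \<times> int \<Rightarrow> _) = (\<lambda>(x, y). (y, x))" by auto
      also have "map_pmf \<dots> (pair_pmf \<mu>\<^sub>h \<mu>\<^sub>v) = pair_pmf \<mu>\<^sub>v \<mu>\<^sub>h"
        by (rule pair_commute_pmf[symmetric])
      finally show ?thesis by (simp add: case_prod_unfold prod.swap_def)
    qed
    have path: "stream_path ?J k s = prod.swap (word_path k s)" for k s
      unfolding stream_path_def by (rule prod_eqI) (simp_all add: fst_sum_list snd_sum_list o_def)
    show ?thesis
    proof (rule *[OF words.straddle_io_prob_1[OF J symmetric_walk_jump nsum zero_le_one]])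
      fix s k assume "s !! k \<in> set_pmf word_pmf" and h: "fst (stream_path ?J (k + 0) s) = 0 \<and>
        weakly_between 0 (snd (stream_path ?J k s)) (snd (stream_path ?J (Suc k) s))"
      then obtain \<epsilon> ls \<delta> ms where w: "s !! k = alternating (hdir \<epsilon>) ls @ alternating (vdir \<delta>) ms"
        "\<epsilon> \<in> {- 1, 1}" "\<delta> \<in> {- 1, 1}" "ls \<noteq> []" "ms \<noteq> []"
        using set_word_pmfE by blast
      obtain x y where xy: "word_path k s = (x, y)" by (cases "word_path k s")
      have "line_hit x \<epsilon> ls"
        using h w line_hit_if_between[of ls x \<epsilon>]
        by (simp add: path jump displacement_append displacement_hdir displacement_vdir xy)
      then show "word_hit k s"
        using h w by (simp add: word_hit_def path xy hits_origin_append hits_origin_hdir)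
    qed
  qed
qed

end

section \<open>The law of the runs\<close>

context drrw_parameters
begin

definition run_law :: "dir \<Rightarrow> nat pmf" where "run_law d = (if horizontal d then \<nu>\<^sub>h else \<nu>\<^sub>v)"
definition uturn :: "dir \<Rightarrow> real" where "uturn d = (if horizontal d then p\<^sub>h else p\<^sub>v)"

text \<open>The density of the next runs given that the preceding run has direction
  \<open>d\<close>.\<close>

fun run_weight :: "dir \<Rightarrow> (dir \<times> nat) list \<Rightarrow> real" where
  "run_weight d [] = 1"
| "run_weight d ((d', l) # w) = turn_prob p\<^sub>h p\<^sub>v d d' * pmf (run_law d') l * run_weight d' w"

lemma pmf_runs_Nil: "pmf (runs_pmf \<eta> r) [] = 0"
  by (auto simp: pmf_eq_0_set_pmf runs_pmf_def set_replicate_pmf)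

lemma pmf_runs_Cons:
  assumes "0 \<le> r" "r < 1"
  shows "pmf (runs_pmf \<eta> r) (l # ls) =
    pmf \<eta> l * (if ls = [] then 1 - r else r * pmf (runs_pmf \<eta> r) ls)"
proof -
  have "ennreal (pmf (runs_pmf \<eta> r) (l # ls)) = emeasure (measure_pmf (runs_pmf \<eta> r)) {l # ls}"
    by (simp add: emeasure_pmf_single)
  also have "\<dots> = (\<integral>\<^sup>+l'. ennreal (if ls = [] then 1 - r else r * pmf (runs_pmf \<eta> r) ls) * indicator {l} l' \<partial>measure_pmf \<eta>)"
    unfolding emeasure_runs_pmf_unfold[OF assms, of _ "{l # ls}"]
  proof (rule nn_integral_cong)
    fix l'
    have "{xs. l' # xs \<in> {l # ls}} = (if l' = l then {ls} else {})" by auto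
    then show "ennreal (1 - r) * indicator {l # ls} [l'] + ennreal r * emeasure (measure_pmf (runs_pmf \<eta> r)) {xs. l' # xs \<in> {l # ls}} =
      ennreal (if ls = [] then 1 - r else r * pmf (runs_pmf \<eta> r) ls) * indicator {l} l'"
      using assms by (auto simp: emeasure_pmf_single pmf_runs_Nil ennreal_mult indicator_def)
  qed
  also have "\<dots> = ennreal (if ls = [] then 1 - r else r * pmf (runs_pmf \<eta> r) ls) * ennreal (pmf \<eta> l)"
    by (subst nn_integral_cmult) (auto simp: emeasure_pmf_single)
  also have "\<dots> = ennreal (pmf \<eta> l * (if ls = [] then 1 - r else r * pmf (runs_pmf \<eta> r) ls))"
    using assms by (subst ennreal_mult[symmetric]) (auto simp: mult.commute)
  finally show ?thesis using assms by (subst (asm) ennreal_inj) auto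
qed

lemma uturn_range: "0 \<le> uturn d" "uturn d < 1"
  using turn_range by (auto simp: uturn_def)

lemma horizontal_opposite [simp]: "horizontal (opposite d) = horizontal d"
  by (cases d) auto

lemma run_law_opposite [simp]: "run_law (opposite d) = run_law d" and uturn_opposite [simp]: "uturn (opposite d) = uturn d"
  by (simp_all add: run_law_def uturn_def)

lemma turn_prob_opposite: "turn_prob p\<^sub>h p\<^sub>v d (opposite d) = uturn d"
  by (simp add: turn_prob_def uturn_def Let_def)

lemma turn_prob_orthogonal:
  "horizontal d' \<noteq> horizontal d \<Longrightarrow> turn_prob p\<^sub>h p\<^sub>v d d' = (1 - uturn d) / 2"
  by (simp add: turn_prob_def uturn_def Let_def)

text \<open>The law of a block contains a factor for its end which its runs alone do not show.
  Multiplying by \<open>1 - uturn e\<close> supplies this factor without a division.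
  \<open>e'\<close> is the direction of the last run of the block.\<close>

lemma run_weight_alternating:
  "\<exists>e'. horizontal e' = horizontal e \<and>
    pmf (run_law e) l * run_weight e (alternating (opposite e) ls @ w) * (1 - uturn e) =
      pmf (runs_pmf (run_law e) (uturn e)) (l # ls) * run_weight e' w"
proof (induction ls arbitrary: e l)
  case Nil
  show ?case by (rule exI[of _ e]) (simp add: pmf_runs_Cons[OF uturn_range])
next
  case (Cons l' ls)
  obtain e' where e': "horizontal e' = horizontal e"
    "pmf (run_law e) l' * run_weight (opposite e) (alternating (opposite (opposite e)) ls @ w) * (1 - uturn e) =
      pmf (runs_pmf (run_law e) (uturn e)) (l' # ls) * run_weight e' w"
    using Cons.IH[of "opposite e" l'] by auto
  have "pmf (run_law e) l * run_weight e (alternating (opposite e) (l' # ls) @ w) * (1 - uturn e) =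
      pmf (run_law e) l * uturn e * (pmf (run_law e) l' * run_weight (opposite e) (alternating (opposite (opposite e)) ls @ w) * (1 - uturn e))"
    by (simp add: turn_prob_opposite)
  also have "\<dots> = pmf (runs_pmf (run_law e) (uturn e)) (l # l' # ls) * run_weight e' w"
    unfolding e'(2) by (subst (2) pmf_runs_Cons[OF uturn_range]) simp
  finally show ?case using e'(1) by blast
qed

text \<open>The turn into the block contributes (1 - uturn d) / 2: the end of the preceding block
  and a fair sign.\<close>

lemma run_weight_block:
  assumes "ls \<noteq> []" "horizontal e \<noteq> horizontal d"
  shows "\<exists>e'. horizontal e' = horizontal e \<and>
    run_weight d (alternating e ls @ w) * (1 - uturn e) =
      (1 - uturn d) / 2 * pmf (runs_pmf (run_law e) (uturn e)) ls * run_weight e' w"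
proof -
  obtain l ls' where ls: "ls = l # ls'" using assms(1) by (cases ls) auto
  obtain e' where e': "horizontal e' = horizontal e"
    "pmf (run_law e) l * run_weight e (alternating (opposite e) ls' @ w) * (1 - uturn e) =
      pmf (runs_pmf (run_law e) (uturn e)) (l # ls') * run_weight e' w"
    using run_weight_alternating by blast
  have "run_weight d (alternating e ls @ w) * (1 - uturn e) =
      (1 - uturn d) / 2 * (pmf (run_law e) l * run_weight e (alternating (opposite e) ls' @ w) * (1 - uturn e))"
    by (simp add: ls turn_prob_orthogonal[OF assms(2)])
  also have "\<dots> = (1 - uturn d) / 2 * pmf (runs_pmf (run_law e) (uturn e)) ls * run_weight e' w"
    unfolding e'(2) by (simp add: ls)
  finally show ?thesis using e'(1) by blast
qed

lemma horizontal_hdir [simp]: "horizontal (hdir \<epsilon>)" and horizontal_vdir [simp]: "\<not> horizontal (vdir \<epsilon>)"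
  by (simp_all add: hdir_def vdir_def)

lemma horizontal_alternating: "x \<in> set (alternating e ls) \<Longrightarrow> horizontal (fst x) = horizontal e"
  by (induction e ls rule: alternating.induct) auto

lemma alternating_eq_Nil [simp]: "alternating e ls = [] \<longleftrightarrow> ls = []"
  by (cases ls) auto

lemma alternating_inject: "ls \<noteq> [] \<Longrightarrow> alternating e ls = alternating e' ls' \<Longrightarrow> e = e' \<and> ls = ls'"
proof -
  have len: "map snd (alternating e ls) = ls" for e ls
    by (induction e ls rule: alternating.induct) auto
  assume "ls \<noteq> []" and eq: "alternating e ls = alternating e' ls'"
  then have "ls = ls'" using len by metis
  moreover from this have "e = e'" using eq \<open>ls \<noteq> []\<close> by (cases ls) auto
  ultimately show ?thesis by simp
qed

text \<open>A change of axis marks the end of a block, so a cycle can be read off any sequence of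
  runs in which nothing or a horizontal run follows it.\<close>

lemma takeWhile_cycle:
  assumes "ls \<noteq> []" "ms \<noteq> []" "r = [] \<or> horizontal (fst (hd r))"
  shows "takeWhile (\<lambda>x. horizontal (fst x)) (alternating (hdir \<epsilon>) ls @ alternating (vdir \<delta>) ms @ r) = alternating (hdir \<epsilon>) ls"
    and "takeWhile (\<lambda>x. \<not> horizontal (fst x)) (dropWhile (\<lambda>x. horizontal (fst x))
      (alternating (hdir \<epsilon>) ls @ alternating (vdir \<delta>) ms @ r)) = alternating (vdir \<delta>) ms"
proof -
  let ?h = "\<lambda>x :: dir \<times> nat. horizontal (fst x)"
  have h: "\<forall>x\<in>set (alternating (hdir \<epsilon>) ls). ?h x" and v: "\<forall>x\<in>set (alternating (vdir \<delta>) ms). \<not> ?h x"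
    using horizontal_alternating by fastforce+
  obtain y ys where y: "alternating (vdir \<delta>) ms = y # ys" "\<not> ?h y"
    using assms(2) v by (cases "alternating (vdir \<delta>) ms") auto
  have "takeWhile ?h (alternating (hdir \<epsilon>) ls @ alternating (vdir \<delta>) ms @ r) =
      alternating (hdir \<epsilon>) ls @ takeWhile ?h (alternating (vdir \<delta>) ms @ r)"
    using h by (intro takeWhile_append2) auto
  then show "takeWhile ?h (alternating (hdir \<epsilon>) ls @ alternating (vdir \<delta>) ms @ r) = alternating (hdir \<epsilon>) ls"
    using y by simp
  have "dropWhile ?h (alternating (hdir \<epsilon>) ls @ alternating (vdir \<delta>) ms @ r) =
      dropWhile ?h (alternating (vdir \<delta>) ms @ r)"
    using h by (intro dropWhile_append2) auto
  also have "\<dots> = alternating (vdir \<delta>) ms @ r" using y by simp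
  also have "takeWhile (\<lambda>x. \<not> ?h x) \<dots> = alternating (vdir \<delta>) ms @ takeWhile (\<lambda>x. \<not> ?h x) r"
    using v by (intro takeWhile_append2) auto
  also have "takeWhile (\<lambda>x. \<not> ?h x) r = []"
    using assms(3) by (cases r) auto
  finally show "takeWhile (\<lambda>x. \<not> ?h x) (dropWhile ?h
      (alternating (hdir \<epsilon>) ls @ alternating (vdir \<delta>) ms @ r)) = alternating (vdir \<delta>) ms" by simp
qed

lemma hd_word: "w \<in> set_pmf word_pmf \<Longrightarrow> w \<noteq> [] \<and> horizontal (fst (hd w))"
  by (erule set_word_pmfE) (use horizontal_alternating in \<open>auto simp: neq_Nil_conv\<close>)

lemma cycle_append_inject:
  assumes "w \<in> set_pmf word_pmf" "w' \<in> set_pmf word_pmf" "w @ r = w' @ r'"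
    "r = [] \<or> horizontal (fst (hd r))" "r' = [] \<or> horizontal (fst (hd r'))"
  shows "w = w'"
proof -
  obtain \<epsilon> ls \<delta> ms where w: "w = alternating (hdir \<epsilon>) ls @ alternating (vdir \<delta>) ms" "ls \<noteq> []" "ms \<noteq> []"
    using assms(1) by (rule set_word_pmfE)
  obtain \<epsilon>' ls' \<delta>' ms' where w': "w' = alternating (hdir \<epsilon>') ls' @ alternating (vdir \<delta>') ms'" "ls' \<noteq> []" "ms' \<noteq> []"
    using assms(2) by (rule set_word_pmfE)
  show ?thesis
    using takeWhile_cycle[OF w(2,3) assms(4), of \<epsilon> \<delta>] takeWhile_cycle[OF w'(2,3) assms(5), of \<epsilon>' \<delta>'] assms(3)
    unfolding w(1) w'(1) by simp
qed

lemma concat_words_hd: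
  "set ws \<subseteq> set_pmf word_pmf \<Longrightarrow> concat ws = [] \<or> horizontal (fst (hd (concat ws)))"
  by (cases ws) (use hd_word in auto)

text \<open>Unique decoding: the horizontal run at the head of each remainder guarantees that the
  last word is complete.\<close>

lemma concat_words_inject:
  assumes "length ws = length ws'" "set ws \<subseteq> set_pmf word_pmf" "set ws' \<subseteq> set_pmf word_pmf"
    "concat ws @ r = concat ws' @ r'" "r \<noteq> []" "horizontal (fst (hd r))" "r' \<noteq> []" "horizontal (fst (hd r'))"
  shows "ws = ws'"
  using assms(1-4)
proof (induction ws ws' rule: list_induct2)
  case (Cons w ws w' ws')
  have "horizontal (fst (hd (concat ws @ r)))" "horizontal (fst (hd (concat ws' @ r')))"
    using concat_words_hd[of ws] concat_words_hd[of ws'] Cons.prems assms(5-8) by (auto simp: hd_append)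
  then have "w = w'"
    using cycle_append_inject[of w w' "concat ws @ r" "concat ws' @ r'"] Cons.prems by simp
  then show ?case using Cons by simp
qed simp

lemma pmf_word_pmf:
  assumes "\<epsilon> \<in> {- 1, 1}" "\<delta> \<in> {- 1, 1}" "ls \<noteq> []" "ms \<noteq> []"
  shows "pmf word_pmf (alternating (hdir \<epsilon>) ls @ alternating (vdir \<delta>) ms) =
    pmf (runs_pmf \<nu>\<^sub>h p\<^sub>h) ls / 2 * (pmf (runs_pmf \<nu>\<^sub>v p\<^sub>v) ms / 2)"
proof -
  let ?P = "pair_pmf (block_pmf \<nu>\<^sub>h p\<^sub>h) (block_pmf \<nu>\<^sub>v p\<^sub>v)"
  \<comment> \<open>\<open>hdir\<close> and \<open>vdir\<close> identify all signs other than 1, and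
    an empty block forgets its sign, so \<open>cycle_word\<close> is injective only on a set such as
    this one, which contains the support.\<close>
  let ?D = "({- 1, 1} \<times> {ls. ls \<noteq> []}) \<times> ({- 1, 1} \<times> {ls. ls \<noteq> []})"
  have inj: "inj_on cycle_word ?D"
  proof (rule inj_onI)
    fix x y assume xy: "x \<in> ?D" "y \<in> ?D" "cycle_word x = cycle_word y"
    obtain \<epsilon> ls \<delta> ms where x: "x = ((\<epsilon>, ls), (\<delta>, ms))" by (rule cycle_word.cases)
    obtain \<epsilon>' ls' \<delta>' ms' where y: "y = ((\<epsilon>', ls'), (\<delta>', ms'))" by (rule cycle_word.cases)
    from xy have signs: "\<epsilon> \<in> {- 1, 1}" "\<delta> \<in> {- 1, 1}" "\<epsilon>' \<in> {- 1, 1}" "\<delta>' \<in> {- 1, 1}"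
      and ne: "ls \<noteq> []" "ms \<noteq> []" "ls' \<noteq> []" "ms' \<noteq> []"
      and eq: "cycle_word ((\<epsilon>, ls), (\<delta>, ms)) = cycle_word ((\<epsilon>', ls'), (\<delta>', ms'))"
      by (simp_all add: x y)
    have "alternating (hdir \<epsilon>) ls = alternating (hdir \<epsilon>') ls'" "alternating (vdir \<delta>) ms = alternating (vdir \<delta>') ms'"
      using takeWhile_cycle[OF ne(1,2), of "[]" \<epsilon> \<delta>] takeWhile_cycle[OF ne(3,4), of "[]" \<epsilon>' \<delta>'] eq by auto
    then have "hdir \<epsilon> = hdir \<epsilon>' \<and> ls = ls'" "vdir \<delta> = vdir \<delta>' \<and> ms = ms'"
      using alternating_inject ne by blast+
    with signs show "x = y"
      by (auto simp: x y hdir_def vdir_def split: if_splits)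
  qed
  let ?x = "((\<epsilon>, ls), (\<delta>, ms))"
  have "pmf word_pmf (cycle_word ?x) = measure_pmf.prob ?P (cycle_word -` {cycle_word ?x})"
    unfolding word_pmf_def by (simp add: pmf_map)
  also have "\<dots> = measure_pmf.prob ?P {?x}"
  proof (rule measure_pmf.finite_measure_eq_AE)
    show "AE z in measure_pmf ?P. z \<in> cycle_word -` {cycle_word ?x} \<longleftrightarrow> z \<in> {?x}"
    proof (intro AE_pmfI)
      fix z assume "z \<in> set_pmf ?P"
      then have zD: "z \<in> ?D"
        using set_pmf_block_subset[of \<nu>\<^sub>h p\<^sub>h] set_pmf_block_subset[of \<nu>\<^sub>v p\<^sub>v] by auto
      have xD: "?x \<in> ?D" using assms by simp
      show "z \<in> cycle_word -` {cycle_word ?x} \<longleftrightarrow> z \<in> {?x}"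
        unfolding vimage_singleton_eq singleton_iff by (rule inj_on_eq_iff[OF inj zD xD])
    qed
  qed auto
  also have "\<dots> = pmf (runs_pmf \<nu>\<^sub>h p\<^sub>h) ls / 2 * (pmf (runs_pmf \<nu>\<^sub>v p\<^sub>v) ms / 2)"
    using assms by (auto simp: measure_pmf_single pmf_pair block_pmf_def)
  finally show ?thesis by simp
qed

text \<open>The turn into a cycle carries the factor \<open>1 - p\<^sub>v\<close> for the end of the
  preceding vertical block, while the factor for the end of the cycle's own vertical block is
  missing. The two are equal, so the weight splits into the laws of the words.\<close>

lemma run_weight_words:
  assumes "set ws \<subseteq> set_pmf word_pmf" "\<not> horizontal d"
  shows "run_weight d (concat ws) = prod_list (map (pmf word_pmf) ws)"
  using assms
proof (induction ws arbitrary: d)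
  case (Cons w ws)
  from Cons.prems have "w \<in> set_pmf word_pmf" by simp
  then obtain \<epsilon> ls \<delta> ms where w: "w = alternating (hdir \<epsilon>) ls @ alternating (vdir \<delta>) ms"
    "\<epsilon> \<in> {- 1, 1}" "\<delta> \<in> {- 1, 1}" "ls \<noteq> []" "ms \<noteq> []"
    by (rule set_word_pmfE)
  let ?r = "alternating (vdir \<delta>) ms @ concat ws"
  obtain e where e: "horizontal e" "run_weight d (alternating (hdir \<epsilon>) ls @ ?r) * (1 - p\<^sub>h) =
      (1 - p\<^sub>v) / 2 * pmf (runs_pmf \<nu>\<^sub>h p\<^sub>h) ls * run_weight e ?r"
    using run_weight_block[OF w(4), of "hdir \<epsilon>" d ?r] Cons.prems by (auto simp: run_law_def uturn_def)
  obtain e' where e': "\<not> horizontal e'" "run_weight e ?r * (1 - p\<^sub>v) =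
      (1 - p\<^sub>h) / 2 * pmf (runs_pmf \<nu>\<^sub>v p\<^sub>v) ms * run_weight e' (concat ws)"
    using run_weight_block[OF w(5), of "vdir \<delta>" e "concat ws"] e(1) by (auto simp: run_law_def uturn_def)
  have IH: "run_weight e' (concat ws) = prod_list (map (pmf word_pmf) ws)"
    using Cons.IH[of e'] Cons.prems e'(1) by simp
  have "run_weight d (concat (w # ws)) * (1 - p\<^sub>h) = pmf (runs_pmf \<nu>\<^sub>h p\<^sub>h) ls / 2 * (run_weight e ?r * (1 - p\<^sub>v))"
    using e(2) by (simp add: w(1))
  also have "\<dots> = pmf word_pmf w * prod_list (map (pmf word_pmf) ws) * (1 - p\<^sub>h)"
    unfolding e'(2) IH by (simp add: w(1) pmf_word_pmf[OF w(2-5)])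
  finally show ?case using turn_range by simp
qed simp

end

section \<open>Probabilities of runs and of prescribed cycles under the law of the walk\<close>

lemma measurable_map_countable:
  fixes X :: "'i \<Rightarrow> 'a \<Rightarrow> 'b::countable"
  assumes X: "\<And>i. X i \<in> measurable M (count_space UNIV)"
  shows "(\<lambda>\<omega>. map (\<lambda>i. X i \<omega>) xs) \<in> measurable M (count_space UNIV)"
proof (induction xs)
  case (Cons x xs)
  have "(\<lambda>\<omega>. X x \<omega> # map (\<lambda>i. X i \<omega>) xs) \<in> measurable M (count_space UNIV)"
    by (rule measurable_compose_countable[where f="\<lambda>y \<omega>. y # map (\<lambda>i. X i \<omega>) xs" and g="X x"])
      (rule measurable_compose[OF Cons.IH], simp, rule X)
  then show ?case by simp
qed simp

lemma (in prob_space) indep_vars_prob_eq: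
  fixes X :: "'i \<Rightarrow> 'a \<Rightarrow> 'b" and f :: "nat \<Rightarrow> 'i"
  assumes indep: "indep_vars (\<lambda>_. count_space UNIV) X UNIV" and f: "inj f"
  shows "prob {\<omega> \<in> space M. \<forall>i<n. X (f i) \<omega> = l i} = (\<Prod>i<n. prob {\<omega> \<in> space M. X (f i) \<omega> = l i})"
proof (cases "n = 0")
  case False
  define J where "J = f ` {..<n}"
  define B where "B k = {l (inv f k)}" for k
  have "prob (\<Inter>k\<in>J. X k -` B k \<inter> space M) = (\<Prod>k\<in>J. prob (X k -` B k \<inter> space M))"
    using False by (intro indep_varsD[OF indep]) (auto simp: J_def)
  also have "\<dots> = (\<Prod>i<n. prob (X (f i) -` B (f i) \<inter> space M))"
    unfolding J_def by (rule prod.reindex_cong[OF _ refl]) (auto intro: inj_on_subset[OF f])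
  also have "\<dots> = (\<Prod>i<n. prob {\<omega> \<in> space M. X (f i) \<omega> = l i})"
    unfolding B_def inv_f_f[OF f]
    by (intro prod.cong refl arg_cong[where f=prob]) auto
  also have "(\<Inter>k\<in>J. X k -` B k \<inter> space M) = {\<omega> \<in> space M. \<forall>i<n. X (f i) \<omega> = l i}"
    using False by (auto simp: J_def B_def inv_f_f[OF f])
  finally show ?thesis .
qed (simp add: prob_space)

context drrw_parameters
begin

lemma run_weight_Cons_eq_prod:
  "run_weight d (x # w) = turn_prob p\<^sub>h p\<^sub>v d (fst x) *
    ((\<Prod>i<length w. turn_prob p\<^sub>h p\<^sub>v (fst ((x # w) ! i)) (fst ((x # w) ! Suc i))) *
    (\<Prod>i<Suc (length w). pmf (run_law (fst ((x # w) ! i))) (snd ((x # w) ! i))))"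
proof (induction w arbitrary: d x)
  case Nil
  then show ?case by (cases x) simp
next
  case (Cons y w)
  have "run_weight d (x # y # w) = turn_prob p\<^sub>h p\<^sub>v d (fst x) * (pmf (run_law (fst x)) (snd x) * run_weight (fst x) (y # w))"
    by (cases x) simp
  then show ?case
    unfolding Cons.IH by (simp add: prod.lessThan_Suc_shift ac_simps del: prod.lessThan_Suc)
qed

lemma last_concat_words:
  assumes "ws \<noteq> []" "set ws \<subseteq> set_pmf word_pmf"
  shows "concat ws \<noteq> [] \<and> \<not> horizontal (fst (last (concat ws)))"
proof -
  have lw: "\<not> horizontal (fst (last w))" if w_in: "w \<in> set_pmf word_pmf" for w
  proof -
    obtain \<epsilon> ls \<delta> ms where w: "w = alternating (hdir \<epsilon>) ls @ alternating (vdir \<delta>) ms" "ls \<noteq> []" "ms \<noteq> []"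
      using set_word_pmfE[OF w_in] by metis
    then have "last w \<in> set (alternating (vdir \<delta>) ms)" by (auto intro: last_in_set)
    then show ?thesis using horizontal_alternating by fastforce
  qed
  show ?thesis using assms
  proof (induction ws rule: rev_induct)
    case (snoc w ws)
    then have "w \<noteq> []" "\<not> horizontal (fst (last w))" using hd_word[of w] lw[of w] by auto
    then show ?case by simp
  qed simp
qed

lemma length_concat_words: "set ws \<subseteq> set_pmf word_pmf \<Longrightarrow> length ws \<le> length (concat ws)"
proof (induction ws)
  case (Cons w ws)
  then have "Suc 0 \<le> length w" using hd_word[of w] by (cases w) auto
  with Cons show ?case by simp
qed simp

end

context drrw
begin

definition len :: "nat \<Rightarrow> 'a \<Rightarrow> nat" where "len = run_length D \<tau>\<^sub>h \<tau>\<^sub>v"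

definition runs :: "nat \<Rightarrow> 'a \<Rightarrow> (dir \<times> nat) list" where
  "runs n \<omega> = map (\<lambda>i. (D i \<omega>, len i \<omega>)) [0..<n]"

text \<open>The persistence time used by run \<open>i\<close> when the directions are \<open>d 0, d 1, \<dots>\<close>\<close>

definition clock :: "(nat \<Rightarrow> dir) \<Rightarrow> nat \<Rightarrow> nat + nat" where
  "clock d i = (let k = card {j. j < i \<and> horizontal (d j) = horizontal (d i)} in
    if horizontal (d i) then Inl k else Inr k)"

definition \<tau> :: "nat + nat \<Rightarrow> 'a \<Rightarrow> nat" where "\<tau> = case_sum \<tau>\<^sub>h \<tau>\<^sub>v"

lemma len_eq_clock: "len i \<omega> = \<tau> (clock (\<lambda>j. D j \<omega>) i) \<omega>"
  by (simp add: len_def run_length_def \<tau>_def clock_def Let_def)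

lemma clock_cong: "(\<And>j. j \<le> i \<Longrightarrow> d j = d' j) \<Longrightarrow> clock d i = clock d' i"
  by (auto simp: clock_def Let_def intro!: arg_cong[where f=card])

text \<open>The number of earlier runs on the same axis increases strictly along that axis. Hence
  different runs use different, and so independent, persistence times.\<close>

lemma inj_clock: "inj (clock d)"
proof -
  have "clock d i \<noteq> clock d j" if "i < j" for i j
  proof (cases "horizontal (d i) = horizontal (d j)")
    case True
    have "{k. k < i \<and> horizontal (d k) = horizontal (d i)} \<subset> {k. k < j \<and> horizontal (d k) = horizontal (d j)}"
      using that True by auto
    then have "card {k. k < i \<and> horizontal (d k) = horizontal (d i)} < card {k. k < j \<and> horizontal (d k) = horizontal (d j)}"
      by (intro psubset_card_mono) auto
    then show ?thesis by (auto simp: clock_def Let_def)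
  qed (auto simp: clock_def Let_def)
  then show ?thesis by (metis injI linorder_neq_iff)
qed

lemma \<tau>_rv [measurable]: "random_variable (count_space UNIV) (\<tau> k)"
  using \<tau>_indep unfolding indep_vars_def \<tau>_def by simp

lemma D_rv' [measurable]: "random_variable (count_space UNIV) (D i)"
  by (rule D_rv)

lemma prob_\<tau>: "prob {\<omega> \<in> space M. \<tau> (clock d i) \<omega> = l} = pmf (run_law (d i)) l"
proof -
  define k where "k = clock d i"
  have "prob {\<omega> \<in> space M. \<tau> k \<omega> = l} = measure (distr M (count_space UNIV) (\<tau> k)) {l}"
    by (subst measure_distr) (auto intro!: arg_cong[where f=prob])
  also have "distr M (count_space UNIV) (\<tau> k) = measure_pmf (run_law (d i))"
    unfolding k_def clock_def Let_def \<tau>_def by (simp add: \<tau>h_law \<tau>v_law run_law_def)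
  finally show ?thesis by (simp add: k_def measure_pmf_single)
qed

lemma prob_\<tau>_prod:
  "prob {\<omega> \<in> space M. \<forall>i<n. \<tau> (clock d i) \<omega> = l i} = (\<Prod>i<n. pmf (run_law (d i)) (l i))"
  unfolding prob_\<tau>[symmetric] by (rule indep_vars_prob_eq[OF \<tau>_indep[folded \<tau>_def] inj_clock])

lemma prob_D:
  "prob {\<omega> \<in> space M. \<forall>i\<le>n. D i \<omega> = d i} =
    (if d 0 = East then \<Prod>i<n. turn_prob p\<^sub>h p\<^sub>v (d i) (d (Suc i)) else 0)"
proof (induction n)
  case 0
  have "prob {\<omega> \<in> space M. D 0 \<omega> = d 0} = (if d 0 = East then 1 else 0)"
  proof (cases "d 0 = East")
    case True
    have "AE \<omega> in M. \<omega> \<in> {\<omega> \<in> space M. D 0 \<omega> = d 0}"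
      using D_start AE_space by eventually_elim (simp add: True)
    then have "prob {\<omega> \<in> space M. D 0 \<omega> = d 0} = 1" by (subst prob_eq_1) auto
    with True show ?thesis by simp
  next
    case False
    have "AE \<omega> in M. \<omega> \<notin> {\<omega> \<in> space M. D 0 \<omega> = d 0}"
      using D_start by eventually_elim (use False in auto)
    then have "prob {\<omega> \<in> space M. D 0 \<omega> = d 0} = 0" by (subst prob_eq_0) auto
    with False show ?thesis by simp
  qed
  then show ?case by simp
next
  case (Suc n)
  then show ?case using markov[of n d] by simp
qed

text \<open>Once the directions are prescribed, the random clocks become the deterministic
  \<open>clock d i\<close>, and the independence of directions and times applies. One more direction
  than lengths is prescribed, so that the end of a block can be observed.\<close>

lemma prob_runs:
  "prob {\<omega> \<in> space M. (\<forall>i\<le>n. D i \<omega> = d i) \<and> (\<forall>i<n. len i \<omega> = l i)} =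
    (if d 0 = East then (\<Prod>i<n. turn_prob p\<^sub>h p\<^sub>v (d i) (d (Suc i))) * (\<Prod>i<n. pmf (run_law (d i)) (l i)) else 0)"
proof -
  let ?A = "{\<omega> \<in> space M. \<forall>i\<le>n. D i \<omega> = d i}" and ?B = "{\<omega> \<in> space M. \<forall>i<n. \<tau> (clock d i) \<omega> = l i}"
  have eq: "{\<omega> \<in> space M. (\<forall>i\<le>n. D i \<omega> = d i) \<and> (\<forall>i<n. len i \<omega> = l i)} = ?A \<inter> ?B"
  proof -
    have "len i \<omega> = \<tau> (clock d i) \<omega>" if "\<forall>i\<le>n. D i \<omega> = d i" "i < n" for i \<omega>
      unfolding len_eq_clock using that by (subst clock_cong[of i _ d]) auto
    then show ?thesis by auto
  qed
  have indep: "prob (?A \<inter> ?B) = prob ?A * prob ?B"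
  proof (rule indep_setD[OF D_\<tau>_indep])
    have "(\<lambda>\<omega> i. D i \<omega>) -` {g \<in> space (PiM UNIV (\<lambda>_. count_space UNIV)). \<forall>i\<le>n. g i = d i} \<inter> space M \<in>
        sets (vimage_algebra (space M) (\<lambda>\<omega> i. D i \<omega>) (PiM UNIV (\<lambda>_. count_space UNIV)))"
      by (rule in_vimage_algebra) measurable
    also have "(\<lambda>\<omega> i. D i \<omega>) -` {g \<in> space (PiM UNIV (\<lambda>_. count_space UNIV)). \<forall>i\<le>n. g i = d i} \<inter> space M = ?A"
      by (auto simp: space_PiM)
    finally show "?A \<in> sets (vimage_algebra (space M) (\<lambda>\<omega> i. D i \<omega>) (PiM UNIV (\<lambda>_. count_space UNIV)))" .
    have "(\<lambda>\<omega> k. case_sum \<tau>\<^sub>h \<tau>\<^sub>v k \<omega>) -` {g \<in> space (PiM UNIV (\<lambda>_. count_space UNIV)). \<forall>i<n. g (clock d i) = l i} \<inter> space M \<in>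
        sets (vimage_algebra (space M) (\<lambda>\<omega> k. case_sum \<tau>\<^sub>h \<tau>\<^sub>v k \<omega>) (PiM UNIV (\<lambda>_. count_space UNIV)))"
      by (rule in_vimage_algebra) measurable
    also have "(\<lambda>\<omega> k. case_sum \<tau>\<^sub>h \<tau>\<^sub>v k \<omega>) -` {g \<in> space (PiM UNIV (\<lambda>_. count_space UNIV)). \<forall>i<n. g (clock d i) = l i} \<inter> space M = ?B"
      by (auto simp: space_PiM \<tau>_def)
    finally show "?B \<in> sets (vimage_algebra (space M) (\<lambda>\<omega> k. case_sum \<tau>\<^sub>h \<tau>\<^sub>v k \<omega>) (PiM UNIV (\<lambda>_. count_space UNIV)))" .
  qed
  show ?thesis
    unfolding eq indep prob_D prob_\<tau>_prod by simp
qed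

text \<open>The clock used by run \<open>i\<close> is random, but it depends only on a finite list
  of directions, which has countably many values.\<close>

lemma len_rv [measurable]: "random_variable (count_space UNIV) (len i)"
proof -
  have "(\<lambda>\<omega>. \<tau> (clock (\<lambda>j. map (\<lambda>j. D j \<omega>) [0..<Suc i] ! j) i) \<omega>) \<in> measurable M (count_space UNIV)"
  proof (rule measurable_compose_countable[where f="\<lambda>ds. \<tau> (clock (\<lambda>j. ds ! j) i)" and g="\<lambda>\<omega>. map (\<lambda>j. D j \<omega>) [0..<Suc i]"])
    show "(\<lambda>\<omega>. map (\<lambda>j. D j \<omega>) [0..<Suc i]) \<in> measurable M (count_space UNIV)"
      by (rule measurable_map_countable) (rule D_rv)
  qed (rule \<tau>_rv)
  also have "(\<lambda>\<omega>. \<tau> (clock (\<lambda>j. map (\<lambda>j. D j \<omega>) [0..<Suc i] ! j) i) \<omega>) = len i"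
    unfolding len_eq_clock[abs_def]
    by (intro ext arg_cong2[where f=\<tau>] refl clock_cong) (simp del: upt_Suc)
  finally show ?thesis .
qed

lemma runs_eq_iff:
  "length w = n \<Longrightarrow> runs n \<omega> = w \<longleftrightarrow> (\<forall>i<n. D i \<omega> = fst (w ! i) \<and> len i \<omega> = snd (w ! i))"
  unfolding runs_def by (auto simp: list_eq_iff_nth_eq prod_eq_iff)

text \<open>The horizontal run after the last word certifies that the last vertical block is
  complete; without it a longer vertical block would give an overlapping event.\<close>

definition cycles_event :: "(dir \<times> nat) list list \<Rightarrow> 'a set" where
  "cycles_event ws = {\<omega> \<in> space M. runs (length (concat ws)) \<omega> = concat ws \<and> horizontal (D (length (concat ws)) \<omega>)}"

lemma cycles_event_sets [measurable]: "cycles_event ws \<in> events"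
proof -
  have "cycles_event ws = {\<omega> \<in> space M. (\<forall>i<length (concat ws). D i \<omega> = fst (concat ws ! i) \<and> len i \<omega> = snd (concat ws ! i)) \<and>
      horizontal (D (length (concat ws)) \<omega>)}"
    unfolding cycles_event_def runs_eq_iff[OF refl] ..
  also have "\<dots> \<in> events" by measurable
  finally show ?thesis .
qed

text \<open>The closing turn to a given horizontal direction has the same probability as an opening
  turn from a fictitious run \<open>North\<close>, so either closing direction contributes
  \<open>run_weight North (concat ws)\<close>. The two directions give the factor 2, which is also
  what conditioning an i.i.d. sequence of words on its start with \<open>East\<close>
  produces.\<close>

lemma prob_cycles_event:
  assumes ws: "set ws \<subseteq> set_pmf word_pmf" "ws \<noteq> []"
  shows "prob (cycles_event ws) =
    (if fst (hd (concat ws)) = East then 2 * pmf (replicate_pmf (length ws) word_pmf) ws else 0)"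
proof -
  obtain x w where w: "concat ws = x # w" using last_concat_words[OF ws(2,1)] by (cases "concat ws") auto
  define n where "n = length (concat ws)"
  have n: "n = Suc (length w)" by (simp add: n_def w)
  have x: "horizontal (fst x)" using concat_words_hd[OF ws(1)] w by simp
  have lst: "\<not> horizontal (fst ((x # w) ! length w))"
    using last_concat_words[OF ws(2,1)] last_conv_nth[of "x # w"]
    unfolding w by (metis diff_Suc_1 length_Cons)
  define d where "d e i = (if i < n then fst ((x # w) ! i) else e)" for e i
  let ?F = "\<lambda>e. {\<omega> \<in> space M. (\<forall>i\<le>n. D i \<omega> = d e i) \<and> (\<forall>i<n. len i \<omega> = snd ((x # w) ! i))}"
  have ev: "?F e \<in> events" for e by measurable
  have "cycles_event ws = ?F East \<union> ?F West"
  proof -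
    have hE: "horizontal e \<longleftrightarrow> e = East \<or> e = West" for e by (cases e) auto
    have rE: "runs n \<omega> = x # w \<longleftrightarrow> (\<forall>i<n. D i \<omega> = fst ((x # w) ! i) \<and> len i \<omega> = snd ((x # w) ! i))" for \<omega>
      by (rule runs_eq_iff) (simp add: n)
    have dE: "(\<forall>i\<le>n. D i \<omega> = d e i) \<longleftrightarrow> (\<forall>i<n. D i \<omega> = fst ((x # w) ! i)) \<and> D n \<omega> = e" for e \<omega>
      by (auto simp: d_def le_less)
    show ?thesis
      unfolding cycles_event_def n_def[symmetric]
      unfolding w hE rE dE by (intro set_eqI) blast
  qed
  moreover have "?F East \<inter> ?F West = {}"
    by (auto simp: d_def dest!: spec[of _ n])
  ultimately have "prob (cycles_event ws) = prob (?F East) + prob (?F West)"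
    using finite_measure_Union[OF ev ev] by simp
  moreover have "prob (?F e) = (if fst x = East then run_weight North (concat ws) else 0)" if "horizontal e" for e
  proof -
    have "turn_prob p\<^sub>h p\<^sub>v (fst ((x # w) ! length w)) e = turn_prob p\<^sub>h p\<^sub>v North (fst x)"
      using lst that x by (simp add: turn_prob_orthogonal uturn_def)
    then have T: "(\<Prod>i<n. turn_prob p\<^sub>h p\<^sub>v (d e i) (d e (Suc i))) =
        (\<Prod>i<length w. turn_prob p\<^sub>h p\<^sub>v (fst ((x # w) ! i)) (fst ((x # w) ! Suc i))) * turn_prob p\<^sub>h p\<^sub>v North (fst x)"
      by (simp add: n d_def)
    have P: "(\<Prod>i<n. pmf (run_law (d e i)) (snd ((x # w) ! i))) =
        (\<Prod>i<Suc (length w). pmf (run_law (fst ((x # w) ! i))) (snd ((x # w) ! i)))"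
      unfolding n[symmetric] by (intro prod.cong) (auto simp: d_def)
    have "d e 0 = fst x" by (simp add: d_def n)
    then show ?thesis
      unfolding prob_runs w run_weight_Cons_eq_prod T P by (simp only: ac_simps)
  qed
  ultimately show ?thesis
    using run_weight_words[OF ws(1), of North] by (simp add: w pmf_replicate_pmf)
qed

text \<open>Both concatenations are prefixes of one sequence of runs, each followed by a horizontal
  run, so unique decoding applies.\<close>

lemma disjoint_cycles_event:
  assumes "length ws = length ws'" "set ws \<subseteq> set_pmf word_pmf" "set ws' \<subseteq> set_pmf word_pmf"
    "\<omega> \<in> cycles_event ws" "\<omega> \<in> cycles_event ws'"
  shows "ws = ws'"
proof -
  define N where "N = Suc (length (concat ws) + length (concat ws'))"
  have *: "\<exists>r. runs N \<omega> = concat us @ r \<and> r \<noteq> [] \<and> horizontal (fst (hd r))"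
    if "\<omega> \<in> cycles_event us" "length (concat us) < N" for us
  proof (intro exI conjI)
    let ?n = "length (concat us)" and ?r = "map (\<lambda>i. (D i \<omega>, len i \<omega>)) [length (concat us)..<N]"
    have "[0..<N] = [0..<?n] @ [?n..<N]"
      using that(2) upt_add_eq_append[of 0 ?n "N - ?n"] by simp
    then show "runs N \<omega> = concat us @ ?r"
      using that(1) unfolding cycles_event_def runs_def by simp
    show "?r \<noteq> []" using that(2) by simp
    then show "horizontal (fst (hd ?r))"
      using that by (simp add: hd_map cycles_event_def)
  qed
  have N: "length (concat ws) < N" "length (concat ws') < N" by (simp_all add: N_def)
  obtain r where r: "runs N \<omega> = concat ws @ r" "r \<noteq> []" "horizontal (fst (hd r))"
    using *[OF assms(4) N(1)] by blast
  obtain r' where r': "runs N \<omega> = concat ws' @ r'" "r' \<noteq> []" "horizontal (fst (hd r'))"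
    using *[OF assms(5) N(2)] by blast
  show ?thesis
    by (rule concat_words_inject[OF assms(1-3) _ r(2,3) r'(2,3)]) (use r(1) r'(1) in simp)
qed

lemma run_rv: "random_variable (count_space UNIV) (\<lambda>\<omega>. (D i \<omega>, len i \<omega>))"
  by (rule measurable_compose_countable[where f="\<lambda>d \<omega>. (d, len i \<omega>)" and g="D i"])
    (rule measurable_compose[OF len_rv], simp, rule D_rv)

lemma runs_rv: "runs n \<in> measurable M (count_space UNIV)"
  unfolding runs_def[abs_def] by (rule measurable_map_countable) (rule run_rv)

lemma runs_event: "{\<omega> \<in> space M. runs n \<omega> \<in> A} \<in> events"
proof -
  have "{\<omega> \<in> space M. runs n \<omega> \<in> A} = runs n -` A \<inter> space M" by auto
  also have "\<dots> \<in> events" by (rule measurable_sets[OF runs_rv]) simp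
  finally show ?thesis .
qed

text \<open>Each word has at least one run, so \<open>K\<close> words determine the first
  \<open>n\<close> runs, and the disjoint events of the word lists can be summed. The result is an
  inequality, since the argument does not show that these events exhaust the space.\<close>

lemma runs_ge_words:
  assumes K: "n \<le> K" "0 < K"
  shows "2 * emeasure (measure_pmf (replicate_pmf K word_pmf))
      {ws. fst (hd (concat ws)) = East \<and> take n (concat ws) \<in> A} \<le>
    emeasure M {\<omega> \<in> space M. runs n \<omega> \<in> A}"
proof -
  let ?r = "replicate_pmf K word_pmf"
  define T where "T = set_pmf ?r \<inter> {ws. fst (hd (concat ws)) = East \<and> take n (concat ws) \<in> A}"
  have T: "length ws = K" "set ws \<subseteq> set_pmf word_pmf" "ws \<noteq> []" "fst (hd (concat ws)) = East"
    "take n (concat ws) \<in> A" if "ws \<in> T" for ws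
    using that K by (auto simp: T_def set_replicate_pmf)
  have "2 * emeasure (measure_pmf ?r) {ws. fst (hd (concat ws)) = East \<and> take n (concat ws) \<in> A} =
      2 * emeasure (measure_pmf ?r) T"
    by (simp only: T_def Int_commute[of "set_pmf ?r"] emeasure_Int_set_pmf)
  also have "\<dots> = 2 * (\<integral>\<^sup>+ws. ennreal (pmf ?r ws) \<partial>count_space T)"
    by (simp add: nn_integral_pmf)
  also have "\<dots> = (\<integral>\<^sup>+ws. 2 * ennreal (pmf ?r ws) \<partial>count_space T)"
    by (rule nn_integral_cmult[symmetric]) simp
  also have "\<dots> = (\<integral>\<^sup>+ws. emeasure M (cycles_event ws) \<partial>count_space T)"
    by (intro nn_integral_cong) (use T in \<open>simp add: emeasure_eq_measure prob_cycles_event ennreal_mult\<close>)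
  also have "\<dots> = emeasure M (\<Union>ws\<in>T. cycles_event ws)"
  proof (rule emeasure_UN_countable[symmetric])
    show "disjoint_family_on cycles_event T"
      unfolding disjoint_family_on_def
    proof (intro ballI impI equals0I)
      fix a b x assume "a \<in> T" "b \<in> T" "a \<noteq> b" "x \<in> cycles_event a \<inter> cycles_event b"
      then show False using disjoint_cycles_event[of a b x] T(1,2) by auto
    qed
  qed auto
  also have "\<dots> \<le> emeasure M {\<omega> \<in> space M. runs n \<omega> \<in> A}"
  proof (rule emeasure_mono)
    show "{\<omega> \<in> space M. runs n \<omega> \<in> A} \<in> sets M"
      by (rule runs_event)
    show "(\<Union>ws\<in>T. cycles_event ws) \<subseteq> {\<omega> \<in> space M. runs n \<omega> \<in> A}"
    proof safe
      fix ws \<omega> assume ws: "ws \<in> T" "\<omega> \<in> cycles_event ws"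
      then show "\<omega> \<in> space M" by (simp add: cycles_event_def)
      have "n \<le> length (concat ws)" using length_concat_words[OF T(2)] T(1) ws(1) K by fastforce
      then have "runs n \<omega> = take n (runs (length (concat ws)) \<omega>)"
        by (simp add: runs_def take_map take_upt)
      then show "runs n \<omega> \<in> A" using ws T(5) by (simp add: cycles_event_def)
    qed
  qed
  finally show ?thesis .
qed

end

section \<open>From cycles to runs\<close>

lemma to_stream_snth [simp]: "to_stream f !! i = f i"
  by (simp add: to_stream_def)

lemma stake_to_stream: "stake n (to_stream f) = map f [0..<n]"
  by (rule nth_equalityI) auto

lemma sstart_UNIV_eq: "sstart UNIV xs = {s. stake (length xs) s = xs}"
  by (auto simp: sstart_eq list_eq_iff_nth_eq)

text \<open>If no word is empty, the first \<open>Suc i\<close> words have more than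
  \<open>i\<close> entries, so entry \<open>i\<close> can be found there without locating its
  word.\<close>

definition concat_words :: "'b list stream \<Rightarrow> 'b stream" where
  "concat_words s = to_stream (\<lambda>i. concat (stake (Suc i) s) ! i)"

lemma length_concat_stake:
  assumes "\<And>k. s !! k \<noteq> []"
  shows "n \<le> length (concat (stake n s))"
proof (induction n)
  case (Suc n)
  have "Suc 0 \<le> length (s !! n)" using assms[of n] by (cases "s !! n") auto
  with Suc show ?case unfolding stake_Suc by simp
qed simp

lemma concat_stake_prefix:
  assumes "\<And>k. s !! k \<noteq> []" "m \<le> n" "i < length (concat (stake m s))"
  shows "concat (stake m s) ! i = concat (stake n s) ! i"
proof -
  have "concat (stake n s) = concat (stake m s) @ concat (stake (n - m) (sdrop m s))"
    using assms(2) by (metis concat_append stake_add le_add_diff_inverse)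
  then show ?thesis using assms(3) by (simp add: nth_append)
qed

lemma concat_words_snth:
  assumes ne: "\<And>k. s !! k \<noteq> []" and i: "i < length (concat (stake n s))"
  shows "concat_words s !! i = concat (stake n s) ! i"
proof -
  have "i < length (concat (stake (Suc i) s))" using length_concat_stake[OF ne, of "Suc i"] by simp
  then have "concat (stake (Suc i) s) ! i = concat (stake (max n (Suc i)) s) ! i"
    by (intro concat_stake_prefix ne) auto
  also have "\<dots> = concat (stake n s) ! i"
    by (intro concat_stake_prefix[symmetric] ne i) auto
  finally show ?thesis by (simp add: concat_words_def del: stake.simps)
qed

lemma stake_concat_words:
  assumes ne: "\<And>k. s !! k \<noteq> []" and n: "n \<le> length (concat (stake k s))"
  shows "stake n (concat_words s) = take n (concat (stake k s))"
  by (rule nth_equalityI) (use n concat_words_snth[OF ne, of _ k] in auto)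

lemma displacement_concat: "displacement (concat ws) = sum_list (map displacement ws)"
  by (induction ws) (auto simp: displacement_append)

lemma hits_origin_iff_run:
  "hits_origin p w \<longleftrightarrow> (\<exists>i<length w. hits_origin (p + displacement (take i w)) [w ! i])"
proof (induction w arbitrary: p)
  case (Cons x w)
  have "hits_origin p (x # w) \<longleftrightarrow> hits_origin p [x] \<or> hits_origin (p + displacement [x]) w"
    using hits_origin_append[of p "[x]" w] by simp
  also have "\<dots> \<longleftrightarrow> (\<exists>i<length (x # w). hits_origin (p + displacement (take i (x # w))) [(x # w) ! i])"
    unfolding Cons.IH length_Cons Ex_less_Suc2
    by (cases x) (simp add: add.assoc zero_prod_def[symmetric])
  finally show ?case .
qed simp

definition run_hit :: "nat \<Rightarrow> (dir \<times> nat) stream \<Rightarrow> bool" where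
  "run_hit j y \<longleftrightarrow> hits_origin (displacement (stake j y)) [y !! j]"

lemma pred_run_hit [measurable]: "Measurable.pred (stream_space (count_space UNIV)) (run_hit j)"
proof -
  have "run_hit j = (\<lambda>y. (\<lambda>xs. hits_origin (displacement (take j xs)) [last xs]) (stake (Suc j) y))"
    by (auto simp: run_hit_def take_stake min_def last_conv_nth stake_nth fun_eq_iff simp del: stake.simps)
  then show ?thesis
    using pred_stake[of "\<lambda>xs. hits_origin (displacement (take j xs)) [last xs]" "Suc j"] by metis
qed

lemma ex_offset_iff: "(\<exists>i<L. P (c + i)) \<longleftrightarrow> (\<exists>j. c \<le> j \<and> j < c + L \<and> P j)" for c L :: nat
proof
  assume "\<exists>i<L. P (c + i)"
  then obtain i where "i < L" "P (c + i)" by blast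
  then show "\<exists>j. c \<le> j \<and> j < c + L \<and> P j" by (intro exI[of _ "c + i"]) auto
next
  assume "\<exists>j. c \<le> j \<and> j < c + L \<and> P j"
  then obtain j where "c \<le> j" "j < c + L" "P j" by blast
  then show "\<exists>i<L. P (c + i)" by (intro exI[of _ "j - c"]) auto
qed

text \<open>The blocks are finite and cover all indices. This serves twice: for runs grouped into
  cycles and for times grouped into runs.\<close>

lemma INFM_blocks:
  fixes c :: "nat \<Rightarrow> nat"
  assumes c: "c 0 = 0" "\<And>k. c k < c (Suc k)"
    and Q: "\<And>k. Q k \<longleftrightarrow> (\<exists>j. c k \<le> j \<and> j < c (Suc k) \<and> P j)"
  shows "(\<exists>\<^sub>\<infinity>j. P j) \<longleftrightarrow> (\<exists>\<^sub>\<infinity>k. Q k)"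
proof -
  have mono: "strict_mono c" using c(2) by (rule strict_monoI_Suc)
  have ge: "k \<le> c k" for k using mono by (rule strict_mono_imp_increasing)
  have ex: "\<exists>k. c k \<le> j \<and> j < c (Suc k)" for j
  proof -
    define k where "k = (LEAST k. j < c (Suc k))"
    have k: "j < c (Suc k)" unfolding k_def by (rule LeastI[of _ j]) (use ge[of "Suc j"] in simp)
    have "c k \<le> j"
    proof (cases k)
      case (Suc k')
      have "\<not> j < c (Suc k')" using not_less_Least[of k' "\<lambda>k. j < c (Suc k)"] Suc by (simp add: k_def)
      then show ?thesis using Suc by simp
    qed (simp add: c(1))
    with k show ?thesis by blast
  qed
  show ?thesis
    unfolding INFM_nat_le
  proof (intro iffI allI)
    fix K assume *: "\<forall>m. \<exists>n\<ge>m. P n"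
    then obtain j where j: "c K \<le> j" "P j" by blast
    obtain k where k: "c k \<le> j" "j < c (Suc k)" using ex by blast
    have "K \<le> k"
    proof (rule ccontr)
      assume "\<not> K \<le> k"
      then have "c (Suc k) \<le> c K" using mono by (simp add: strict_mono_less_eq)
      with j k show False by simp
    qed
    with j k show "\<exists>n\<ge>K. Q n" unfolding Q by blast
  next
    fix N assume *: "\<forall>m. \<exists>n\<ge>m. Q n"
    then obtain k where "N \<le> k" "Q k" by blast
    then show "\<exists>n\<ge>N. P n" unfolding Q using ge[of k] by (meson order_trans)
  qed
qed

context drrw_parameters
begin

lemma run_hits_concat_words:
  assumes ne: "\<And>k. s !! k \<noteq> []"
  shows "(\<exists>\<^sub>\<infinity>j. run_hit j (concat_words s)) \<longleftrightarrow> (\<exists>\<^sub>\<infinity>k. word_hit k s)"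
proof (rule INFM_blocks[where c="\<lambda>k. length (concat (stake k s))"])
  show "length (concat (stake k s)) < length (concat (stake (Suc k) s))" for k
    unfolding stake_Suc using ne[of k] by simp
  fix k
  let ?c = "length (concat (stake k s))"
  have Suc: "concat (stake (Suc k) s) = concat (stake k s) @ s !! k"
    unfolding stake_Suc by simp
  have run: "run_hit (?c + i) (concat_words s) \<longleftrightarrow>
      hits_origin (word_path k s + displacement (take i (s !! k))) [s !! k ! i]" if "i < length (s !! k)" for i
  proof -
    have "stake (?c + i) (concat_words s) = concat (stake k s) @ take i (s !! k)"
      using that by (subst stake_concat_words[OF ne, of _ "Suc k"]) (simp_all add: Suc del: stake.simps)
    moreover have "concat_words s !! (?c + i) = s !! k ! i"
      using that by (subst concat_words_snth[OF ne, of _ "Suc k"]) (simp_all add: Suc del: stake.simps)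
    ultimately show ?thesis
      by (simp add: run_hit_def displacement_append displacement_concat stream_path_def)
  qed
  have "word_hit k s \<longleftrightarrow> (\<exists>i<length (s !! k). run_hit (?c + i) (concat_words s))"
    unfolding word_hit_def by (subst hits_origin_iff_run) (use run in blast)
  also have "\<dots> \<longleftrightarrow> (\<exists>j. ?c \<le> j \<and> j < length (concat (stake (Suc k) s)) \<and> run_hit j (concat_words s))"
    unfolding Suc length_append by (rule ex_offset_iff)
  finally show "word_hit k s \<longleftrightarrow> (\<exists>j. ?c \<le> j \<and> j < length (concat (stake (Suc k) s)) \<and> run_hit j (concat_words s))" .
qed simp

abbreviation starts_east :: "(dir \<times> nat) list stream \<Rightarrow> bool" where
  "starts_east s \<equiv> fst (hd (shd s)) = East"

lemma pred_starts_east [measurable]: "Measurable.pred (stream_space (count_space UNIV)) starts_east"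
  by (rule measurable_compose[OF measurable_shd]) simp

lemma prob_starts_east: "words.S.prob {s. starts_east s} = 1 / 2"
proof -
  let ?P = "pair_pmf (block_pmf \<nu>\<^sub>h p\<^sub>h) (block_pmf \<nu>\<^sub>v p\<^sub>v)"
  have "words.S.prob {s. starts_east s} = measure_pmf.prob ?P {z. fst (hd (cycle_word z)) = East}"
    using words.prob_stake[of "\<lambda>ws. fst (hd (hd ws)) = East" 1]
    unfolding replicate_pmf_1 word_pmf_def measure_map_pmf by (simp add: vimage_def)
  also have "\<dots> = measure_pmf.prob ?P {z. fst (fst z) = 1}"
  proof (rule measure_pmf.finite_measure_eq_AE)
    show "AE z in measure_pmf ?P. z \<in> {z. fst (hd (cycle_word z)) = East} \<longleftrightarrow> z \<in> {z. fst (fst z) = 1}"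
    proof (rule AE_pmfI)
      fix z assume "z \<in> set_pmf ?P"
      then obtain \<epsilon> ls \<delta> ms where "z = ((\<epsilon>, ls), (\<delta>, ms))" "ls \<noteq> []" "\<epsilon> \<in> {- 1, 1}"
        using set_pmf_block_subset[of \<nu>\<^sub>h p\<^sub>h] by fastforce
      then show "z \<in> {z. fst (hd (cycle_word z)) = East} \<longleftrightarrow> z \<in> {z. fst (fst z) = 1}"
        by (cases ls) (auto simp: hdir_def)
    qed
  qed auto
  also have "\<dots> = measure_pmf.prob (map_pmf fst (map_pmf fst ?P)) {1}"
    unfolding measure_map_pmf by (rule arg_cong[where f="measure _"]) auto
  also have "\<dots> = 1 / 2"
    unfolding map_fst_pair_pmf block_pmf_def by (simp add: measure_pmf_single)
  finally show ?thesis .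
qed

end

section \<open>The sequence of runs as a conditioned stream of words\<close>

context drrw
begin

definition run_stream :: "'a \<Rightarrow> (dir \<times> nat) stream" where
  "run_stream \<omega> = to_stream (\<lambda>i. (D i \<omega>, len i \<omega>))"

lemma stake_run_stream: "stake n (run_stream \<omega>) = runs n \<omega>"
  by (simp add: run_stream_def stake_to_stream runs_def)

lemma pred_stake_concat_words:
  fixes A :: "(dir \<times> nat) list set"
  shows "Measurable.pred (stream_space (count_space UNIV)) (\<lambda>s. stake n (concat_words s) \<in> A)"
proof -
  have "stake n (concat_words s) = map (\<lambda>i. concat (take (Suc i) (stake n s)) ! i) [0..<n]" for s :: "(dir \<times> nat) list stream"
    by (auto simp: concat_words_def stake_to_stream take_stake min_def simp del: stake.simps)
  then show ?thesis
    using pred_stake[of "\<lambda>ws. map (\<lambda>i. concat (take (Suc i) ws) ! i) [0..<n] \<in> A" n] by (simp only:)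
qed

lemma measurable_concat_words [measurable]:
  "concat_words \<in> measurable words.S (stream_space (count_space (UNIV :: (dir \<times> nat) set)))"
proof (rule measurable_stream_space2)
  fix i
  have "(\<lambda>s. (\<lambda>ws. concat ws ! i) (stake (Suc i) s)) \<in> measurable (stream_space (count_space UNIV)) (count_space (UNIV :: (dir \<times> nat) set))"
    by (rule measurable_compose[OF measurable_stake]) simp
  then show "(\<lambda>s. concat_words s !! i) \<in> measurable words.S (count_space UNIV)"
    unfolding concat_words_def to_stream_snth measurable_cong_sets[OF words.sets_S refl] .
qed

text \<open>The inequality of \<open>runs_ge_words\<close> holds for \<open>A\<close> and for its
  complement, and the totals agree because a word starts east with probability 1/2; hence there is
  equality.\<close>

lemma prob_runs_words:
  "prob {\<omega> \<in> space M. runs n \<omega> \<in> A} =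
    2 * words.S.prob {s. starts_east s \<and> stake n (concat_words s) \<in> A}"
proof -
  let ?Q = "\<lambda>A. {s. starts_east s \<and> stake n (concat_words s) \<in> A}"
  let ?R = "\<lambda>A ws. fst (hd (concat ws)) = East \<and> take n (concat ws) \<in> A"
  have Q[measurable]: "?Q A \<in> words.S.events" for A
    by (rule words.pred_imp_event) (intro pred_intros_logic pred_starts_east pred_stake_concat_words)
  have R: "{s. ?R A (stake (Suc n) s)} \<in> words.S.events" for A
    by (rule words.pred_imp_event) (rule pred_stake)
  \<comment> \<open>\<open>Suc n\<close> words instead of \<open>n\<close>, so that the first word,
    which decides \<open>starts_east\<close>, is present also for \<open>n = 0\<close>.\<close>
  have S_eq: "words.S.prob (?Q A) = measure_pmf.prob (replicate_pmf (Suc n) word_pmf) {ws. ?R A ws}" for A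
  proof -
    have "AE s in words.S. s \<in> ?Q A \<longleftrightarrow> s \<in> {s. ?R A (stake (Suc n) s)}"
      using AE_words
    proof eventually_elim
      case (elim s)
      then have ne: "s !! k \<noteq> []" for k using hd_word by blast
      have "n \<le> length (concat (stake (Suc n) s))" using length_concat_stake[OF ne, of "Suc n"] by simp
      moreover have "hd (concat (stake (Suc n) s)) = hd (shd s)" using ne[of 0] by simp
      ultimately show ?case by (simp add: stake_concat_words[OF ne, of n "Suc n"] del: stake.simps)
    qed
    then have "words.S.prob (?Q A) = words.S.prob {s. ?R A (stake (Suc n) s)}"
      by (rule words.S.finite_measure_eq_AE[OF _ Q R])
    also have "\<dots> = measure_pmf.prob (replicate_pmf (Suc n) word_pmf) {ws. ?R A ws}"
      by (rule words.prob_stake)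
    finally show ?thesis .
  qed
  have ge: "2 * words.S.prob (?Q A) \<le> prob {\<omega> \<in> space M. runs n \<omega> \<in> A}" for A
  proof -
    have "ennreal (2 * words.S.prob (?Q A)) \<le> ennreal (prob {\<omega> \<in> space M. runs n \<omega> \<in> A})"
      using runs_ge_words[of n "Suc n" A] unfolding S_eq
      by (simp add: emeasure_eq_measure measure_pmf.emeasure_eq_measure ennreal_mult)
    then show ?thesis by simp
  qed
  have u1: "{\<omega> \<in> space M. runs n \<omega> \<in> A} \<union> {\<omega> \<in> space M. runs n \<omega> \<in> - A} = space M"
    by blast
  have u2: "?Q A \<union> ?Q (- A) = {s. starts_east s}"
    by blast
  have "prob ({\<omega> \<in> space M. runs n \<omega> \<in> A} \<union> {\<omega> \<in> space M. runs n \<omega> \<in> - A}) =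
      prob {\<omega> \<in> space M. runs n \<omega> \<in> A} + prob {\<omega> \<in> space M. runs n \<omega> \<in> - A}"
    by (rule finite_measure_Union[OF runs_event runs_event]) blast
  then have s1: "1 = prob {\<omega> \<in> space M. runs n \<omega> \<in> A} + prob {\<omega> \<in> space M. runs n \<omega> \<in> - A}"
    unfolding u1 prob_space .
  have "words.S.prob (?Q A \<union> ?Q (- A)) = words.S.prob (?Q A) + words.S.prob (?Q (- A))"
    by (rule words.S.finite_measure_Union[OF Q Q]) blast
  then have s2: "1 / 2 = words.S.prob (?Q A) + words.S.prob (?Q (- A))"
    unfolding u2 prob_starts_east .
  show ?thesis
    using ge[of A] ge[of "- A"] s1 s2 by linarith
qed

lemma measurable_run_stream [measurable]:
  "run_stream \<in> measurable M (stream_space (count_space UNIV))"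
  by (rule measurable_stream_space2) (simp add: run_stream_def run_rv)

text \<open>A law on streams is determined by its cylinders, and these are compared by
  \<open>prob_runs_words\<close>. Conditioning on \<open>starts_east\<close> is expressed by the
  density 2 on that event.\<close>

lemma prob_run_stream:
  assumes P: "Measurable.pred (stream_space (count_space UNIV)) P"
  shows "prob {\<omega> \<in> space M. P (run_stream \<omega>)} = 2 * words.S.prob {s. starts_east s \<and> P (concat_words s)}"
proof -
  let ?SS = "stream_space (count_space (UNIV :: (dir \<times> nat) set))"
  let ?E = "{s. starts_east s}"
  have E[measurable]: "?E \<in> words.S.events" by (rule words.pred_imp_event) measurable
  let ?N1 = "distr M ?SS run_stream"
  let ?d = "density words.S (\<lambda>s. 2 * indicator ?E s)"
  let ?N2 = "distr ?d ?SS concat_words"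
  have cw: "concat_words \<in> measurable ?d ?SS" by measurable
  have em2: "emeasure ?N2 A = 2 * emeasure words.S (?E \<inter> concat_words -` A)" if [measurable]: "A \<in> sets ?SS" for A
  proof -
    have [measurable]: "concat_words -` A \<in> words.S.events"
      using measurable_sets[OF measurable_concat_words that] by simp
    have "emeasure ?N2 A = emeasure ?d (concat_words -` A)"
      by (subst emeasure_distr) (auto simp: cw)
    also have "\<dots> = (\<integral>\<^sup>+s. 2 * indicator (?E \<inter> concat_words -` A) s \<partial>words.S)"
      by (subst emeasure_density) (auto intro!: nn_integral_cong simp: indicator_def)
    also have "\<dots> = 2 * emeasure words.S (?E \<inter> concat_words -` A)"
      by (subst nn_integral_cmult) auto
    finally show ?thesis .
  qed
  have "?N1 = ?N2"
  proof (rule stream_space_eq_sstart[where S=UNIV])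
    show "prob_space ?N1" by (rule prob_space_distr) measurable
    show "prob_space ?N2"
    proof
      have half: "(2 :: ennreal) * ennreal (1 / 2) = 1"
      proof -
        have "1 = ennreal (2 * (1 / 2))" by simp
        also have "\<dots> = ennreal 2 * ennreal (1 / 2)" by (rule ennreal_mult) auto
        also have "ennreal 2 = 2" by simp
        finally show ?thesis by (rule sym)
      qed
      have "emeasure ?N2 UNIV = 2 * emeasure words.S ?E"
        using em2[of UNIV] sets.top[of ?SS] by (simp add: space_stream_space)
      also have "\<dots> = 1"
        unfolding words.S.emeasure_eq_measure prob_starts_east by (rule half)
      finally show "emeasure ?N2 (space ?N2) = 1"
        by (simp add: space_stream_space)
    qed
    fix xs :: "(dir \<times> nat) list"
    have "emeasure ?N1 (sstart UNIV xs) = emeasure M {\<omega> \<in> space M. runs (length xs) \<omega> \<in> {xs}}"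
      by (subst emeasure_distr)
        (auto simp: sstart_UNIV_eq stake_run_stream intro!: arg_cong[where f="emeasure M"] sets_sstart[where \<Omega>=UNIV, unfolded sstart_UNIV_eq])
    also have "\<dots> = ennreal (2 * words.S.prob {s. starts_east s \<and> stake (length xs) (concat_words s) \<in> {xs}})"
      unfolding emeasure_eq_measure prob_runs_words ..
    also have "{s. starts_east s \<and> stake (length xs) (concat_words s) \<in> {xs}} = ?E \<inter> concat_words -` sstart UNIV xs"
      by (auto simp: sstart_UNIV_eq)
    also have "ennreal (2 * words.S.prob (?E \<inter> concat_words -` sstart UNIV xs)) = emeasure ?N2 (sstart UNIV xs)"
      by (subst em2) (auto simp: words.S.emeasure_eq_measure ennreal_mult intro: sets_sstart)
    finally show "emeasure ?N1 (sstart UNIV xs) = emeasure ?N2 (sstart UNIV xs)" .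
  qed auto
  have PS: "{y. P y} \<in> sets ?SS" using P by (simp add: pred_def space_stream_space)
  have "emeasure M {\<omega> \<in> space M. P (run_stream \<omega>)} = emeasure ?N1 {y. P y}"
    by (subst emeasure_distr) (auto simp: PS intro!: arg_cong[where f="emeasure M"])
  also have "\<dots> = 2 * emeasure words.S (?E \<inter> concat_words -` {y. P y})"
    unfolding \<open>?N1 = ?N2\<close> by (rule em2[OF PS])
  also have "?E \<inter> concat_words -` {y. P y} = {s. starts_east s \<and> P (concat_words s)}" by auto
  finally have "ennreal (prob {\<omega> \<in> space M. P (run_stream \<omega>)}) = ennreal (2 * words.S.prob {s. starts_east s \<and> P (concat_words s)})"
    by (simp add: emeasure_eq_measure words.S.emeasure_eq_measure ennreal_mult)
  then show ?thesis by simp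
qed

end

section \<open>From runs to the walk\<close>

lemma (in prob_space) distr_map_iid:
  fixes X :: "'i \<Rightarrow> 'a \<Rightarrow> 'b::countable" and f :: "nat \<Rightarrow> 'i"
  assumes indep: "indep_vars (\<lambda>_. count_space UNIV) X UNIV" and f: "inj f"
    and law: "\<And>i. distr M (count_space UNIV) (X (f i)) = measure_pmf \<mu>"
  shows "distr M (count_space UNIV) (\<lambda>\<omega>. map (\<lambda>i. X (f i) \<omega>) [0..<n]) = measure_pmf (replicate_pmf n \<mu>)"
proof -
  have rv[measurable]: "X k \<in> measurable M (count_space UNIV)" for k
    using indep unfolding indep_vars_def by simp
  let ?Y = "\<lambda>\<omega>. map (\<lambda>i. X (f i) \<omega>) [0..<n]"
  have Y_iff: "?Y \<omega> = xs \<longleftrightarrow> length xs = n \<and> (\<forall>i<n. X (f i) \<omega> = xs ! i)" for xs \<omega>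
    by (auto simp: list_eq_iff_nth_eq)
  have Y: "?Y \<in> measurable M (count_space UNIV)"
    by (rule measurable_map_countable) (rule rv)
  show ?thesis
  proof (rule measure_eqI_countable[where A=UNIV])
    fix xs :: "'b list"
    have eq: "prob {\<omega> \<in> space M. X (f i) \<omega> = x} = pmf \<mu> x" for i x
    proof -
      have "prob {\<omega> \<in> space M. X (f i) \<omega> = x} = measure (distr M (count_space UNIV) (X (f i))) {x}"
        by (subst measure_distr) (auto intro!: arg_cong[where f=prob])
      then show ?thesis by (simp add: law measure_pmf_single)
    qed
    have "emeasure (distr M (count_space UNIV) ?Y) {xs} = emeasure M {\<omega> \<in> space M. ?Y \<omega> = xs}"
      by (subst emeasure_distr[OF Y]) (auto intro!: arg_cong[where f="emeasure M"])
    also have "\<dots> = ennreal (pmf (replicate_pmf n \<mu>) xs)"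
    proof (cases "length xs = n")
      case True
      then have "prob {\<omega> \<in> space M. ?Y \<omega> = xs} = (\<Prod>i<n. pmf \<mu> (xs ! i))"
        unfolding Y_iff using indep_vars_prob_eq[OF indep f, of n "(!) xs"] by (simp add: eq)
      also have "\<dots> = prod_list (map (pmf \<mu>) xs)"
        using True by (simp add: prod.list_conv_set_nth lessThan_atLeast0)
      also have "\<dots> = pmf (replicate_pmf n \<mu>) xs"
        using True by (rule pmf_replicate_pmf[symmetric])
      finally show ?thesis by (simp add: emeasure_eq_measure)
    next
      case False
      then have "pmf (replicate_pmf n \<mu>) xs = 0" by (auto simp: pmf_eq_0_set_pmf set_replicate_pmf)
      then show ?thesis using False unfolding Y_iff by simp
    qed
    finally show "emeasure (distr M (count_space UNIV) ?Y) {xs} = emeasure (measure_pmf (replicate_pmf n \<mu>)) {xs}"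
      by (simp add: emeasure_pmf_single)
  qed auto
qed

lemma replicate_pmf_Suc_snoc:
  "replicate_pmf (Suc n) \<mu> = map_pmf (\<lambda>(xs, x). xs @ [x]) (pair_pmf (replicate_pmf n \<mu>) \<mu>)"
  using replicate_pmf_distrib[of n 1 \<mu>]
  unfolding replicate_pmf_1 by (simp add: map_pmf_def pair_pmf_def bind_assoc_pmf bind_return_pmf)

text \<open>The jumps of both walks form one independent family indexed by a sum type;
  \<open>f\<close> selects those of one walk and is \<open>Inl\<close> or \<open>Inr\<close> in the
  applications.\<close>

locale iid_walk = prob_space M for M :: "'b measure" +
  fixes X :: "'i \<Rightarrow> 'b \<Rightarrow> int" and f :: "nat \<Rightarrow> 'i" and W :: "nat \<Rightarrow> 'b \<Rightarrow> int" and \<mu> :: "int pmf"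
  assumes indep: "indep_vars (\<lambda>_. count_space UNIV) X UNIV" and f: "inj f"
    and law: "\<And>i. distr M (count_space UNIV) (X (f i)) = measure_pmf \<mu>"
    and start: "\<And>\<omega>. \<omega> \<in> space M \<Longrightarrow> W 0 \<omega> = 0"
    and jump: "\<And>i \<omega>. X (f i) \<omega> = W (Suc i) \<omega> - W i \<omega>"
begin

lemma walk_eq_sum_list: "\<omega> \<in> space M \<Longrightarrow> W n \<omega> = sum_list (map (\<lambda>i. X (f i) \<omega>) [0..<n])"
  by (induction n) (simp_all add: start jump)

lemma prob_jumps:
  "prob {\<omega> \<in> space M. P (map (\<lambda>i. X (f i) \<omega>) [0..<n])} = measure_pmf.prob (replicate_pmf n \<mu>) {xs. P xs}"
proof -
  have "X k \<in> measurable M (count_space UNIV)" for k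
    using indep unfolding indep_vars_def by simp
  then have "(\<lambda>\<omega>. map (\<lambda>i. X (f i) \<omega>) [0..<n]) \<in> measurable M (count_space UNIV)"
    by (intro measurable_map_countable)
  then show ?thesis
    unfolding distr_map_iid[OF indep f law, symmetric]
    by (subst measure_distr) (auto intro!: arg_cong[where f=prob])
qed

lemma prob_return: "prob {\<omega> \<in> space M. W n \<omega> = 0} = ret_prob \<mu> n"
proof -
  have "prob {\<omega> \<in> space M. W n \<omega> = 0} = prob {\<omega> \<in> space M. sum_list (map (\<lambda>i. X (f i) \<omega>) [0..<n]) = 0}"
    by (intro arg_cong[where f=prob] Collect_cong conj_cong refl) (simp add: walk_eq_sum_list)
  also have "\<dots> = measure_pmf.prob (replicate_pmf n \<mu>) {xs. sum_list xs = 0}"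
    by (rule prob_jumps)
  also have "\<dots> = measure_pmf.prob (walk_pmf \<mu> n) {0}"
    unfolding map_sum_list_replicate_pmf[symmetric] measure_map_pmf
    by (rule arg_cong[where f="measure _"]) auto
  finally show ?thesis by (simp add: ret_prob_def measure_pmf_single)
qed

lemma prob_straddle:
  "prob {\<omega> \<in> space M. 0 \<le> W n \<omega> \<and> W n \<omega> \<le> W (Suc n) \<omega> - W n \<omega>} = straddle_prob \<mu> n"
proof -
  let ?P = "\<lambda>xs. 0 \<le> sum_list (butlast xs) \<and> sum_list (butlast xs) \<le> last xs"
  have "prob {\<omega> \<in> space M. 0 \<le> W n \<omega> \<and> W n \<omega> \<le> W (Suc n) \<omega> - W n \<omega>} =
      prob {\<omega> \<in> space M. ?P (map (\<lambda>i. X (f i) \<omega>) [0..<Suc n])}"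
    by (rule arg_cong[where f=prob], rule Collect_cong, rule conj_cong[OF refl])
      (simp add: walk_eq_sum_list butlast_append)
  also have "\<dots> = measure_pmf.prob (replicate_pmf (Suc n) \<mu>) {xs. ?P xs}"
    by (rule prob_jumps)
  also have "\<dots> = measure_pmf.prob (pair_pmf (replicate_pmf n \<mu>) \<mu>) {(xs, x). 0 \<le> sum_list xs \<and> sum_list xs \<le> x}"
    unfolding replicate_pmf_Suc_snoc measure_map_pmf by (rule arg_cong[where f="measure _"]) auto
  also have "\<dots> = straddle_prob \<mu> n"
    unfolding straddle_prob_def map_sum_list_replicate_pmf[symmetric] pair_map_pmf1 measure_map_pmf
    by (rule arg_cong[where f="measure _"]) auto
  finally show ?thesis .
qed

end

lemma suminf_ennreal_eq_top_iff:
  fixes f :: "nat \<Rightarrow> real"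
  assumes "\<And>n. 0 \<le> f n"
  shows "(\<Sum>n. ennreal (f n)) = \<infinity> \<longleftrightarrow> \<not> summable f"
proof
  assume top: "(\<Sum>n. ennreal (f n)) = \<infinity>"
  show "\<not> summable f"
  proof
    assume "summable f"
    then have "(\<Sum>n. ennreal (f n)) = ennreal (\<Sum>n. f n)" by (intro suminf_ennreal2 assms)
    with top show False by simp
  qed
next
  assume "\<not> summable f"
  then show "(\<Sum>n. ennreal (f n)) = \<infinity>"
    using summable_suminf_not_top[of f, OF assms] by auto
qed

section \<open>Visits of the walk in terms of its runs\<close>

context drrw
begin

abbreviation walk :: "nat \<Rightarrow> 'a \<Rightarrow> int \<times> int" where "walk \<equiv> drrw_walk D \<tau>\<^sub>h \<tau>\<^sub>v"

definition start_time :: "nat \<Rightarrow> 'a \<Rightarrow> nat" where "start_time j \<omega> = (\<Sum>i<j. len i \<omega>)"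

lemma AE_len_pos: "AE \<omega> in M. \<forall>i. 0 < len i \<omega>"
proof -
  have "AE \<omega> in M. 0 < \<tau> k \<omega>" for k
  proof (rule AE_distrD[OF \<tau>_rv])
    show "AE l in distr M (count_space UNIV) (\<tau> k). 0 < l"
    proof -
      have law: "distr M (count_space UNIV) (\<tau> k) = measure_pmf (case k of Inl _ \<Rightarrow> \<nu>\<^sub>h | Inr _ \<Rightarrow> \<nu>\<^sub>v)"
        unfolding \<tau>_def by (cases k) (simp_all add: \<tau>h_law \<tau>v_law)
      show ?thesis
        unfolding law AE_measure_pmf_iff using persistence_pos by (cases k) (auto intro!: gr0I)
    qed
  qed
  then have "AE \<omega> in M. \<forall>k. 0 < \<tau> k \<omega>" by (simp add: AE_all_countable)
  then show ?thesis by eventually_elim (simp add: len_eq_clock)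
qed

lemma run_at_eq:
  assumes pos: "\<And>i. 0 < len i \<omega>" and m: "start_time j \<omega> \<le> m" "m < start_time (Suc j) \<omega>"
  shows "run_at D \<tau>\<^sub>h \<tau>\<^sub>v m \<omega> = j"
proof -
  have mono: "start_time i \<omega> \<le> start_time k \<omega>" if "i \<le> k" for i k
    unfolding start_time_def by (rule sum_mono2) (use that in auto)
  have "run_at D \<tau>\<^sub>h \<tau>\<^sub>v m \<omega> = (LEAST j. m < start_time (Suc j) \<omega>)"
    by (simp add: run_at_def start_time_def len_def lessThan_Suc_atMost del: sum.lessThan_Suc)
  also have "\<dots> = j"
  proof (rule Least_equality)
    show "m < start_time (Suc j) \<omega>" by (rule m(2))
    fix k assume "m < start_time (Suc k) \<omega>"
    then show "j \<le> k" using mono[of "Suc k" j] m(1) by (cases "Suc k \<le> j") auto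
  qed
  finally show ?thesis .
qed

lemma walk_Suc: "walk (Suc m) \<omega> = walk m \<omega> + step (D (run_at D \<tau>\<^sub>h \<tau>\<^sub>v m \<omega>) \<omega>)"
  by (simp add: drrw_walk_def)

text \<open>Both ends of the run are included: the end of run \<open>j\<close> is the base point
  from which the induction treats the next run.\<close>

lemma walk_run:
  assumes pos: "\<And>i. 0 < len i \<omega>" and t: "t \<le> len j \<omega>"
  shows "walk (start_time j \<omega> + t) \<omega> =
    displacement (runs j \<omega>) + (int t * fst (step (D j \<omega>)), int t * snd (step (D j \<omega>)))"
  using t
proof (induction j arbitrary: t)
  case (Suc j)
  have base: "walk (start_time (Suc j) \<omega>) \<omega> = displacement (runs (Suc j) \<omega>)"
    using Suc.IH[of "len j \<omega>"] by (simp add: start_time_def runs_def displacement_append zero_prod_def[symmetric])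
  show ?case using Suc.prems
  proof (induction t)
    case (Suc t)
    then have "run_at D \<tau>\<^sub>h \<tau>\<^sub>v (start_time (Suc j) \<omega> + t) \<omega> = Suc j"
      by (intro run_at_eq[OF pos]) (auto simp: start_time_def)
    with Suc show ?case
      by (simp add: walk_Suc prod_eq_iff algebra_simps)
  qed (simp add: base zero_prod_def[symmetric])
next
  case 0
  then show ?case
  proof (induction t)
    case (Suc t)
    then have "run_at D \<tau>\<^sub>h \<tau>\<^sub>v (start_time 0 \<omega> + t) \<omega> = 0"
      by (intro run_at_eq[OF pos]) (auto simp: start_time_def)
    with Suc show ?case
      by (simp add: walk_Suc prod_eq_iff algebra_simps)
  qed (simp add: start_time_def drrw_walk_def runs_def zero_prod_def[symmetric])
qed

text \<open>Times are grouped into half-open run intervals, whereas \<open>run_hit\<close> uses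
  closed ones. A visit at the end of run \<open>j\<close> is the first time of run
  \<open>Suc j\<close>, whose interval is nonempty because lengths are positive; so
  \<open>run_hit j\<close> yields \<open>Q j\<close> or \<open>Q (Suc j)\<close>.\<close>

lemma infinite_visits_iff:
  assumes pos: "\<And>i. 0 < len i \<omega>"
  shows "infinite {n. walk n \<omega> = (0, 0)} \<longleftrightarrow> (\<exists>\<^sub>\<infinity>j. run_hit j (run_stream \<omega>))"
proof -
  let ?T = "\<lambda>j. start_time j \<omega>"
  define Q where "Q j \<longleftrightarrow> (\<exists>n. ?T j \<le> n \<and> n < ?T (Suc j) \<and> walk n \<omega> = 0)" for j
  have T_Suc: "?T (Suc j) = ?T j + len j \<omega>" for j by (simp add: start_time_def)
  have hit: "run_hit j (run_stream \<omega>) \<longleftrightarrow> (\<exists>t\<le>len j \<omega>. walk (?T j + t) \<omega> = 0)" for j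
  proof -
    have "run_stream \<omega> !! j = (D j \<omega>, len j \<omega>)" by (simp add: run_stream_def)
    then have "run_hit j (run_stream \<omega>) \<longleftrightarrow> (\<exists>t\<le>len j \<omega>. displacement (runs j \<omega>) +
        (int t * fst (step (D j \<omega>)), int t * snd (step (D j \<omega>))) = 0)"
      by (simp add: run_hit_def stake_run_stream)
    then show ?thesis using walk_run[OF pos, of _ j] by metis
  qed
  have "infinite {n. walk n \<omega> = (0, 0)} \<longleftrightarrow> (\<exists>\<^sub>\<infinity>n. walk n \<omega> = 0)"
    by (simp add: frequently_cofinite zero_prod_def)
  also have "\<dots> \<longleftrightarrow> (\<exists>\<^sub>\<infinity>j. Q j)"
    by (rule INFM_blocks[where c="?T"]) (use pos in \<open>auto simp: start_time_def Q_def\<close>)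
  also have "\<dots> \<longleftrightarrow> (\<exists>\<^sub>\<infinity>j. run_hit j (run_stream \<omega>))"
  proof
    assume "\<exists>\<^sub>\<infinity>j. Q j"
    then show "\<exists>\<^sub>\<infinity>j. run_hit j (run_stream \<omega>)"
    proof (rule INFM_mono)
      fix j assume "Q j"
      then obtain n where "?T j \<le> n" "n < ?T (Suc j)" "walk n \<omega> = 0" unfolding Q_def by blast
      then show "run_hit j (run_stream \<omega>)"
        unfolding hit by (intro exI[of _ "n - ?T j"]) (auto simp: T_Suc)
    qed
  next
    assume *: "\<exists>\<^sub>\<infinity>j. run_hit j (run_stream \<omega>)"
    have "Q j \<or> Q (Suc j)" if hj: "run_hit j (run_stream \<omega>)" for j
    proof -
      obtain t where t: "t \<le> len j \<omega>" "walk (?T j + t) \<omega> = 0" using hj unfolding hit by blast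
      show ?thesis
      proof (cases "t = len j \<omega>")
        case True
        then have "Q (Suc j)" using t pos[of "Suc j"] unfolding Q_def
          by (intro exI[of _ "?T (Suc j)"]) (auto simp: T_Suc)
        then show ?thesis ..
      next
        case False
        then have "Q j" using t unfolding Q_def by (intro exI[of _ "?T j + t"]) (auto simp: T_Suc)
        then show ?thesis ..
      qed
    qed
    with * show "\<exists>\<^sub>\<infinity>j. Q j"
      unfolding INFM_nat_le by (meson le_SucI)
  qed
  finally show ?thesis .
qed

lemma measurable_add_countable:
  fixes f g :: "'a \<Rightarrow> 'g::{countable,plus}"
  assumes f: "f \<in> measurable M (count_space UNIV)" and g: "g \<in> measurable M (count_space UNIV)"
  shows "(\<lambda>\<omega>. f \<omega> + g \<omega>) \<in> measurable M (count_space UNIV)"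
  by (rule measurable_compose_countable[where f="\<lambda>x \<omega>. x + g \<omega>" and g=f])
    (rule measurable_compose[OF g], simp, rule f)

lemma walk_rv: "random_variable (count_space UNIV) (walk n)"
proof (induction n)
  case (Suc n)
  have "run_at D \<tau>\<^sub>h \<tau>\<^sub>v n \<in> measurable M (count_space UNIV)"
    unfolding run_at_def[abs_def] len_def[symmetric] by measurable
  then have "(\<lambda>\<omega>. D (run_at D \<tau>\<^sub>h \<tau>\<^sub>v n \<omega>) \<omega>) \<in> measurable M (count_space UNIV)"
    by (rule measurable_compose_countable[where f=D, rotated]) (rule D_rv)
  then have "(\<lambda>\<omega>. step (D (run_at D \<tau>\<^sub>h \<tau>\<^sub>v n \<omega>) \<omega>)) \<in> measurable M (count_space UNIV)"
    by (rule measurable_compose) simp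
  from measurable_add_countable[OF Suc.IH this] show ?case by (simp add: walk_Suc)
qed (simp add: drrw_walk_def)

lemma prob_infinite_visits:
  "prob {\<omega> \<in> space M. infinite {n. walk n \<omega> = (0, 0)}} =
    2 * words.S.prob {s. starts_east s \<and> (\<exists>\<^sub>\<infinity>k. word_hit k s)}"
proof -
  have [measurable]: "Measurable.pred (stream_space (count_space UNIV)) (\<lambda>y. \<exists>\<^sub>\<infinity>j. run_hit j y)"
    unfolding INFM_nat_le by measurable
  have "prob {\<omega> \<in> space M. infinite {n. walk n \<omega> = (0, 0)}} =
      prob {\<omega> \<in> space M. \<exists>\<^sub>\<infinity>j. run_hit j (run_stream \<omega>)}"
  proof (rule finite_measure_eq_AE)
    show "AE \<omega> in M. \<omega> \<in> {\<omega> \<in> space M. infinite {n. walk n \<omega> = (0, 0)}} \<longleftrightarrow>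
        \<omega> \<in> {\<omega> \<in> space M. \<exists>\<^sub>\<infinity>j. run_hit j (run_stream \<omega>)}"
      using AE_len_pos by eventually_elim (simp add: infinite_visits_iff)
    have [measurable]: "Measurable.pred M (\<lambda>\<omega>. walk n \<omega> = (0, 0))" for n
      by (rule measurable_compose[OF walk_rv]) simp
    show "{\<omega> \<in> space M. infinite {n. walk n \<omega> = (0, 0)}} \<in> events"
      unfolding frequently_cofinite[symmetric] INFM_nat_le by measurable
    show "{\<omega> \<in> space M. \<exists>\<^sub>\<infinity>j. run_hit j (run_stream \<omega>)} \<in> events"
      by measurable
  qed
  also have "\<dots> = 2 * words.S.prob {s. starts_east s \<and> (\<exists>\<^sub>\<infinity>j. run_hit j (concat_words s))}"
    by (rule prob_run_stream) measurable
  also have "words.S.prob {s. starts_east s \<and> (\<exists>\<^sub>\<infinity>j. run_hit j (concat_words s))} =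
      words.S.prob {s. starts_east s \<and> (\<exists>\<^sub>\<infinity>k. word_hit k s)}"
  proof (rule words.S.finite_measure_eq_AE)
    show "AE s in words.S. s \<in> {s. starts_east s \<and> (\<exists>\<^sub>\<infinity>j. run_hit j (concat_words s))} \<longleftrightarrow>
        s \<in> {s. starts_east s \<and> (\<exists>\<^sub>\<infinity>k. word_hit k s)}"
      using AE_words
    proof eventually_elim
      case (elim s)
      then have "s !! k \<noteq> []" for k using hd_word by blast
      from run_hits_concat_words[OF this] show ?case by simp
    qed
    have "Measurable.pred words.S (\<lambda>s. \<exists>\<^sub>\<infinity>j. run_hit j (concat_words s))"
      by (rule measurable_compose[OF measurable_concat_words]) measurable
    moreover have "Measurable.pred words.S starts_east" by measurable
    ultimately have "Measurable.pred words.S (\<lambda>s. starts_east s \<and> (\<exists>\<^sub>\<infinity>j. run_hit j (concat_words s)))"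
      by measurable
    then show "{s. starts_east s \<and> (\<exists>\<^sub>\<infinity>j. run_hit j (concat_words s))} \<in> words.S.events"
      by (simp add: pred_def)
    show "{s. starts_east s \<and> (\<exists>\<^sub>\<infinity>k. word_hit k s)} \<in> words.S.events"
      unfolding INFM_nat_le by (rule words.pred_imp_event) measurable
  qed
  finally show ?thesis .
qed

text \<open>Infinitely many word hits have probability 0 or 1. Intersecting with
  \<open>starts_east\<close> leaves 0 or 1/2, and the factor 2 of the conditioning restores 0 or
  1.\<close>

lemma origin_recurrent_iff:
  "origin_recurrent M walk \<longleftrightarrow> \<not> summable return_v \<or> \<not> summable return_h"
proof -
  let ?I = "{s. \<exists>\<^sub>\<infinity>k. word_hit k s}" and ?E = "{s. starts_east s}"
  have I: "?I \<in> words.S.events"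
    unfolding INFM_nat_le by (rule words.pred_imp_event) measurable
  have E: "?E \<in> words.S.events"
    by (rule words.pred_imp_event) measurable
  have EI: "{s. starts_east s \<and> (\<exists>\<^sub>\<infinity>k. word_hit k s)} = ?E \<inter> ?I" by auto
  show ?thesis
  proof (cases "summable return_v \<and> summable return_h")
    case True
    then have "words.S.prob ?I = 0" using word_hits_finite by blast
    then have "words.S.prob (?E \<inter> ?I) = 0"
      using words.S.finite_measure_mono[of "?E \<inter> ?I" ?I] I measure_nonneg[of words.S "?E \<inter> ?I"] by auto
    then show ?thesis using True unfolding origin_recurrent_def prob_infinite_visits EI by simp
  next
    case False
    then have "words.S.prob ?I = 1" using word_hits_infinite by blast
    then have "AE s in words.S. s \<in> ?I" using words.S.prob_eq_1[OF I] by simp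
    then have "words.S.prob (?E \<inter> ?I) = words.S.prob ?E"
      by (intro words.S.finite_measure_eq_AE) (auto intro: E I sets.Int elim!: eventually_mono)
    then show ?thesis using False unfolding origin_recurrent_def prob_infinite_visits EI
      by (auto simp: prob_starts_east)
  qed
qed

end

theorem corollary2p1:
  fixes M :: "'a measure" and N :: "'b measure"
    and \<nu>\<^sub>h \<nu>\<^sub>v :: "nat pmf" and p\<^sub>h p\<^sub>v :: real
    and D :: "nat \<Rightarrow> 'a \<Rightarrow> dir" and \<tau>\<^sub>h \<tau>\<^sub>v :: "nat \<Rightarrow> 'a \<Rightarrow> nat"
    and H V :: "nat \<Rightarrow> 'b \<Rightarrow> int"
  assumes "drrw M \<nu>\<^sub>h \<nu>\<^sub>v p\<^sub>h p\<^sub>v D \<tau>\<^sub>h \<tau>\<^sub>v"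
    and "associated_walks N \<nu>\<^sub>h \<nu>\<^sub>v p\<^sub>h p\<^sub>v H V"
  shows "origin_recurrent M (drrw_walk D \<tau>\<^sub>h \<tau>\<^sub>v) \<longleftrightarrow>
    (\<Sum>n. ennreal (measure N {\<omega> \<in> space N. H (n + 1) \<omega> = 0} *
        measure N {\<omega> \<in> space N. 0 \<le> V n \<omega> \<and> V n \<omega> \<le> V (n + 1) \<omega> - V n \<omega>})) = \<infinity> \<or>
    (\<Sum>n. ennreal (measure N {\<omega> \<in> space N. V (n + 1) \<omega> = 0} *
        measure N {\<omega> \<in> space N. 0 \<le> H n \<omega> \<and> H n \<omega> \<le> H (n + 1) \<omega> - H n \<omega>})) = \<infinity>"
proof -
  interpret drrw M \<nu>\<^sub>h \<nu>\<^sub>v p\<^sub>h p\<^sub>v D \<tau>\<^sub>h \<tau>\<^sub>v by fact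
  interpret N: associated_walks N \<nu>\<^sub>h \<nu>\<^sub>v p\<^sub>h p\<^sub>v H V by fact
  let ?X = "case_sum (\<lambda>n \<omega>. H (Suc n) \<omega> - H n \<omega>) (\<lambda>n \<omega>. V (Suc n) \<omega> - V n \<omega>)"
  interpret H: iid_walk N ?X Inl H "\<mu>\<^sub>h"
    by unfold_locales (auto simp: N.jumps_indep N.H_jump_law N.start)
  interpret V: iid_walk N ?X Inr V "\<mu>\<^sub>v"
    by unfold_locales (auto simp: N.jumps_indep N.V_jump_law N.start)
  have rv: "return_v n = measure N {\<omega> \<in> space N. H (n + 1) \<omega> = 0} *
      measure N {\<omega> \<in> space N. 0 \<le> V n \<omega> \<and> V n \<omega> \<le> V (n + 1) \<omega> - V n \<omega>}" for n
    using H.prob_return[of "Suc n"] V.prob_straddle[of n] by (simp add: return_v_def)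
  have rh: "return_h n = measure N {\<omega> \<in> space N. V (n + 1) \<omega> = 0} *
      measure N {\<omega> \<in> space N. 0 \<le> H n \<omega> \<and> H n \<omega> \<le> H (n + 1) \<omega> - H n \<omega>}" for n
    using V.prob_return[of "Suc n"] H.prob_straddle[of n] by (simp add: return_h_def)
  have nonneg: "0 \<le> return_v n" "0 \<le> return_h n" for n
    by (simp_all add: return_v_def return_h_def ret_prob_def v.straddle_prob_nonneg h.straddle_prob_nonneg)
  show ?thesis
    unfolding rv[symmetric] rh[symmetric]
    unfolding origin_recurrent_iff suminf_ennreal_eq_top_iff[OF nonneg(1)] suminf_ennreal_eq_top_iff[OF nonneg(2)] ..
qed

end
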